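(* Let $(G_i)_{i\in I}$ be a sequence of groups (viewed as $\mathcal{L}$-structures) and for each $i\in I$ let $H_i\le G_i$ be any finite subgroup. Let $D$ be an ultrafilter on $I$, let $\mathcal{G}=\prod_D G_i$, regarded as a small elementary submodel of a monster model $\mathcal{U}$, let $\mu_i:=\frac{1}{|H_i|}\sum_{h\in H_i}\delta_h$, and let $\mu=\lim_D\mu_i\in\mathfrak{M}_x(\mathcal{G})$. If $\mathcal{G}$ is NIP, then $\hat\mu\in\mathfrak{M}_x(\mathcal{U})$ is a generically stable idempotent Keisler measure.
   Context: $\mathcal{L}$ is a first-order language containing the language of groups, and each $G_i$ is an $\mathcal{L}$-structure expanding a group; $I$ is an infinite index set and $D$ is non-principal. $\mathcal{U}$ is a monster model of the theory of $\mathcal{G}$, with $\mathcal{G}\prec\mathcal{U}$ small. $x,y$ are single variables of the group sort. For $A\subseteq\mathcal{U}$, $\mathcal{L}_x(A)$ is the set of formulas with parameters from $A$ and free variable $x$ (modulo equivalence), and $\mathfrak{M}_x(A)$ is the space of Keisler measures, i.e. finitely additive probability measures on $\mathcal{L}_x(A)$. $\delta_h$ is the Dirac measure at $\mathrm{tp}(h/G_i)$. Ultralimit: for $\mu_i\in\mathfrak{M}_x(G_i)$, $\lim_D\mu_i\in\mathfrak{M}_x(\mathcal{G})$ is the measure with $(\lim_D\mu_i)(\varphi(x,\mathbf{b}))=\lim_D\mu_i(\varphi(x,\mathbf{b}(i)))$ for all $\varphi(x,\mathbf{b})\in\mathcal{L}_x(\mathcal{G})$, where $(\mathbf{b}(i))_{i\in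 I}$ represents $\mathbf{b}$. Definability: $\mu\in\mathfrak{M}_x(M)$ is $M$-definable if for every $\mathcal{L}$-formula $\varphi(x,z)$ ($z$ a finite tuple) there is a (necessarily unique) continuous $F^\varphi_{\mu,M}:S_z(M)\to[0,1]$ with $F^\varphi_{\mu,M}(\mathrm{tp}(b/M))=\mu(\varphi(x,b))$ for all $b\in M^z$. A global measure $\lambda\in\mathfrak{M}_x(\mathcal{U})$ is definable over a small model $G$ if $\lambda|_G$ is $G$-definable and $\lambda(\varphi(x,b))=F^\varphi_{\lambda|_G,G}(\mathrm{tp}(b/G))$ for every $\mathcal{L}$-formula $\varphi(x,z)$ and every $b$ from $\mathcal{U}$. If $\mu\in\mathfrak{M}_x(M)$ is $M$-definable, $\hat\mu\in\mathfrak{M}_x(\mathcal{U})$ denotes the unique global measure extending $\mu$ that is definable over $M$. (It is known that when $\mathcal{G}$ is NIP, an ultralimit $\mu$ of measures each concentrating on finitely many realized types is finitely approximated and hence $\mathcal{G}$-definable, so $\hat\mu$ is defined.) Global Morley product and convolution: if $\lambda\in\mathfrak{M}_x(\mathcal{U})$ is definable over $G$ and $\nu\in\mathfrak{M}_y(\mathcal{U})$, then $(\lambda\tilde\otimes\nu)(\varphi(x,y,b))=\int_{S_y(Gb)}F^{\varphi_b}_{\lambda,Gb}\,d(\nu|_{Gb})$, where $F^{\varphi_b}_{\lambda,Gb}(q)=\lambda(\varphi(x,c,b))$ for any $c\models q$ in $\mathcal{U}$, and $\nu|_{Gb}$ is identified with the corresponding regular Borel probability measure on $S_y(Gb)$.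 The convolution $\lambda*\nu\in\mathfrak{M}_x(\mathcal{U})$ is given by $(\lambda*\nu)(\varphi(x))=(\lambda\tilde\otimes\nu)(\varphi(x\cdot y))$ for $\varphi(x)\in\mathcal{L}_x(\mathcal{U})$ (with $\nu$ viewed in the variable $y$). A definable $\lambda$ is idempotent if $\lambda*\lambda=\lambda$. Generic stability: in an NIP theory, a global Keisler measure is generically stable if for some small model $M\prec\mathcal{U}$ it is definable over $M$ and finitely satisfiable in $M$ (every formula over $\mathcal{U}$ of positive measure is satisfied by a tuple from $M$); equivalently, for some small $M$, for every $\mathcal{L}$-formula $\varphi(x,z)$ and $\epsilon>0$ there are $a_1,\dots,a_n\in M$ whose average measure is uniformly within $\epsilon$ of it on all instances $\varphi(x,b)$, $b\in\mathcal{U}^z$. *)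

theory Defs
  imports "HOL-Probability.Probability" "HOL-Algebra.Group"
begin

unbundle cardinal_syntax

section \<open>Many-sorted first-order logic\<close>

text \<open>
  The symbols of a language are all the elements of the types \<open>'s\<close> (sorts), \<open>'f\<close> (functions) and
  \<open>'r\<close> (relations). The last four fields single out the language of groups on one sort.
\<close>

record ('s, 'f, 'r) glang =
  fdom :: "'f \<Rightarrow> 's list"
  fcod :: "'f \<Rightarrow> 's"
  rdom :: "'r \<Rightarrow> 's list"
  gsort :: 's
  gmul :: 'f
  ginv :: 'f
  gone :: 'f

definition group_lang :: "('s, 'f, 'r) glang \<Rightarrow> bool" where
  "group_lang L \<longleftrightarrow>
     fdom L (gmul L) = [gsort L, gsort L] \<and> fcod L (gmul L) = gsort L \<and>
     fdom L (ginv L) = [gsort L] \<and> fcod L (ginv L) = gsort L \<and>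
     fdom L (gone L) = [] \<and> fcod L (gone L) = gsort L"

text \<open>
  Locally nameless syntax: \<open>Var\<close> is a free variable, \<open>Bnd n\<close> the variable bound by the \<open>n\<close>-th
  enclosing quantifier, \<open>Par\<close> a parameter. Substituting terms without \<open>Bnd\<close> for free variables
  therefore never causes capture.
\<close>

datatype (tfv: 'v, dead 'f, tpar: 'c) tm =
    Var 'v
  | Bnd nat
  | Par 'c
  | Fn 'f "('v, 'f, 'c) tm list"

datatype (fv: 'v, dead 's, dead 'f, dead 'r, par: 'c) fm =
    Fls
  | Eq "('v, 'f, 'c) tm" "('v, 'f, 'c) tm"
  | Rel 'r "('v, 'f, 'c) tm list"
  | Neg "('v, 's, 'f, 'r, 'c) fm"
  | Disj "('v, 's, 'f, 'r, 'c) fm" "('v, 's, 'f, 'r, 'c) fm"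
  | Ex 's "('v, 's, 'f, 'r, 'c) fm"

type_synonym 's var = "'s \<times> nat"

type_synonym ('s, 'f, 'a) trm = "('s var, 'f, 's \<times> 'a) tm"

type_synonym ('s, 'f, 'r, 'a) form = "('s var, 's, 'f, 'r, 's \<times> 'a) fm"

text \<open>In \<open>tm_ok\<close> and \<open>fm_ok\<close>, the list \<open>B\<close> gives the sorts of the bound variables in scope.\<close>

fun tm_ok :: "('s, 'f, 'r) glang \<Rightarrow> 's list \<Rightarrow> ('s, 'f, 'a) trm \<Rightarrow> 's \<Rightarrow> bool" where
  "tm_ok L B (Var w) s \<longleftrightarrow> fst w = s"
| "tm_ok L B (Bnd n) s \<longleftrightarrow> n < length B \<and> B ! n = s"
| "tm_ok L B (Par c) s \<longleftrightarrow> fst c = s"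
| "tm_ok L B (Fn f ts) s \<longleftrightarrow> fcod L f = s \<and> list_all2 (tm_ok L B) ts (fdom L f)"

fun fm_ok :: "('s, 'f, 'r) glang \<Rightarrow> 's list \<Rightarrow> ('s, 'f, 'r, 'a) form \<Rightarrow> bool" where
  "fm_ok L B Fls \<longleftrightarrow> True"
| "fm_ok L B (Eq t u) \<longleftrightarrow> (\<exists>s. tm_ok L B t s \<and> tm_ok L B u s)"
| "fm_ok L B (Rel r ts) \<longleftrightarrow> list_all2 (tm_ok L B) ts (rdom L r)"
| "fm_ok L B (Neg \<phi>) \<longleftrightarrow> fm_ok L B \<phi>"
| "fm_ok L B (Disj \<phi> \<psi>) \<longleftrightarrow> fm_ok L B \<phi> \<and> fm_ok L B \<psi>"
| "fm_ok L B (Ex s \<phi>) \<longleftrightarrow> fm_ok L (s # B) \<phi>"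

text \<open>
  \<open>forms L Z A\<close>: formulas with free variables in \<open>Z\<close> and parameters from the set \<open>A\<close> of sorted
  elements. Formulas without parameters are those in \<open>forms L Z {}\<close>.
\<close>

definition forms :: "('s, 'f, 'r) glang \<Rightarrow> 's var set \<Rightarrow> ('s \<times> 'a) set \<Rightarrow> ('s, 'f, 'r, 'a) form set"
  where "forms L Z A = {\<phi>. fm_ok L [] \<phi> \<and> fv \<phi> \<subseteq> Z \<and> par \<phi> \<subseteq> A}"

fun tsubst :: "('v \<Rightarrow> ('w, 'f, 'c) tm) \<Rightarrow> ('v, 'f, 'c) tm \<Rightarrow> ('w, 'f, 'c) tm" where
  "tsubst \<sigma> (Var w) = \<sigma> w"
| "tsubst \<sigma> (Bnd n) = Bnd n"
| "tsubst \<sigma> (Par c) = Par c"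
| "tsubst \<sigma> (Fn f ts) = Fn f (map (tsubst \<sigma>) ts)"

fun subst :: "('v \<Rightarrow> ('w, 'f, 'c) tm) \<Rightarrow> ('v, 's, 'f, 'r, 'c) fm \<Rightarrow> ('w, 's, 'f, 'r, 'c) fm" where
  "subst \<sigma> Fls = Fls"
| "subst \<sigma> (Eq t u) = Eq (tsubst \<sigma> t) (tsubst \<sigma> u)"
| "subst \<sigma> (Rel r ts) = Rel r (map (tsubst \<sigma>) ts)"
| "subst \<sigma> (Neg \<phi>) = Neg (subst \<sigma> \<phi>)"
| "subst \<sigma> (Disj \<phi> \<psi>) = Disj (subst \<sigma> \<phi>) (subst \<sigma> \<psi>)"
| "subst \<sigma> (Ex s \<phi>) = Ex s (subst \<sigma> \<phi>)"

text \<open>If \<open>\<phi>\<close> is \<open>\<phi>(x,z)\<close> and \<open>Z\<close> is the set of variables of \<open>z\<close>, then \<open>inst Z b \<phi>\<close> is \<open>\<phi>(x,b)\<close>.\<close>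

definition inst :: "'s var set \<Rightarrow> ('s var \<Rightarrow> 'a) \<Rightarrow> ('s, 'f, 'r, 'a) form \<Rightarrow> ('s, 'f, 'r, 'a) form"
  where "inst Z b = subst (\<lambda>w. if w \<in> Z then Par (fst w, b w) else Var w)"

abbreviation map_par ::
  "('s \<Rightarrow> 'a \<Rightarrow> 'b) \<Rightarrow> ('s, 'f, 'r, 'a) form \<Rightarrow> ('s, 'f, 'r, 'b) form"
  where "map_par g \<equiv> map_fm id (\<lambda>(s, a). (s, g s a))"


section \<open>Structures\<close>

record ('s, 'f, 'r, 'a) struct =
  carr :: "'s \<Rightarrow> 'a set"
  fint :: "'f \<Rightarrow> 'a list \<Rightarrow> 'a"
  rint :: "'r \<Rightarrow> 'a list \<Rightarrow> bool"

definition args :: "('s, 'f, 'r, 'a) struct \<Rightarrow> 's list \<Rightarrow> 'a list set" where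
  "args M ss = {as. list_all2 (\<lambda>a s. a \<in> carr M s) as ss}"

definition is_struct :: "('s, 'f, 'r) glang \<Rightarrow> ('s, 'f, 'r, 'a) struct \<Rightarrow> bool" where
  "is_struct L M \<longleftrightarrow>
     (\<forall>s. carr M s \<noteq> {}) \<and> (\<forall>f. \<forall>as \<in> args M (fdom L f). fint M f as \<in> carr M (fcod L f))"

definition elts :: "('s, 'f, 'r, 'a) struct \<Rightarrow> ('s \<times> 'a) set" where
  "elts M = {(s, a). a \<in> carr M s}"

text \<open>\<open>assign M Z\<close> is \<open>M\<^sup>z\<close>; values of an assignment outside \<open>Z\<close> are irrelevant.\<close>

definition assign :: "('s, 'f, 'r, 'a) struct \<Rightarrow> 's var set \<Rightarrow> ('s var \<Rightarrow> 'a) set" where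
  "assign M Z = {b. \<forall>w \<in> Z. b w \<in> carr M (fst w)}"

fun tval :: "('s, 'f, 'r, 'a) struct \<Rightarrow> ('s var \<Rightarrow> 'a) \<Rightarrow> 'a list \<Rightarrow> ('s, 'f, 'a) trm \<Rightarrow> 'a" where
  "tval M v e (Var w) = v w"
| "tval M v e (Bnd n) = e ! n"
| "tval M v e (Par c) = snd c"
| "tval M v e (Fn f ts) = fint M f (map (tval M v e) ts)"

fun sat :: "('s, 'f, 'r, 'a) struct \<Rightarrow> ('s var \<Rightarrow> 'a) \<Rightarrow> 'a list \<Rightarrow> ('s, 'f, 'r, 'a) form \<Rightarrow> bool"
where
  "sat M v e Fls \<longleftrightarrow> False"
| "sat M v e (Eq t u) \<longleftrightarrow> tval M v e t = tval M v e u"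
| "sat M v e (Rel r ts) \<longleftrightarrow> rint M r (map (tval M v e) ts)"
| "sat M v e (Neg \<phi>) \<longleftrightarrow> \<not> sat M v e \<phi>"
| "sat M v e (Disj \<phi> \<psi>) \<longleftrightarrow> sat M v e \<phi> \<or> sat M v e \<psi>"
| "sat M v e (Ex s \<phi>) \<longleftrightarrow> (\<exists>a \<in> carr M s. sat M v (a # e) \<phi>)"

definition isomorphism ::
  "('s, 'f, 'r) glang \<Rightarrow> ('s, 'f, 'r, 'a) struct \<Rightarrow> ('s, 'f, 'r, 'b) struct \<Rightarrow> ('s \<Rightarrow> 'a \<Rightarrow> 'b) \<Rightarrow> bool"
where
  "isomorphism L M N j \<longleftrightarrow>
     (\<forall>s. bij_betw (j s) (carr M s) (carr N s)) \<and>
     (\<forall>f. \<forall>as \<in> args M (fdom L f).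
        j (fcod L f) (fint M f as) = fint N f (map2 j (fdom L f) as)) \<and>
     (\<forall>r. \<forall>as \<in> args M (rdom L r). rint M r as \<longleftrightarrow> rint N r (map2 j (rdom L r) as))"

definition elementary_map ::
  "('s, 'f, 'r) glang \<Rightarrow> ('s, 'f, 'r, 'a) struct \<Rightarrow> ('s \<times> 'a) set \<Rightarrow> ('s, 'f, 'r, 'a) struct \<Rightarrow>
     ('s \<Rightarrow> 'a \<Rightarrow> 'a) \<Rightarrow> bool"
where
  "elementary_map L M A N g \<longleftrightarrow>
     (\<forall>(s, a) \<in> A. g s a \<in> carr N s) \<and>
     (\<forall>\<phi> \<in> forms L UNIV {}. \<forall>v. (\<forall>w \<in> fv \<phi>. (fst w, v w) \<in> A) \<longrightarrow>
        (sat M v [] \<phi> \<longleftrightarrow> sat N (\<lambda>w. g (fst w) (v w)) [] \<phi>))"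

definition elementary_substruct ::
  "('s, 'f, 'r) glang \<Rightarrow> ('s, 'f, 'r, 'a) struct \<Rightarrow> ('s, 'f, 'r, 'a) struct \<Rightarrow> bool"
where
  "elementary_substruct L M N \<longleftrightarrow>
     is_struct L M \<and> is_struct L N \<and> elementary_map L M (elts M) N (\<lambda>s a. a)"

text \<open>The group on the group sort; \<open>expands_group\<close> also fixes the interpretation of the inverse.\<close>

definition grp :: "('s, 'f, 'r) glang \<Rightarrow> ('s, 'f, 'r, 'a) struct \<Rightarrow> 'a monoid" where
  "grp L M = \<lparr>carrier = carr M (gsort L), mult = (\<lambda>a b. fint M (gmul L) [a, b]),
              one = fint M (gone L) []\<rparr>"

definition expands_group :: "('s, 'f, 'r) glang \<Rightarrow> ('s, 'f, 'r, 'a) struct \<Rightarrow> bool" where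
  "expands_group L M \<longleftrightarrow> is_struct L M \<and> group (grp L M) \<and>
     (\<forall>a \<in> carr M (gsort L). fint M (ginv L) [a] = inv\<^bsub>grp L M\<^esub> a)"

text \<open>NIP: no partitioned formula \<open>\<phi>(X;Z)\<close> shatters sets of tuples of every finite size.\<close>

definition NIP :: "('s, 'f, 'r) glang \<Rightarrow> ('s, 'f, 'r, 'a) struct \<Rightarrow> bool" where
  "NIP L M \<longleftrightarrow>
     (\<forall>X Z. \<forall>\<phi> \<in> forms L (X \<union> Z) {}. finite X \<and> finite Z \<and> X \<inter> Z = {} \<longrightarrow>
        (\<exists>n::nat. \<not> (\<exists>a b. (\<forall>k<n. a k \<in> assign M X) \<and> (\<forall>S \<subseteq> {..<n}. b S \<in> assign M Z) \<and>
           (\<forall>k<n. \<forall>S \<subseteq> {..<n}.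
              sat M (\<lambda>w. if w \<in> X then a k w else b S w) [] \<phi> \<longleftrightarrow> k \<in> S))))"


section \<open>Type spaces and monster models\<close>

text \<open>\<open>types L M Z A\<close> is the space of complete types over \<open>A\<close> (a subset of \<open>M\<close>) in the variables \<open>Z\<close>.\<close>

definition types ::
  "('s, 'f, 'r) glang \<Rightarrow> ('s, 'f, 'r, 'a) struct \<Rightarrow> 's var set \<Rightarrow> ('s \<times> 'a) set \<Rightarrow>
     ('s, 'f, 'r, 'a) form set set"
where
  "types L M Z A =
     {p. p \<subseteq> forms L Z A \<and>
         (\<forall>q \<subseteq> p. finite q \<longrightarrow> (\<exists>b \<in> assign M Z. \<forall>\<phi> \<in> q. sat M b [] \<phi>)) \<and>
         (\<forall>\<phi> \<in> forms L Z A. \<phi> \<in> p \<or> Neg \<phi> \<in> p)}"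

definition tp ::
  "('s, 'f, 'r) glang \<Rightarrow> ('s, 'f, 'r, 'a) struct \<Rightarrow> 's var set \<Rightarrow> ('s \<times> 'a) set \<Rightarrow> ('s var \<Rightarrow> 'a) \<Rightarrow>
     ('s, 'f, 'r, 'a) form set"
where
  "tp L M Z A b = {\<phi> \<in> forms L Z A. sat M b [] \<phi>}"

definition basic_clopen ::
  "('s, 'f, 'r) glang \<Rightarrow> ('s, 'f, 'r, 'a) struct \<Rightarrow> 's var set \<Rightarrow> ('s \<times> 'a) set \<Rightarrow>
     ('s, 'f, 'r, 'a) form \<Rightarrow> ('s, 'f, 'r, 'a) form set set"
where
  "basic_clopen L M Z A \<phi> = {p \<in> types L M Z A. \<phi> \<in> p}"

definition type_topology ::
  "('s, 'f, 'r) glang \<Rightarrow> ('s, 'f, 'r, 'a) struct \<Rightarrow> 's var set \<Rightarrow> ('s \<times> 'a) set \<Rightarrow>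
     ('s, 'f, 'r, 'a) form set topology"
where
  "type_topology L M Z A = topology_generated_by (basic_clopen L M Z A ` forms L Z A)"

text \<open>
  A monster model is \<open>\<kappa>\<close>-saturated and strongly \<open>\<kappa>\<close>-homogeneous for an uncountable cardinal \<open>\<kappa>\<close>
  larger than the language; small means of cardinality less than \<open>\<kappa>\<close>.
\<close>

definition saturated ::
  "('s, 'f, 'r) glang \<Rightarrow> 'k rel \<Rightarrow> ('s, 'f, 'r, 'u) struct \<Rightarrow> bool"
where
  "saturated L \<kappa> U \<longleftrightarrow>
     (\<forall>A w. \<forall>p \<in> types L U {w} A. A \<subseteq> elts U \<and> |A| <o \<kappa> \<longrightarrow>
        (\<exists>a \<in> carr U (fst w). tp L U {w} A (\<lambda>_. a) = p))"

definition strongly_homogeneous ::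
  "('s, 'f, 'r) glang \<Rightarrow> 'k rel \<Rightarrow> ('s, 'f, 'r, 'u) struct \<Rightarrow> bool"
where
  "strongly_homogeneous L \<kappa> U \<longleftrightarrow>
     (\<forall>A g. A \<subseteq> elts U \<and> |A| <o \<kappa> \<and> elementary_map L U A U g \<longrightarrow>
        (\<exists>\<sigma>. isomorphism L U U \<sigma> \<and> (\<forall>(s, a) \<in> A. \<sigma> s a = g s a)))"

definition monster_model ::
  "('s, 'f, 'r) glang \<Rightarrow> 'k rel \<Rightarrow> ('s, 'f, 'r, 'u) struct \<Rightarrow> bool"
where
  "monster_model L \<kappa> U \<longleftrightarrow>
     Card_order \<kappa> \<and> |UNIV :: nat set| <o \<kappa> \<and>
     |UNIV :: 's set| <o \<kappa> \<and> |UNIV :: 'f set| <o \<kappa> \<and> |UNIV :: 'r set| <o \<kappa> \<and>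
     is_struct L U \<and> saturated L \<kappa> U \<and> strongly_homogeneous L \<kappa> U"

definition small_model ::
  "('s, 'f, 'r) glang \<Rightarrow> 'k rel \<Rightarrow> ('s, 'f, 'r, 'u) struct \<Rightarrow> ('s, 'f, 'r, 'u) struct \<Rightarrow> bool"
where
  "small_model L \<kappa> U M \<longleftrightarrow> elementary_substruct L M U \<and> |elts M| <o \<kappa>"


section \<open>Keisler measures\<close>

text \<open>
  A Keisler measure over \<open>A\<close>, a subset of \<open>M\<close>, is a function on formulas that respects equivalence
  in \<open>M\<close>. It is \<open>undefined\<close> off \<open>forms L {x} A\<close>, so that equality of measures is equality of functions.
\<close>

definition keisler ::
  "('s, 'f, 'r) glang \<Rightarrow> ('s, 'f, 'r, 'a) struct \<Rightarrow> 's var \<Rightarrow> ('s \<times> 'a) set \<Rightarrow>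
     (('s, 'f, 'r, 'a) form \<Rightarrow> real) \<Rightarrow> bool"
where
  "keisler L M x A \<mu> \<longleftrightarrow>
     \<mu> \<in> extensional (forms L {x} A) \<and>
     (\<forall>\<phi> \<in> forms L {x} A. 0 \<le> \<mu> \<phi>) \<and>
     \<mu> (Neg Fls) = 1 \<and>
     (\<forall>\<phi> \<in> forms L {x} A. \<forall>\<psi> \<in> forms L {x} A.
        (\<forall>b \<in> assign M {x}. sat M b [] \<phi> \<longleftrightarrow> sat M b [] \<psi>) \<longrightarrow> \<mu> \<phi> = \<mu> \<psi>) \<and>
     (\<forall>\<phi> \<in> forms L {x} A. \<forall>\<psi> \<in> forms L {x} A.
        (\<forall>b \<in> assign M {x}. \<not> (sat M b [] \<phi> \<and> sat M b [] \<psi>)) \<longrightarrow> \<mu> (Disj \<phi> \<psi>) = \<mu> \<phi> + \<mu> \<psi>)"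

definition dirac_tp :: "('s, 'f, 'r, 'a) form set \<Rightarrow> ('s, 'f, 'r, 'a) form \<Rightarrow> real" where
  "dirac_tp p \<phi> = (if \<phi> \<in> p then 1 else 0)"

definition uniform_measure_on ::
  "('s, 'f, 'r) glang \<Rightarrow> ('s, 'f, 'r, 'a) struct \<Rightarrow> 's var \<Rightarrow> 'a set \<Rightarrow>
     ('s, 'f, 'r, 'a) form \<Rightarrow> real"
where
  "uniform_measure_on L M x H =
     (\<lambda>\<phi> \<in> forms L {x} (elts M).
        1 / real (card H) * (\<Sum>h \<in> H. dirac_tp (tp L M {x} (elts M) (\<lambda>_. h)) \<phi>))"

text \<open>\<open>F\<close> is the map \<open>F\<^sup>\<phi>\<close> of \<open>\<mu>\<close> over \<open>M\<close>; it is unique as realized types are dense.\<close>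

definition defining_map ::
  "('s, 'f, 'r) glang \<Rightarrow> ('s, 'f, 'r, 'a) struct \<Rightarrow> (('s, 'f, 'r, 'a) form \<Rightarrow> real) \<Rightarrow>
     's var set \<Rightarrow> ('s, 'f, 'r, 'a) form \<Rightarrow> (('s, 'f, 'r, 'a) form set \<Rightarrow> real) \<Rightarrow> bool"
where
  "defining_map L M \<mu> Z \<phi> F \<longleftrightarrow>
     continuous_map (type_topology L M Z (elts M)) (top_of_set {0..1}) F \<and>
     (\<forall>b \<in> assign M Z. F (tp L M Z (elts M) b) = \<mu> (inst Z b \<phi>))"

text \<open>
  \<open>definable_over L \<kappa> U x G \<rho>\<close>: the restriction of the global measure \<open>\<rho>\<close> to \<open>G\<close> is \<open>G\<close>-definable, and
  its maps \<open>F\<^sup>\<phi>\<close> compute \<open>\<lambda>\<close> on all instances of \<open>\<phi>\<close> over \<open>U\<close>.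
\<close>

definition definable_over ::
  "('s, 'f, 'r) glang \<Rightarrow> 'k rel \<Rightarrow> ('s, 'f, 'r, 'u) struct \<Rightarrow> 's var \<Rightarrow> ('s, 'f, 'r, 'u) struct \<Rightarrow>
     (('s, 'f, 'r, 'u) form \<Rightarrow> real) \<Rightarrow> bool"
where
  "definable_over L \<kappa> U x G \<rho> \<longleftrightarrow>
     small_model L \<kappa> U G \<and>
     (\<forall>Z. \<forall>\<phi> \<in> forms L (insert x Z) {}. finite Z \<and> x \<notin> Z \<longrightarrow>
        (\<exists>F. defining_map L G (restrict \<rho> (forms L {x} (elts G))) Z \<phi> F \<and>
             (\<forall>b \<in> assign U Z. \<rho> (inst Z b \<phi>) = F (tp L U Z (elts G) b))))"

definition hat ::
  "('s, 'f, 'r) glang \<Rightarrow> 'k rel \<Rightarrow> ('s, 'f, 'r, 'u) struct \<Rightarrow> 's var \<Rightarrow> ('s, 'f, 'r, 'u) struct \<Rightarrow>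
     (('s, 'f, 'r, 'u) form \<Rightarrow> real) \<Rightarrow> ('s, 'f, 'r, 'u) form \<Rightarrow> real"
where
  "hat L \<kappa> U x M \<mu> =
     (THE \<rho>. keisler L U x (elts U) \<rho> \<and> restrict \<rho> (forms L {x} (elts M)) = \<mu> \<and>
              definable_over L \<kappa> U x M \<rho>)"

definition finitely_satisfiable_in ::
  "('s, 'f, 'r) glang \<Rightarrow> ('s, 'f, 'r, 'u) struct \<Rightarrow> 's var \<Rightarrow> ('s, 'f, 'r, 'u) struct \<Rightarrow>
     (('s, 'f, 'r, 'u) form \<Rightarrow> real) \<Rightarrow> bool"
where
  "finitely_satisfiable_in L U x M \<rho> \<longleftrightarrow>
     (\<forall>\<phi> \<in> forms L {x} (elts U). \<rho> \<phi> > 0 \<longrightarrow> (\<exists>b \<in> assign M {x}. sat U b [] \<phi>))"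

definition generically_stable ::
  "('s, 'f, 'r) glang \<Rightarrow> 'k rel \<Rightarrow> ('s, 'f, 'r, 'u) struct \<Rightarrow> 's var \<Rightarrow>
     (('s, 'f, 'r, 'u) form \<Rightarrow> real) \<Rightarrow> bool"
where
  "generically_stable L \<kappa> U x \<rho> \<longleftrightarrow>
     (\<exists>M. small_model L \<kappa> U M \<and> definable_over L \<kappa> U x M \<rho> \<and> finitely_satisfiable_in L U x M \<rho>)"


section \<open>Morley product and convolution\<close>

definition regular_borel_prob :: "'p topology \<Rightarrow> 'p measure \<Rightarrow> bool" where
  "regular_borel_prob T N \<longleftrightarrow>
     prob_space N \<and> sets N = sigma_sets (topspace T) {V. openin T V} \<and>
     (\<forall>B \<in> sets N.
        emeasure N B = (INF V \<in> {V. openin T V \<and> B \<subseteq> V}. emeasure N V) \<and>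
        emeasure N B = (SUP K \<in> {K. compactin T K \<and> K \<subseteq> B}. emeasure N K))"

definition type_measure ::
  "('s, 'f, 'r) glang \<Rightarrow> ('s, 'f, 'r, 'a) struct \<Rightarrow> 's var \<Rightarrow> ('s \<times> 'a) set \<Rightarrow>
     (('s, 'f, 'r, 'a) form \<Rightarrow> real) \<Rightarrow> ('s, 'f, 'r, 'a) form set measure"
where
  "type_measure L M y A \<nu> =
     (THE N. regular_borel_prob (type_topology L M {y} A) N \<and>
             (\<forall>\<phi> \<in> forms L {y} A. measure N (basic_clopen L M {y} A \<phi>) = \<nu> \<phi>))"

text \<open>
  For a formula \<open>\<phi>\<close> in \<open>x\<close>, \<open>y\<close> over \<open>U\<close>, the set \<open>A\<close> below is \<open>Gb\<close>, with \<open>b\<close> the parameters of \<open>\<phi>\<close>;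
  the integrand does not depend on which realization of \<open>q\<close> is chosen.
\<close>

definition morley_product ::
  "('s, 'f, 'r) glang \<Rightarrow> ('s, 'f, 'r, 'u) struct \<Rightarrow> ('s, 'f, 'r, 'u) struct \<Rightarrow> 's var \<Rightarrow> 's var \<Rightarrow>
     (('s, 'f, 'r, 'u) form \<Rightarrow> real) \<Rightarrow> (('s, 'f, 'r, 'u) form \<Rightarrow> real) \<Rightarrow>
     ('s, 'f, 'r, 'u) form \<Rightarrow> real"
where
  "morley_product L U G x y \<rho> \<nu> =
     (\<lambda>\<phi> \<in> forms L {x, y} (elts U).
        let A = elts G \<union> par \<phi>;
            F = (\<lambda>q. let c = (SOME c. c \<in> carr U (fst y) \<and> tp L U {y} A (\<lambda>_. c) = q)
                     in \<rho> (inst {y} (\<lambda>_. c) \<phi>))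
        in \<integral>q. F q \<partial>(type_measure L U y A (restrict \<nu> (forms L {y} A))))"

definition in_variable ::
  "('s, 'f, 'r) glang \<Rightarrow> ('s, 'f, 'r, 'u) struct \<Rightarrow> 's var \<Rightarrow> 's var \<Rightarrow>
     (('s, 'f, 'r, 'u) form \<Rightarrow> real) \<Rightarrow> ('s, 'f, 'r, 'u) form \<Rightarrow> real"
where
  "in_variable L U x y \<nu> = (\<lambda>\<psi> \<in> forms L {y} (elts U). \<nu> (subst (Var(y := Var x)) \<psi>))"

definition convolution ::
  "('s, 'f, 'r) glang \<Rightarrow> ('s, 'f, 'r, 'u) struct \<Rightarrow> ('s, 'f, 'r, 'u) struct \<Rightarrow> 's var \<Rightarrow> 's var \<Rightarrow>
     (('s, 'f, 'r, 'u) form \<Rightarrow> real) \<Rightarrow> (('s, 'f, 'r, 'u) form \<Rightarrow> real) \<Rightarrow>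
     ('s, 'f, 'r, 'u) form \<Rightarrow> real"
where
  "convolution L U G x y \<rho> \<nu> =
     (\<lambda>\<phi> \<in> forms L {x} (elts U).
        morley_product L U G x y \<rho> (in_variable L U x y \<nu>)
          (subst (Var(x := Fn (gmul L) [Var x, Var y])) \<phi>))"

text \<open>The convolution is defined through a small model \<open>G\<close> over which \<open>\<rho>\<close> is definable, but is
  independent of it; idempotence is required for every such \<open>G\<close>.\<close>

definition idempotent_measure ::
  "('s, 'f, 'r) glang \<Rightarrow> 'k rel \<Rightarrow> ('s, 'f, 'r, 'u) struct \<Rightarrow> 's var \<Rightarrow> 's var \<Rightarrow>
     (('s, 'f, 'r, 'u) form \<Rightarrow> real) \<Rightarrow> bool"
where
  "idempotent_measure L \<kappa> U x y \<rho> \<longleftrightarrow>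
     (\<exists>G. definable_over L \<kappa> U x G \<rho>) \<and>
     (\<forall>G. definable_over L \<kappa> U x G \<rho> \<longrightarrow> convolution L U G x y \<rho> \<rho> = \<rho>)"


section \<open>Ultraproducts and ultralimits\<close>

definition ultrafilter :: "'i filter \<Rightarrow> bool" where
  "ultrafilter D \<longleftrightarrow> D \<noteq> bot \<and> (\<forall>P. eventually P D \<or> eventually (\<lambda>i. \<not> P i) D)"

definition nonprincipal :: "'i filter \<Rightarrow> bool" where
  "nonprincipal D \<longleftrightarrow> (\<forall>i. \<not> eventually (\<lambda>k. k = i) D)"

definition ultraclass ::
  "'i filter \<Rightarrow> ('i \<Rightarrow> ('s, 'f, 'r, 'a) struct) \<Rightarrow> 's \<Rightarrow> ('i \<Rightarrow> 'a) \<Rightarrow> ('i \<Rightarrow> 'a) set"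
where
  "ultraclass D G s g = {h \<in> (\<Pi> i\<in>UNIV. carr (G i) s). eventually (\<lambda>i. h i = g i) D}"

text \<open>The definitions below do not depend on the chosen representatives (for \<open>D\<close> an ultrafilter).\<close>

definition representative :: "('i \<Rightarrow> 'a) set \<Rightarrow> 'i \<Rightarrow> 'a" where
  "representative c = (SOME g. g \<in> c)"

definition ultraproduct ::
  "('s, 'f, 'r) glang \<Rightarrow> 'i filter \<Rightarrow> ('i \<Rightarrow> ('s, 'f, 'r, 'a) struct) \<Rightarrow>
     ('s, 'f, 'r, ('i \<Rightarrow> 'a) set) struct"
where
  "ultraproduct L D G =
     \<lparr>carr = (\<lambda>s. ultraclass D G s ` (\<Pi> i\<in>UNIV. carr (G i) s)),
      fint = (\<lambda>f cs. ultraclass D G (fcod L f)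
                       (\<lambda>i. fint (G i) f (map (\<lambda>c. representative c i) cs))),
      rint = (\<lambda>r cs. eventually (\<lambda>i. rint (G i) r (map (\<lambda>c. representative c i) cs)) D)\<rparr>"

definition ultralimit ::
  "('s, 'f, 'r) glang \<Rightarrow> 'i filter \<Rightarrow> ('i \<Rightarrow> ('s, 'f, 'r, 'a) struct) \<Rightarrow> 's var \<Rightarrow>
     ('i \<Rightarrow> ('s, 'f, 'r, 'a) form \<Rightarrow> real) \<Rightarrow> ('s, 'f, 'r, ('i \<Rightarrow> 'a) set) form \<Rightarrow> real"
where
  "ultralimit L D G x \<mu> =
     (\<lambda>\<phi> \<in> forms L {x} (elts (ultraproduct L D G)).
        Lim D (\<lambda>i. \<mu> i (map_par (\<lambda>s c. representative c i) \<phi>)))"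

text \<open>Transport of a measure over \<open>M\<close> along an isomorphism \<open>j\<close> from \<open>M\<close> onto \<open>N\<close>.\<close>

definition transport ::
  "('s, 'f, 'r) glang \<Rightarrow> ('s, 'f, 'r, 'a) struct \<Rightarrow> ('s, 'f, 'r, 'b) struct \<Rightarrow> ('s \<Rightarrow> 'a \<Rightarrow> 'b) \<Rightarrow>
     's var \<Rightarrow> (('s, 'f, 'r, 'a) form \<Rightarrow> real) \<Rightarrow> ('s, 'f, 'r, 'b) form \<Rightarrow> real"
where
  "transport L M N j x \<mu> =
     (\<lambda>\<phi> \<in> forms L {x} (elts N). \<mu> (map_par (\<lambda>s. inv_into (carr M s) (j s)) \<phi>))"

end

theory Submission
  imports Defs "HOL-Real_Asymp.Real_Asymp"
begin

text \<open>
  The proof rests on one consequence of NIP: the measure on the ultraproduct has uniform finite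
  samples, and they can be taken from the internal group that the subgroups \<open>H i\<close> define.

  By NIP and Los's theorem, the dimension of a formula \<open>\<psi>(x; z)\<close> is bounded by the same number in
  \<open>D\<close>-most factors (\<open>NIP_bounds_shattering\<close>). The Vapnik-Chervonenkis theorem
  (\<open>uniform_approximation\<close>) therefore gives, for each \<open>\<epsilon> > 0\<close>, a sample size \<open>n\<close> such that in \<open>D\<close>-most
  factors some \<open>n\<close> points of \<open>H i\<close> approximate the uniform measure on \<open>H i\<close> up to \<open>\<epsilon>\<close> at all instances
  of \<open>\<psi>\<close>, however large \<open>H i\<close> is. The classes of these points form a sample in the ultraproduct
  with the same property for the ultralimit (\<open>approximation_in_ultraproduct\<close>).

  Since every type over \<open>M\<close> is finitely satisfiable in \<open>M\<close>, two samples that are good over \<open>M\<close> have close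
  averages at all instances over \<open>U\<close>. The averages thus converge uniformly, and their limit \<open>\<rho>\<close> is
  a global measure; it is definable because a uniform limit of averages of clopen sets is
  continuous on the type space, and finitely satisfiable in \<open>M\<close> because the samples lie in \<open>M\<close>. A
  definable extension is determined by its values over \<open>M\<close>, realized types being dense, so \<open>\<rho>\<close> is
  the measure in question (\<open>hat_eq_\<rho>\<close>).

  For idempotence, translation by an element of \<open>H i\<close> preserves the uniform measure on \<open>H i\<close>. Hence
  translation by a sample point preserves the ultralimit (\<open>\<mu>_ltrans\<close>) and also \<open>\<rho>\<close>
  (\<open>\<rho>_invariant\<close>). The convolution at \<open>\<phi>\<close> is the integral of \<open>\<rho>(\<phi>(x \<cdot> c))\<close> in \<open>c\<close>; a sample turns it, up to
  \<open>\<epsilon>\<close>, into an average of measures of translates of \<open>\<phi>\<close>, all equal to \<open>\<rho>(\<phi>)\<close> (\<open>convolution_\<rho>\<close>).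

  The integral is taken with respect to a regular Borel measure given by a definite description, so
  existence and uniqueness of regular Borel extensions on type spaces are needed as well; they
  are obtained for arbitrary contents on clopen sets of a compact space (locale
  \<open>clopen_content\<close>).
\<close>

section \<open>Shattering and the growth of set systems\<close>

definition shatters :: "'a set set \<Rightarrow> 'a set \<Rightarrow> bool" where
  "shatters F S \<longleftrightarrow> Pow S \<subseteq> (\<inter>) S ` F"

lemma shatters_subset:
  assumes "shatters F S" "S' \<subseteq> S"
  shows "shatters F S'"
  unfolding shatters_def
proof
  fix V assume "V \<in> Pow S'"
  then obtain W where "W \<in> F" "V = S \<inter> W"
    using assms unfolding shatters_def by (metis Pow_iff image_iff subset_iff subset_trans)
  with \<open>V \<in> Pow S'\<close> assms(2) have "V = S' \<inter> W" by blast
  with \<open>W \<in> F\<close> show "V \<in> (\<inter>) S' ` F" by blast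
qed

text \<open>
  Pajor's form of the Sauer-Shelah lemma, by induction on the ground set. A point \<open>a\<close> splits \<open>F\<close> into
  the members without \<open>a\<close> and the members with \<open>a\<close>, from which \<open>a\<close> is removed. A set shattered by one
  part is shattered by \<open>F\<close>; a set shattered by both counts twice, as \<open>F\<close> also shatters it with \<open>a\<close> added.
\<close>

lemma card_le_card_shattered:
  assumes "finite A" "F \<subseteq> Pow A"
  shows "card F \<le> card {S. S \<subseteq> A \<and> shatters F S}"
  using assms
proof (induction A arbitrary: F rule: finite_induct)
  case empty
  show ?case
  proof (cases "F = {}")
    case False
    with empty have "F = {{}}" by auto
    moreover have "{S. S \<subseteq> {} \<and> shatters {{}} S} = {{} :: 'a set}" by (auto simp: shatters_def)
    ultimately show ?thesis by simp
  qed simp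
next
  case (insert a A)
  define F0 where "F0 = {V \<in> F. a \<notin> V}"
  define F1 where "F1 = (\<lambda>V. V - {a}) ` {V \<in> F. a \<in> V}"
  let ?Sh = "\<lambda>F. {S. S \<subseteq> A \<and> shatters F S}"
  have finF: "finite F" using insert.prems insert.hyps finite_subset by (metis finite_Pow_iff finite_insert)
  have F0A: "F0 \<subseteq> Pow A" and F1A: "F1 \<subseteq> Pow A"
    using insert.prems by (auto simp: F0_def F1_def)
  have inj: "inj_on (\<lambda>V. V - {a}) {V \<in> F. a \<in> V}"
    by (rule inj_onI) auto
  have 1: "card F = card F0 + card F1"
  proof -
    have "card F = card (F0 \<union> {V \<in> F. a \<in> V})"
      by (rule arg_cong[where f = card]) (auto simp: F0_def)
    also have "\<dots> = card F0 + card {V \<in> F. a \<in> V}"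
      using finF by (intro card_Un_disjoint) (auto simp: F0_def)
    finally show ?thesis
      using inj by (simp add: F1_def card_image)
  qed
  have 2: "card (?Sh F0) + card (?Sh F1) = card (?Sh F0 \<union> ?Sh F1) + card (?Sh F0 \<inter> ?Sh F1)"
    using insert.hyps by (intro card_Un_Int) auto
  have 3: "card (insert a ` (?Sh F0 \<inter> ?Sh F1)) = card (?Sh F0 \<inter> ?Sh F1)"
    by (rule card_image, rule inj_onI) (use insert.hyps in auto)
  have 4: "card ((?Sh F0 \<union> ?Sh F1) \<union> insert a ` (?Sh F0 \<inter> ?Sh F1)) =
      card (?Sh F0 \<union> ?Sh F1) + card (insert a ` (?Sh F0 \<inter> ?Sh F1))"
    using insert.hyps by (intro card_Un_disjoint) auto
  have 5: "card ((?Sh F0 \<union> ?Sh F1) \<union> insert a ` (?Sh F0 \<inter> ?Sh F1)) \<le>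
      card {S. S \<subseteq> insert a A \<and> shatters F S}"
  proof (rule card_mono)
    show "finite {S. S \<subseteq> insert a A \<and> shatters F S}"
      by (rule finite_subset[of _ "Pow (insert a A)"]) (use insert.hyps in auto)
    have 0: "shatters F S" if "shatters F0 S" for S
    proof -
      have "F0 \<subseteq> F" by (auto simp: F0_def)
      then have "(\<inter>) S ` F0 \<subseteq> (\<inter>) S ` F" by (rule image_mono)
      with that show ?thesis unfolding shatters_def by (rule subset_trans)
    qed
    have 1: "shatters F S" if S: "shatters F1 S" "S \<subseteq> A" for S
      unfolding shatters_def
    proof
      fix V assume "V \<in> Pow S"
      then have "V \<in> (\<inter>) S ` F1" using S(1) unfolding shatters_def by (rule subsetD[rotated])
      then obtain W where "W \<in> F" "V = S \<inter> (W - {a})" unfolding F1_def by blast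
      moreover have "S \<inter> (W - {a}) = S \<inter> W" using S(2) insert.hyps by blast
      ultimately show "V \<in> (\<inter>) S ` F" by (metis image_eqI)
    qed
    have 2: "shatters F (insert a S)" if S: "shatters F0 S" "shatters F1 S" for S
      unfolding shatters_def
    proof
      fix V assume V: "V \<in> Pow (insert a S)"
      show "V \<in> (\<inter>) (insert a S) ` F"
      proof (cases "a \<in> V")
        case True
        have "V - {a} \<in> Pow S" using V by auto
        then have "V - {a} \<in> (\<inter>) S ` F1" using S(2) unfolding shatters_def by (rule subsetD[rotated])
        then obtain W where W: "W \<in> F" "a \<in> W" "V - {a} = S \<inter> (W - {a})"
          unfolding F1_def by blast
        have "V = insert a S \<inter> W" using W True by blast
        with W show ?thesis by blast
      next
        case False
        then have "V \<in> Pow S" using V by auto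
        then have "V \<in> (\<inter>) S ` F0" using S(1) unfolding shatters_def by (rule subsetD[rotated])
        then obtain W where W: "W \<in> F" "a \<notin> W" "V = S \<inter> W"
          unfolding F0_def by blast
        then have "V = insert a S \<inter> W" by blast
        with W show ?thesis by blast
      qed
    qed
    show "(?Sh F0 \<union> ?Sh F1) \<union> insert a ` (?Sh F0 \<inter> ?Sh F1) \<subseteq> {S. S \<subseteq> insert a A \<and> shatters F S}"
      by (intro Un_least subsetI) (auto intro: 0 1 2)
  qed
  show ?case
    using 1 2 3 4 5 insert.IH[OF F0A] insert.IH[OF F1A] by linarith
qed

text \<open>
  A subset with fewer than \<open>d\<close> elements is read off from a word of length \<open>d\<close> whose letters are the
  elements of \<open>W\<close> and a blank.
\<close>

lemma card_small_subsets:
  assumes "finite W"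
  shows "card {S. S \<subseteq> W \<and> card S < d} \<le> (card W + 1) ^ d"
proof -
  let ?L = "{xs. set xs \<subseteq> insert None (Some ` W) \<and> length xs = d}"
  have "{S. S \<subseteq> W \<and> card S < d} \<subseteq> (\<lambda>xs. {a. Some a \<in> set xs}) ` ?L"
  proof
    fix S assume "S \<in> {S. S \<subseteq> W \<and> card S < d}"
    then have S: "S \<subseteq> W" "card S < d" "finite S" using assms finite_subset by auto
    obtain ys where ys: "set ys = S" "length ys = card S"
      using finite_distinct_list[OF S(3)] distinct_card by metis
    let ?xs = "map Some ys @ replicate (d - card S) None"
    have "?xs \<in> ?L" using ys S by auto
    moreover have "S = {a. Some a \<in> set ?xs}" using ys by auto
    ultimately show "S \<in> (\<lambda>xs. {a. Some a \<in> set xs}) ` ?L" by blast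
  qed
  then have "card {S. S \<subseteq> W \<and> card S < d} \<le> card ?L"
    using assms by (intro surj_card_le) (auto intro!: finite_lists_length_eq)
  also have "\<dots> = card (insert None (Some ` W)) ^ d"
    using assms by (intro card_lists_length_eq) auto
  also have "card (insert None (Some ` W)) = card W + 1"
    using assms by (subst card_insert_disjoint) (auto simp: card_image)
  finally show ?thesis .
qed

text \<open>
  Subsets of shattered sets are shattered, so without a shattered set of size \<open>d\<close> only sets with
  fewer than \<open>d\<close> elements enter Pajor's bound.
\<close>

lemma sauer_shelah:
  assumes "finite W" "\<And>S. S \<subseteq> W \<Longrightarrow> card S = d \<Longrightarrow> \<not> shatters F S"
  shows "card ((\<inter>) W ` F) \<le> (card W + 1) ^ d"
proof -
  let ?F = "(\<inter>) W ` F"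
  have "card ?F \<le> card {S. S \<subseteq> W \<and> shatters ?F S}"
    using assms(1) by (intro card_le_card_shattered) auto
  also have "\<dots> \<le> card {S. S \<subseteq> W \<and> card S < d}"
  proof (rule card_mono)
    show "finite {S. S \<subseteq> W \<and> card S < d}" using assms(1) by (rule_tac finite_subset[of _ "Pow W"]) auto
    show "{S. S \<subseteq> W \<and> shatters ?F S} \<subseteq> {S. S \<subseteq> W \<and> card S < d}"
    proof (clarify)
      fix S assume S: "S \<subseteq> W" "shatters ?F S"
      have "S \<inter> (W \<inter> V) = S \<inter> V" for V using S(1) by blast
      then have sh: "shatters F S" using S(2) by (simp add: shatters_def image_image)
      show "card S < d"
      proof (rule ccontr)
        assume "\<not> card S < d"
        then obtain S' where S': "S' \<subseteq> S" "card S' = d"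
          by (meson not_less obtain_subset_with_card_n)
        with assms(2)[of S'] shatters_subset[OF sh] S(1) show False by auto
      qed
    qed
  qed
  also have "\<dots> \<le> (card W + 1) ^ d" using assms(1) by (rule card_small_subsets)
  finally show ?thesis .
qed

lemma two_power_fact_le: "2 ^ n * fact n \<le> (fact (2 * n) :: real)"
proof (induction n)
  case (Suc n)
  have "2 ^ Suc n * fact (Suc n) = (2 * real n + 2) * (2 ^ n * fact n :: real)"
    by (simp only: power_Suc fact_Suc of_nat_Suc) (simp only: algebra_simps)
  also have "\<dots> \<le> (2 * real n + 2) * fact (2 * n)" using Suc by (intro mult_left_mono) auto
  also have "\<dots> \<le> (2 * real n + 2) * ((2 * real n + 1) * fact (2 * n))"
    by (intro mult_left_mono) (simp_all add: mult_le_cancel_right1)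
  also have "\<dots> = fact (Suc (Suc (2 * n)))"
    by (simp only: fact_Suc of_nat_Suc of_nat_mult of_nat_numeral) (simp only: algebra_simps)
  also have "Suc (Suc (2 * n)) = 2 * Suc n" by simp
  finally show ?case .
qed simp

text \<open>
  Termwise comparison of the power series of \<open>cosh t\<close> and \<open>exp (t\<^sup>2 / 2)\<close>.
\<close>

lemma exp_plus_exp_minus_le: "exp t + exp (- t) \<le> 2 * exp (t\<^sup>2 / 2)" for t :: real
proof -
  have 1: "(\<lambda>n. if even n then t ^ n /\<^sub>R fact n else 0) sums cosh t" by (rule cosh_converges)
  have 2: "strict_mono (\<lambda>n::nat. 2 * n)" by (auto intro!: strict_monoI)
  have 3: "(\<lambda>n. t ^ (2 * n) /\<^sub>R fact (2 * n)) sums cosh t"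
  proof -
    have "(if even n then t ^ n /\<^sub>R fact n else 0) = 0" if "n \<notin> range (\<lambda>n::nat. 2 * n)" for n
      using that by (metis evenE rangeI)
    from sums_mono_reindex[OF 2 this] 1
    have "(\<lambda>n. if even (2 * n) then t ^ (2 * n) /\<^sub>R fact (2 * n) else 0) sums cosh t"
      by (rule iffD2)
    then show ?thesis by (simp only: dvd_triv_left if_True)
  qed
  have 4: "(\<lambda>n. (t\<^sup>2 / 2) ^ n /\<^sub>R fact n) sums exp (t\<^sup>2 / 2)" by (rule exp_converges)
  have 5: "t ^ (2 * n) /\<^sub>R fact (2 * n) \<le> (t\<^sup>2 / 2) ^ n /\<^sub>R fact n" for n
  proof -
    have "t ^ (2 * n) / fact (2 * n) \<le> t ^ (2 * n) / (2 ^ n * fact n)"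
      using two_power_fact_le[of n] by (intro divide_left_mono) (auto simp: power_mult)
    also have "\<dots> = (t\<^sup>2 / 2) ^ n / fact n" by (simp add: power_mult power_divide)
    finally show ?thesis by (simp only: real_scaleR_def divide_inverse mult.commute)
  qed
  have "cosh t \<le> exp (t\<^sup>2 / 2)" by (rule sums_le[OF 5 3 4])
  then have "(exp t + exp (- t)) / 2 \<le> exp (t\<^sup>2 / 2)" unfolding cosh_field_def .
  then show ?thesis by (simp only: pos_divide_le_eq zero_less_numeral mult.commute)
qed

section \<open>Uniform approximation by samples of bounded size\<close>

definition avg :: "nat \<Rightarrow> (nat \<Rightarrow> 'a) \<Rightarrow> 'a set \<Rightarrow> real" where
  "avg n l S = (\<Sum>k<n. of_bool (l k \<in> S)) / real n"

lemma sum_PiE_coordinate: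
  fixes f :: "'a \<Rightarrow> real"
  assumes "finite H" "k < n"
  shows "(\<Sum>l \<in> PiE {..<n} (\<lambda>_. H). f (l k)) = real (card H) ^ (n - 1) * (\<Sum>h\<in>H. f h)"
proof -
  have "(\<Sum>l \<in> PiE {..<n} (\<lambda>_. H). f (l k)) =
      (\<Sum>l \<in> PiE {..<n} (\<lambda>_. H). \<Prod>i<n. if i = k then f (l i) else 1)"
    using assms(2) by (intro sum.cong refl) simp
  also have "\<dots> = (\<Prod>i<n. \<Sum>h\<in>H. if i = k then f h else 1)"
    using assms(1) by (intro prod_sum_PiE[symmetric]) auto
  also have "\<dots> = (\<Prod>i\<in>insert k ({..<n} - {k}). \<Sum>h\<in>H. if i = k then f h else 1)"
    using assms(2) by (intro prod.cong) auto
  also have "\<dots> = (\<Sum>h\<in>H. f h) * (\<Prod>i\<in>{..<n} - {k}. real (card H))"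
    by (subst prod.insert) (auto intro!: prod.cong)
  also have "(\<Prod>i\<in>{..<n} - {k}. real (card H)) = real (card H) ^ (n - 1)"
    using assms(2) by (simp add: card_Diff_singleton)
  finally show ?thesis by (simp only: mult.commute)
qed

lemma sum_avg:
  assumes "finite H" "H \<noteq> {}" "n \<noteq> 0"
  shows "(\<Sum>l \<in> PiE {..<n} (\<lambda>_. H). avg n l S) = real (card H) ^ n * (card (H \<inter> S) / card H)"
proof -
  have c: "real (card H) \<noteq> 0" using assms by simp
  have "(\<Sum>l \<in> PiE {..<n} (\<lambda>_. H). avg n l S) =
      (\<Sum>k<n. \<Sum>l \<in> PiE {..<n} (\<lambda>_. H). of_bool (l k \<in> S)) / real n"
    by (subst sum.swap) (simp only: avg_def sum_divide_distrib)
  also have "\<dots> = (\<Sum>k<n. real (card H) ^ (n - 1) * real (card (H \<inter> S))) / real n"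
    using sum_PiE_coordinate[OF assms(1), of _ n "\<lambda>h. of_bool (h \<in> S)"] assms(1)
    by (simp add: Int_def)
  also have "\<dots> = real (card H) ^ (n - 1) * real (card (H \<inter> S))" using assms(3) by simp
  also have "\<dots> = real (card H) ^ n * (card (H \<inter> S) / card H)"
    using c assms(3) by (cases n) auto
  finally show ?thesis .
qed

text \<open>
  The moment generating function of a sum of independent signs with coefficients \<open>c k\<close> is a product.
  Expectations over samples and signs are finite sums over extensional functions.
\<close>

lemma sum_exp_signs_le:
  fixes c :: "nat \<Rightarrow> real"
  assumes "\<And>k. k < n \<Longrightarrow> \<bar>c k\<bar> \<le> a"
  shows "(\<Sum>s \<in> PiE {..<n} (\<lambda>_. UNIV :: bool set). exp (\<Sum>k<n. if s k then c k else - c k))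
           \<le> 2 ^ n * exp (n * a\<^sup>2 / 2)"
proof -
  have "(\<Sum>s \<in> PiE {..<n} (\<lambda>_. UNIV :: bool set). exp (\<Sum>k<n. if s k then c k else - c k)) =
      (\<Sum>s \<in> PiE {..<n} (\<lambda>_. UNIV :: bool set). \<Prod>k<n. exp (if s k then c k else - c k))"
    by (simp only: exp_sum finite_lessThan)
  also have "\<dots> = (\<Prod>k<n. \<Sum>b\<in>(UNIV :: bool set). exp (if b then c k else - c k))"
    by (intro prod_sum_PiE[symmetric]) auto
  also have "\<dots> = (\<Prod>k<n. exp (c k) + exp (- c k))"
    by (intro prod.cong) (auto simp: UNIV_bool)
  also have "\<dots> \<le> (\<Prod>k<n. 2 * exp (a\<^sup>2 / 2))"
  proof (intro prod_mono conjI)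
    fix k assume "k \<in> {..<n}"
    then have "\<bar>c k\<bar> \<le> \<bar>a\<bar>" using assms[of k] by auto
    then have "(c k)\<^sup>2 \<le> a\<^sup>2" by (simp only: abs_le_square_iff)
    then have "2 * exp ((c k)\<^sup>2 / 2) \<le> 2 * exp (a\<^sup>2 / 2)" by simp
    with exp_plus_exp_minus_le[of "c k"] show "exp (c k) + exp (- c k) \<le> 2 * exp (a\<^sup>2 / 2)"
      by linarith
    show "0 \<le> exp (c k) + exp (- c k)" by (intro add_nonneg_nonneg) auto
  qed
  also have "\<dots> = 2 ^ n * exp (n * a\<^sup>2 / 2)"
    by (simp add: power_mult_distrib exp_of_nat_mult[symmetric])
  finally show ?thesis .
qed

text \<open>
  One half of the pair of samples obtained from \<open>l\<close> and \<open>l'\<close> by exchanging their entries at the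
  positions where \<open>s\<close> is false; the other half is \<open>exchange n s l' l\<close>. Values outside \<open>{..<n}\<close> are
  undefined, so that samples stay extensional.
\<close>

definition exchange :: "nat \<Rightarrow> (nat \<Rightarrow> bool) \<Rightarrow> (nat \<Rightarrow> 'a) \<Rightarrow> (nat \<Rightarrow> 'a) \<Rightarrow> nat \<Rightarrow> 'a" where
  "exchange n s l l' = (\<lambda>k\<in>{..<n}. if s k then l k else l' k)"

definition traces :: "'a set set \<Rightarrow> nat \<Rightarrow> (nat \<Rightarrow> 'a) \<Rightarrow> (nat \<Rightarrow> 'a) \<Rightarrow> 'a set set" where
  "traces F n l l' = (\<inter>) (l ` {..<n} \<union> l' ` {..<n}) ` F"

lemma finite_traces: "finite (traces F n l l')"
  unfolding traces_def by (rule finite_subset[of _ "Pow (l ` {..<n} \<union> l' ` {..<n})"]) auto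

text \<open>
  Symmetrization: each exchange permutes the pairs of samples and preserves the set of entries of a
  pair, hence its traces. The double sum may therefore be averaged over all exchanges. For a fixed
  pair and a fixed trace, the average runs over a sum of independent signs, and a pair has at most
  \<open>K\<close> traces.
\<close>

lemma sum_sum_exp_deviation_le:
  fixes b K :: real
  assumes H: "finite H" and n: "n \<noteq> 0"
    and K: "\<And>W. finite W \<Longrightarrow> W \<subseteq> H \<Longrightarrow> card W \<le> 2 * n \<Longrightarrow> real (card ((\<inter>) W ` F)) \<le> K"
  defines "P \<equiv> PiE {..<n} (\<lambda>_. H)"
  shows "(\<Sum>l\<in>P. \<Sum>l'\<in>P. \<Sum>V\<in>traces F n l l'. exp (b * (avg n l V - avg n l' V)))
           \<le> (real (card H) ^ n)\<^sup>2 * (K * exp (b\<^sup>2 / (2 * n)))"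
proof -
  define g where "g p = (\<Sum>V\<in>traces F n (fst p) (snd p). exp (b * (avg n (fst p) V - avg n (snd p) V)))"
    for p :: "(nat \<Rightarrow> 'a) \<times> (nat \<Rightarrow> 'a)"
  define \<sigma> where "\<sigma> s p = (exchange n s (fst p) (snd p), exchange n s (snd p) (fst p))"
    for s and p :: "(nat \<Rightarrow> 'a) \<times> (nat \<Rightarrow> 'a)"
  let ?B = "PiE {..<n} (\<lambda>_. UNIV :: bool set)"
  have finP: "finite P" unfolding P_def using H by (intro finite_PiE) auto
  have cardP: "card P = card H ^ n" unfolding P_def by (simp add: card_PiE)
  have inv: "\<sigma> s (\<sigma> s p) = p" if "p \<in> P \<times> P" for s p
  proof -
    have "exchange n s (exchange n s l l') (exchange n s l' l) = l" if "l \<in> P" for l l'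
    proof
      fix k
      show "exchange n s (exchange n s l l') (exchange n s l' l) k = l k"
        using that PiE_arb[of l "{..<n}" "\<lambda>_. H" k] by (cases "k < n") (simp_all add: exchange_def P_def)
    qed
    with that show ?thesis by (simp add: \<sigma>_def mem_Times_iff)
  qed
  have mem: "\<sigma> s p \<in> P \<times> P" if "p \<in> P \<times> P" for s p
  proof -
    have "exchange n s l l' \<in> P" if "l \<in> P" "l' \<in> P" for l l'
      unfolding P_def
    proof (rule PiE_I)
      show "exchange n s l l' k \<in> H" if "k \<in> {..<n}" for k
        using that PiE_mem[OF \<open>l \<in> P\<close>[unfolded P_def]] PiE_mem[OF \<open>l' \<in> P\<close>[unfolded P_def]]
        by (simp add: exchange_def)
    qed (simp add: exchange_def)
    with that show ?thesis by (simp add: \<sigma>_def mem_Times_iff)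
  qed
  have sym: "sum g (P \<times> P) = (\<Sum>p\<in>P \<times> P. g (\<sigma> s p))" for s
  proof (rule sum.reindex_bij_witness[of _ "\<sigma> s" "\<sigma> s"])
    show "g (\<sigma> s (\<sigma> s p)) = g p" if "p \<in> P \<times> P" for p by (subst inv[OF that]) (rule refl)
  qed (fact inv mem)+
  have bound: "(\<Sum>s\<in>?B. g (\<sigma> s p)) \<le> K * (2 ^ n * exp (b\<^sup>2 / (2 * n)))" if p: "p \<in> P \<times> P" for p
  proof -
    obtain l l' where [simp]: "p = (l, l')" by (cases p)
    have lH: "l k \<in> H" "l' k \<in> H" if "k < n" for k using p that by (auto simp: P_def)
    define c where "c V k = b / n * (of_bool (l k \<in> V) - of_bool (l' k \<in> V))" for V k
    have tr: "traces F n (exchange n s l l') (exchange n s l' l) = traces F n l l'" for s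
    proof -
      have "exchange n s l l' ` {..<n} \<union> exchange n s l' l ` {..<n} = l ` {..<n} \<union> l' ` {..<n}"
        by (auto simp: exchange_def)
      then show ?thesis unfolding traces_def by simp
    qed
    have dev: "b * (avg n (exchange n s l l') V - avg n (exchange n s l' l) V) = (\<Sum>k<n. if s k then c V k else - c V k)"
      for s V
    proof -
      have "b * (avg n (exchange n s l l') V - avg n (exchange n s l' l) V) =
          (\<Sum>k<n. b / n * (of_bool (exchange n s l l' k \<in> V) - of_bool (exchange n s l' l k \<in> V)))"
        by (simp only: avg_def sum_subtractf sum_distrib_left[symmetric] diff_divide_distrib[symmetric])
          (simp only: times_divide_eq_left times_divide_eq_right)
      also have "\<dots> = (\<Sum>k<n. if s k then c V k else - c V k)"
        by (intro sum.cong) (auto simp: exchange_def c_def)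
      finally show ?thesis .
    qed
    have ca: "\<bar>c V k\<bar> \<le> \<bar>b\<bar> / n" for V k by (auto simp: c_def)
    have "(\<Sum>s\<in>?B. g (\<sigma> s p)) =
        (\<Sum>s\<in>?B. \<Sum>V\<in>traces F n l l'. exp (\<Sum>k<n. if s k then c V k else - c V k))"
      by (simp only: g_def \<sigma>_def fst_conv snd_conv \<open>p = (l, l')\<close> tr dev)
    also have "\<dots> = (\<Sum>V\<in>traces F n l l'. \<Sum>s\<in>?B. exp (\<Sum>k<n. if s k then c V k else - c V k))"
      by (rule sum.swap)
    also have "\<dots> \<le> (\<Sum>V\<in>traces F n l l'. 2 ^ n * exp (n * (\<bar>b\<bar> / n)\<^sup>2 / 2))"
      by (intro sum_mono sum_exp_signs_le ca)
    also have "\<dots> = card (traces F n l l') * (2 ^ n * exp (b\<^sup>2 / (2 * n)))"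
      using n by (simp add: power2_eq_square)
    also have "\<dots> \<le> K * (2 ^ n * exp (b\<^sup>2 / (2 * n)))"
    proof (intro mult_right_mono)
      have "card (l ` {..<n} \<union> l' ` {..<n}) \<le> card (l ` {..<n}) + card (l' ` {..<n})"
        by (rule card_Un_le)
      also have "\<dots> \<le> n + n"
        using card_image_le[of "{..<n}" l] card_image_le[of "{..<n}" l'] by simp
      finally show "real (card (traces F n l l')) \<le> K"
        unfolding traces_def using lH by (intro K) auto
    qed auto
    finally show ?thesis .
  qed
  have "2 ^ n * sum g (P \<times> P) = (\<Sum>s\<in>?B. sum g (P \<times> P))"
    by (simp add: card_PiE)
  also have "\<dots> = (\<Sum>s\<in>?B. \<Sum>p\<in>P \<times> P. g (\<sigma> s p))" by (rule sum.cong[OF refl sym])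
  also have "\<dots> = (\<Sum>p\<in>P \<times> P. \<Sum>s\<in>?B. g (\<sigma> s p))" by (rule sum.swap)
  also have "\<dots> \<le> (\<Sum>p\<in>P \<times> P. K * (2 ^ n * exp (b\<^sup>2 / (2 * n))))" by (rule sum_mono[OF bound])
  also have "\<dots> = 2 ^ n * ((real (card H) ^ n)\<^sup>2 * (K * exp (b\<^sup>2 / (2 * n))))"
    by (simp add: card_cartesian_product cardP power2_eq_square)
  finally have "sum g (P \<times> P) \<le> (real (card H) ^ n)\<^sup>2 * (K * exp (b\<^sup>2 / (2 * n)))"
    by (rule mult_left_le_imp_le) simp
  then show ?thesis by (simp add: g_def sum.cartesian_product case_prod_beta)
qed

text \<open>
  The Vapnik-Chervonenkis theorem for the uniform measure on a finite set. Suppose that every sample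
  \<open>l\<close> fails at some \<open>S l\<close>. The measure of \<open>S l\<close> is the mean of \<open>avg n l' (S l)\<close> over a second sample \<open>l'\<close>,
  so on average the two samples differ by more than \<open>2 * \<delta>\<close> at \<open>S l\<close>. But this difference depends only
  on the trace of \<open>S l\<close> on the pair, and \<open>u \<le> \<delta> + exp (b * (u - \<delta>)) / b\<close>; summing the exponentials over
  all traces removes the dependence on \<open>S\<close> and symmetrization bounds the mean by \<open>2 * \<delta>\<close>.
\<close>

theorem uniform_approximation:
  fixes \<delta> K :: real
  assumes H: "finite H" "H \<noteq> {}" and n: "n \<noteq> 0" and \<delta>: "0 < \<delta>"
    and K: "\<And>W. finite W \<Longrightarrow> W \<subseteq> H \<Longrightarrow> card W \<le> 2 * n \<Longrightarrow> real (card ((\<inter>) W ` F)) \<le> K"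
    and small: "2 * K / (n * \<delta>) * exp (- (n * \<delta>\<^sup>2 / 2)) \<le> \<delta>"
  obtains l where "\<And>k. k < n \<Longrightarrow> l k \<in> H" "\<And>S. S \<in> F \<Longrightarrow> \<bar>avg n l S - card (H \<inter> S) / card H\<bar> \<le> 2 * \<delta>"
proof -
  define P where "P = PiE {..<n} (\<lambda>_. H)"
  define N where "N = real (card H) ^ n"
  \<comment> \<open>this value of \<open>b\<close> minimizes the exponent \<open>b\<^sup>2 / (2 * n) - b * \<delta>\<close> that symmetrization leaves\<close>
  define b where "b = n * \<delta>"
  have b: "b > 0" using n \<delta> by (simp add: b_def)
  have N: "N > 0" using H by (simp add: N_def card_gt_0_iff)
  have finP: "finite P" unfolding P_def using H by (intro finite_PiE) auto
  have cardP: "real (card P) = N" unfolding P_def N_def by (simp add: card_PiE)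
  have "\<exists>l\<in>P. \<forall>S\<in>F. \<bar>avg n l S - card (H \<inter> S) / card H\<bar> \<le> 2 * \<delta>"
  proof (rule ccontr)
    assume "\<not> ?thesis"
    then have "\<forall>l\<in>P. \<exists>S\<in>F. 2 * \<delta> < \<bar>avg n l S - card (H \<inter> S) / card H\<bar>"
      by (simp add: not_le)
    then obtain S where S: "\<And>l. l \<in> P \<Longrightarrow> S l \<in> F"
      "\<And>l. l \<in> P \<Longrightarrow> 2 * \<delta> < \<bar>avg n l (S l) - card (H \<inter> S l) / card H\<bar>"
      by metis
    define Z where "Z c l l' = (\<Sum>V\<in>traces F n l l'. exp (c * (avg n l V - avg n l' V)))"
      for c and l l' :: "nat \<Rightarrow> 'a"
    have dev: "\<bar>avg n l T - avg n l' T\<bar> \<le> \<delta> + exp (- (b * \<delta>)) / b * (Z b l l' + Z (- b) l l')"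
      if T: "T \<in> F" for T l l'
    proof -
      define V where "V = (l ` {..<n} \<union> l' ` {..<n}) \<inter> T"
      have V: "V \<in> traces F n l l'" using T by (auto simp: V_def traces_def)
      have av: "avg n l T = avg n l V" "avg n l' T = avg n l' V"
        by (auto simp: avg_def V_def)
      define u where "u = avg n l V - avg n l' V"
      have 1: "exp (b * u) \<le> Z b l l'" "exp (- b * u) \<le> Z (- b) l l'"
        unfolding Z_def u_def by (rule member_le_sum[OF V]; simp add: finite_traces)+
      have "b * (\<bar>u\<bar> - \<delta>) \<le> exp (b * (\<bar>u\<bar> - \<delta>))"
        using exp_ge_add_one_self[of "b * (\<bar>u\<bar> - \<delta>)"] by linarith
      also have "\<dots> = exp (- (b * \<delta>)) * exp (b * \<bar>u\<bar>)"
        by (simp add: right_diff_distrib flip: exp_add)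
      also have "\<dots> \<le> exp (- (b * \<delta>)) * (Z b l l' + Z (- b) l l')"
      proof (rule mult_left_mono)
        have "exp (b * \<bar>u\<bar>) \<le> exp (b * u) + exp (- b * u)"
          by (cases "u \<ge> 0") (auto simp: abs_if)
        with 1 show "exp (b * \<bar>u\<bar>) \<le> Z b l l' + Z (- b) l l'" by linarith
      qed simp
      finally have "\<bar>u\<bar> - \<delta> \<le> exp (- (b * \<delta>)) * (Z b l l' + Z (- b) l l') / b"
        using b by (simp only: pos_le_divide_eq mult.commute)
      then show ?thesis by (simp add: av u_def)
    qed
    have ZZ: "(\<Sum>l\<in>P. \<Sum>l'\<in>P. Z c l l') \<le> N\<^sup>2 * (K * exp (b\<^sup>2 / (2 * n)))" if "c = b \<or> c = - b" for c
    proof -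
      have "c\<^sup>2 = b\<^sup>2" using that by auto
      with sum_sum_exp_deviation_le[where F = F and b = c and K = K, OF H(1) n K]
      show ?thesis unfolding Z_def P_def N_def by simp
    qed
    have "N\<^sup>2 * (2 * \<delta>) = (\<Sum>l\<in>P. N * (2 * \<delta>))" by (simp add: cardP power2_eq_square)
    also have "\<dots> < (\<Sum>l\<in>P. \<Sum>l'\<in>P. \<bar>avg n l (S l) - avg n l' (S l)\<bar>)"
    proof (rule sum_strict_mono[OF finP])
      show "P \<noteq> {}" using H by (auto simp: P_def PiE_eq_empty_iff)
      fix l assume l: "l \<in> P"
      have "N * (2 * \<delta>) < N * \<bar>avg n l (S l) - card (H \<inter> S l) / card H\<bar>"
        using S(2)[OF l] N by simp
      also have "\<dots> = \<bar>N * avg n l (S l) - N * (card (H \<inter> S l) / card H)\<bar>"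
        using N by (simp only: right_diff_distrib[symmetric] abs_mult abs_of_pos)
      also have "N * (card (H \<inter> S l) / card H) = (\<Sum>l'\<in>P. avg n l' (S l))"
        unfolding N_def P_def by (rule sum_avg[OF H n, symmetric])
      also have "N * avg n l (S l) = (\<Sum>l'\<in>P. avg n l (S l))" by (simp add: cardP)
      also have "\<bar>(\<Sum>l'\<in>P. avg n l (S l)) - (\<Sum>l'\<in>P. avg n l' (S l))\<bar>
          \<le> (\<Sum>l'\<in>P. \<bar>avg n l (S l) - avg n l' (S l)\<bar>)"
        by (simp only: sum_subtractf[symmetric] sum_abs)
      finally show "N * (2 * \<delta>) < (\<Sum>l'\<in>P. \<bar>avg n l (S l) - avg n l' (S l)\<bar>)" .
    qed
    also have "\<dots> \<le> (\<Sum>l\<in>P. \<Sum>l'\<in>P. \<delta> + exp (- (b * \<delta>)) / b * (Z b l l' + Z (- b) l l'))"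
      by (intro sum_mono dev S(1))
    also have "\<dots> = N\<^sup>2 * \<delta> + exp (- (b * \<delta>)) / b *
        ((\<Sum>l\<in>P. \<Sum>l'\<in>P. Z b l l') + (\<Sum>l\<in>P. \<Sum>l'\<in>P. Z (- b) l l'))"
      by (simp only: sum.distrib sum_distrib_left[symmetric] sum_constant cardP power2_eq_square mult.assoc)
    also have "\<dots> \<le> N\<^sup>2 * \<delta> + exp (- (b * \<delta>)) / b *
        (N\<^sup>2 * (K * exp (b\<^sup>2 / (2 * n))) + N\<^sup>2 * (K * exp (b\<^sup>2 / (2 * n))))"
      using b by (intro add_left_mono mult_left_mono add_mono ZZ) auto
    also have "\<dots> = N\<^sup>2 * (\<delta> + 2 * K / b * (exp (- (b * \<delta>)) * exp (b\<^sup>2 / (2 * n))))"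
      by (simp add: algebra_simps)
    also have "exp (- (b * \<delta>)) * exp (b\<^sup>2 / (2 * n)) = exp (- (n * \<delta>\<^sup>2 / 2))"
    proof -
      have "- (b * \<delta>) + b\<^sup>2 / (2 * n) = - (n * \<delta>\<^sup>2 / 2)"
        using n by (simp add: b_def power2_eq_square field_simps)
      then show ?thesis by (simp only: exp_add[symmetric])
    qed
    also have "N\<^sup>2 * (\<delta> + 2 * K / b * exp (- (n * \<delta>\<^sup>2 / 2))) \<le> N\<^sup>2 * (\<delta> + \<delta>)"
      using small by (intro mult_left_mono add_left_mono) (auto simp: b_def)
    finally show False by simp
  qed
  then obtain l where "l \<in> P" "\<forall>S\<in>F. \<bar>avg n l S - card (H \<inter> S) / card H\<bar> \<le> 2 * \<delta>" by blast
  then show ?thesis by (intro that[of l]) (auto simp: P_def)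
qed

section \<open>Regular Borel extensions of contents on clopen sets\<close>

text \<open>
  The intended spaces are type spaces, with the content given by a Keisler measure. They need not be
  second countable, so an open set may be an uncountable union of clopen sets and lie outside the
  sigma-algebra that the algebra \<open>B\<close> generates. The content is therefore extended as in the Riesz
  representation theorem, through its values on open sets.
\<close>

locale clopen_content = algebra "topspace T" B for T :: "'p topology" and B +
  fixes m :: "'p set \<Rightarrow> real"
  assumes compact: "compact_space T"
    and openB: "A \<in> B \<Longrightarrow> openin T A"
    and baseB: "openin T V \<Longrightarrow> q \<in> V \<Longrightarrow> \<exists>A\<in>B. q \<in> A \<and> A \<subseteq> V"
    and m_nonneg: "A \<in> B \<Longrightarrow> 0 \<le> m A"
    and m_space: "m (topspace T) = 1"
    and m_add: "A \<in> B \<Longrightarrow> C \<in> B \<Longrightarrow> A \<inter> C = {} \<Longrightarrow> m (A \<union> C) = m A + m C"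
begin

lemma m_empty: "m {} = 0"
  using m_add[of "{}" "{}"] by simp

lemma m_diff: "A \<in> B \<Longrightarrow> C \<in> B \<Longrightarrow> C \<subseteq> A \<Longrightarrow> m A = m C + m (A - C)"
  using m_add[of C "A - C"] Diff[of A C] by (simp add: Diff_partition Un_absorb1)

lemma m_mono: "A \<in> B \<Longrightarrow> C \<in> B \<Longrightarrow> C \<subseteq> A \<Longrightarrow> m C \<le> m A"
  using m_diff[of A C] m_nonneg[of "A - C"] Diff[of A C] by simp

lemma m_UN_le:
  assumes "finite I" "\<And>i. i \<in> I \<Longrightarrow> A i \<in> B"
  shows "m (\<Union>i\<in>I. A i) \<le> (\<Sum>i\<in>I. m (A i))"
  using assms
proof (induction I rule: finite_induct)
  case (insert i I)
  let ?W = "\<Union>i\<in>I. A i"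
  have W: "?W \<in> B" using insert by (intro finite_UN) auto
  have "m (A i \<union> ?W) = m (A i) + m (?W - A i)"
    using insert.prems W m_add[of "A i" "?W - A i"] Diff[of ?W "A i"] by (simp add: Un_Diff_cancel Diff_disjoint)
  also have "m (?W - A i) \<le> m ?W" using W insert.prems by (intro m_mono) auto
  finally show ?case using insert by simp
qed (simp add: m_empty)

text \<open>
  The value of the extension on open sets is approximated from inside by clopen sets, the value on
  other sets from outside by open sets.
\<close>

definition lower :: "'p set \<Rightarrow> ennreal" where
  "lower V = (SUP A\<in>{A\<in>B. A \<subseteq> V}. ennreal (m A))"

definition outer :: "'p set \<Rightarrow> ennreal" where
  "outer E = (INF V\<in>{V. openin T V \<and> E \<subseteq> V}. lower V)"

lemma lower_ge: "A \<in> B \<Longrightarrow> A \<subseteq> V \<Longrightarrow> ennreal (m A) \<le> lower V"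
  unfolding lower_def by (rule SUP_upper) simp

lemma lower_mono: "V \<subseteq> W \<Longrightarrow> lower V \<le> lower W"
  unfolding lower_def by (rule SUP_subset_mono) auto

lemma lower_B: "A \<in> B \<Longrightarrow> lower A = ennreal (m A)"
  unfolding lower_def
  by (rule antisym[OF SUP_least SUP_upper]) (auto intro!: ennreal_leI m_mono)

lemma lower_le_1: "lower V \<le> 1"
  unfolding lower_def
proof (rule SUP_least, safe)
  fix A assume "A \<in> B"
  then have "m A \<le> m (topspace T)" using sets_into_space by (intro m_mono) auto
  then show "ennreal (m A) \<le> 1" using m_space ennreal_leI[of "m A" 1] by simp
qed

lemma separate:
  assumes "compactin T K" "openin T V" "K \<subseteq> V"
  obtains A where "A \<in> B" "K \<subseteq> A" "A \<subseteq> V"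
proof -
  let ?U = "{A\<in>B. A \<subseteq> V}"
  have "K \<subseteq> \<Union> ?U" using baseB[OF assms(2)] assms(3) by blast
  then obtain F where F: "finite F" "F \<subseteq> ?U" "K \<subseteq> \<Union> F"
    using assms(1) openB unfolding compactin_def by (metis (no_types, lifting) mem_Collect_eq)
  have "\<Union>F \<in> B" using F by (intro finite_Union) auto
  with F show ?thesis by (intro that[of "\<Union>F"]) auto
qed

lemma compactin_B: "A \<in> B \<Longrightarrow> compactin T A"
proof (rule closedin_compact_space[OF compact])
  assume "A \<in> B"
  then have "openin T (topspace T - A)" by (intro openB) auto
  then show "closedin T A" using \<open>A \<in> B\<close> sets_into_space by (auto simp: closedin_def)
qed

text \<open>
  A clopen set is compact. If it lies in a countable union of open sets, it is covered by finitely
  many clopen sets, each inside one of the open sets.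
\<close>

lemma lower_UN_le:
  fixes V :: "nat \<Rightarrow> 'p set"
  assumes "\<And>i. openin T (V i)"
  shows "lower (\<Union>i. V i) \<le> (\<Sum>i. lower (V i))"
  unfolding lower_def[of "\<Union>i. V i"]
proof (rule SUP_least, safe)
  fix A assume A: "A \<in> B" "A \<subseteq> (\<Union>i. V i)"
  let ?U = "{C\<in>B. \<exists>i. C \<subseteq> V i}"
  have "A \<subseteq> \<Union> ?U"
  proof
    fix q assume "q \<in> A"
    with A obtain i where "q \<in> V i" by auto
    with baseB[OF assms] show "q \<in> \<Union> ?U" by blast
  qed
  then obtain F where F: "finite F" "F \<subseteq> ?U" "A \<subseteq> \<Union> F"
    using compactin_B[OF A(1)] openB unfolding compactin_def
    by (metis (no_types, lifting) mem_Collect_eq)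
  have "\<forall>C\<in>F. \<exists>i. C \<subseteq> V i" using F(2) by blast
  then obtain k where k: "\<And>C. C \<in> F \<Longrightarrow> C \<subseteq> V (k C)" by metis
  define I where "I = k ` F"
  define W where "W i = \<Union>{C\<in>F. k C = i}" for i
  have "W i \<in> B" for i
    unfolding W_def by (rule finite_Union) (use F in auto)
  moreover have "W i \<subseteq> V i" for i
    using k unfolding W_def by blast
  ultimately have W: "W i \<in> B" "W i \<subseteq> V i" for i by auto
  have finI: "finite I" using F by (simp add: I_def)
  have "A \<subseteq> (\<Union>i\<in>I. W i)" using F(3) unfolding I_def W_def by blast
  then have "m A \<le> m (\<Union>i\<in>I. W i)" using W A finI by (intro m_mono finite_UN) auto
  also have "\<dots> \<le> (\<Sum>i\<in>I. m (W i))" using finI W by (intro m_UN_le) auto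
  finally have "ennreal (m A) \<le> ennreal (\<Sum>i\<in>I. m (W i))" by (rule ennreal_leI)
  also have "\<dots> = (\<Sum>i\<in>I. ennreal (m (W i)))" using W m_nonneg by (intro sum_ennreal[symmetric]) auto
  also have "\<dots> \<le> (\<Sum>i\<in>I. lower (V i))" using W by (intro sum_mono lower_ge)
  also have "\<dots> \<le> (\<Sum>i. lower (V i))" using finI by (intro sum_le_suminf) auto
  finally show "ennreal (m A) \<le> (\<Sum>i. lower (V i))" .
qed

lemma outer_open: "openin T V \<Longrightarrow> outer V = lower V"
  unfolding outer_def by (rule antisym[OF INF_lower INF_greatest]) (auto intro: lower_mono)

lemma outer_mono: "E \<subseteq> E' \<Longrightarrow> outer E \<le> outer E'"
  unfolding outer_def by (rule INF_superset_mono) auto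

lemma outer_B: "A \<in> B \<Longrightarrow> outer A = ennreal (m A)"
  using outer_open[OF openB] lower_B by simp

lemma outer_less_top: "E \<subseteq> topspace T \<Longrightarrow> outer E < \<top>"
  using outer_mono[of E "topspace T"] outer_open[OF openin_topspace] lower_le_1[of "topspace T"]
  by (metis ennreal_one_less_top order_le_less_trans)

lemma outer_close:
  assumes "E \<subseteq> topspace T" "0 < e"
  obtains V where "openin T V" "E \<subseteq> V" "lower V \<le> outer E + ennreal e"
proof -
  have "outer E < outer E + ennreal e" using outer_less_top[OF assms(1)] assms(2) by (auto simp: less_top)
  then obtain V where "openin T V" "E \<subseteq> V" "lower V < outer E + ennreal e"
    unfolding outer_def[of E] INF_less_iff by auto
  then show ?thesis by (intro that[of V]) auto
qed

lemma outer_measure_space_outer: "outer_measure_space (Pow (topspace T)) outer"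
  unfolding outer_measure_space_def
proof (intro conjI)
  show "positive (Pow (topspace T)) outer"
    using outer_B[of "{}"] by (simp add: positive_def m_empty)
  show "increasing (Pow (topspace T)) outer" by (auto simp: increasing_def intro: outer_mono)
  show "countably_subadditive (Pow (topspace T)) outer"
    unfolding countably_subadditive_def
  proof safe
    fix A :: "nat \<Rightarrow> 'p set" assume A: "range A \<subseteq> Pow (topspace T)"
    show "outer (\<Union>i. A i) \<le> (\<Sum>n. outer (A n))"
    proof (rule ennreal_le_epsilon)
      fix e :: real assume e: "0 < e"
      have "\<exists>V. openin T V \<and> A n \<subseteq> V \<and> lower V \<le> outer (A n) + ennreal (e * (1/2) ^ Suc n)" for n
        using outer_close[of "A n" "e * (1/2) ^ Suc n"] A e by (metis Pow_iff rangeI subsetD zero_less_divide_1_iff zero_less_mult_iff zero_less_numeral zero_less_power)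
      then obtain V where V: "\<And>n. openin T (V n)" "\<And>n. A n \<subseteq> V n"
        "\<And>n. lower (V n) \<le> outer (A n) + ennreal (e * (1/2) ^ Suc n)" by metis
      have "outer (\<Union>i. A i) \<le> outer (\<Union>i. V i)" using V(2) by (intro outer_mono) auto
      also have "\<dots> = lower (\<Union>i. V i)" using V(1) by (intro outer_open) auto
      also have "\<dots> \<le> (\<Sum>i. lower (V i))" using V(1) by (rule lower_UN_le)
      also have "\<dots> \<le> (\<Sum>n. outer (A n) + ennreal (e * (1/2) ^ Suc n))"
        using V(3) by (intro suminf_le) auto
      also have "\<dots> = (\<Sum>n. outer (A n)) + (\<Sum>n. ennreal e * ennreal ((1/2) ^ Suc n))"
        using e by (subst suminf_add[symmetric])
                   (auto simp del: ennreal_suminf_cmult simp add: ennreal_mult[symmetric])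
      also have "\<dots> = (\<Sum>n. outer (A n)) + e"
        unfolding ennreal_suminf_cmult
        by (subst suminf_ennreal_eq[OF zero_le_power power_half_series]) auto
      finally show "outer (\<Union>i. A i) \<le> (\<Sum>n. outer (A n)) + e" .
    qed
  qed
qed

text \<open>
  Caratheodory's condition for open sets. If the open set \<open>W\<close> is almost optimal for \<open>E\<close> and the clopen
  set \<open>C\<close> almost exhausts \<open>W \<inter> V\<close>, then \<open>W - C\<close> is an open set around \<open>E - V\<close>, and \<open>C\<close> and \<open>W - C\<close> are
  disjoint in \<open>W\<close>.
\<close>

lemma outer_split_open:
  assumes V: "openin T V" and E: "E \<subseteq> topspace T"
  shows "outer (E \<inter> V) + outer (E - V) \<le> outer E"
proof (rule ennreal_le_epsilon)
  fix e :: real assume e: "0 < e"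
  then obtain W where W: "openin T W" "E \<subseteq> W" "lower W \<le> outer E + ennreal (e / 2)"
    using outer_close[OF E, of "e / 2"] by auto
  have VW: "openin T (W \<inter> V)" using V W by auto
  have "lower (W \<inter> V) < lower (W \<inter> V) + ennreal (e / 2)"
    using lower_le_1[of "W \<inter> V"] e by (metis ennreal_add_left_cancel_less add.right_neutral ennreal_one_less_top
        ennreal_less_zero_iff half_gt_zero infinity_ennreal_def order_le_less_trans order_less_irrefl)
  have "\<exists>C\<in>B. C \<subseteq> W \<inter> V \<and> lower (W \<inter> V) \<le> ennreal (m C) + ennreal (e / 2)"
  proof (rule ccontr)
    assume *: "\<not> ?thesis"
    define s where "s = enn2real (lower (W \<inter> V))"
    have s: "lower (W \<inter> V) = ennreal s"
      using lower_le_1[of "W \<inter> V"] unfolding s_def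
      by (metis ennreal_enn2real ennreal_one_less_top order_le_less_trans)
    have s0: "0 \<le> s" by (simp add: s_def)
    have "m C + e / 2 \<le> s" if "C \<in> B" "C \<subseteq> W \<inter> V" for C
    proof (rule ccontr)
      assume "\<not> m C + e / 2 \<le> s"
      then have "ennreal s \<le> ennreal (m C + e / 2)" by (intro ennreal_leI) simp
      also have "\<dots> = ennreal (m C) + ennreal (e / 2)" using m_nonneg[OF that(1)] e by (intro ennreal_plus) auto
      finally show False using * that s by auto
    qed
    then have "lower (W \<inter> V) \<le> ennreal (s - e / 2)"
      unfolding lower_def by (intro SUP_least ennreal_leI) (auto simp: algebra_simps)
    moreover have "s - e / 2 \<ge> 0"
      using \<open>\<And>C. C \<in> B \<Longrightarrow> C \<subseteq> W \<inter> V \<Longrightarrow> m C + e / 2 \<le> s\<close>[of "{}"] m_empty by auto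
    ultimately show False using s s0 e by (simp add: ennreal_le_iff)
  qed
  then obtain C where C: "C \<in> B" "C \<subseteq> W \<inter> V" "lower (W \<inter> V) \<le> ennreal (m C) + ennreal (e / 2)" by blast
  have WC: "openin T (W - C)"
    using W(1) C(1) compactin_B closedin_compact_space[OF compact]
    by (metis C(1) Diff_subset Int_Diff Int_absorb2 compl_sets openB openin_Int openin_subset)
  have disj: "ennreal (m C) + lower (W - C) \<le> lower W"
    unfolding lower_def[of "W - C"]
  proof (subst ennreal_SUP_add_right)
    show "{A \<in> B. A \<subseteq> W - C} \<noteq> {}" by auto
    show "(SUP A\<in>{A \<in> B. A \<subseteq> W - C}. ennreal (m C) + ennreal (m A)) \<le> lower W"
    proof (rule SUP_least, safe)
      fix A assume A: "A \<in> B" "A \<subseteq> W - C"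
      then have "ennreal (m C) + ennreal (m A) = ennreal (m (C \<union> A))"
      proof -
        have "C \<inter> A = {}" using A by auto
        then show ?thesis
          using m_nonneg[OF C(1)] m_nonneg[OF A(1)] m_add[OF C(1) A(1)] by simp
      qed
      also have "\<dots> \<le> lower W" using A C by (intro lower_ge) auto
      finally show "ennreal (m C) + ennreal (m A) \<le> lower W" .
    qed
  qed
  have "outer (E \<inter> V) \<le> lower (W \<inter> V)"
    using outer_mono[of "E \<inter> V" "W \<inter> V"] outer_open[OF VW] W(2) by auto
  also have "\<dots> \<le> ennreal (m C) + ennreal (e / 2)" by (rule C(3))
  finally have 1: "outer (E \<inter> V) \<le> ennreal (m C) + ennreal (e / 2)" .
  have 2: "outer (E - V) \<le> lower (W - C)"
    using outer_mono[of "E - V" "W - C"] outer_open[OF WC] W(2) C(2) by auto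
  have "outer (E \<inter> V) + outer (E - V) \<le> (ennreal (m C) + ennreal (e / 2)) + lower (W - C)"
    by (rule add_mono[OF 1 2])
  also have "\<dots> = (ennreal (m C) + lower (W - C)) + ennreal (e / 2)" by (simp only: ac_simps)
  also have "\<dots> \<le> lower W + ennreal (e / 2)" by (rule add_right_mono[OF disj])
  also have "\<dots> \<le> (outer E + ennreal (e / 2)) + ennreal (e / 2)" by (rule add_right_mono[OF W(3)])
  also have "\<dots> = outer E + ennreal e"
    using e by (simp only: add.assoc) (subst ennreal_plus[symmetric], auto)
  finally show "outer (E \<inter> V) + outer (E - V) \<le> outer E + ennreal e" .
qed

abbreviation borel_sets :: "'p set set" where
  "borel_sets \<equiv> sigma_sets (topspace T) {V. openin T V}"

lemma measure_space_outer: "measure_space (topspace T) borel_sets outer"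
proof -
  let ?L = "lambda_system (topspace T) (Pow (topspace T)) outer"
  have mls: "measure_space (topspace T) ?L outer"
    by (rule sigma_algebra.caratheodory_lemma[OF sigma_algebra_Pow outer_measure_space_outer])
  then have sls: "sigma_algebra (topspace T) ?L" by (simp add: measure_space_def)
  have "{V. openin T V} \<subseteq> ?L"
  proof (clarsimp simp: algebra.lambda_system_eq[OF algebra_Pow] openin_subset)
    fix V E assume V: "openin T V" and E: "E \<subseteq> topspace T"
    have "outer E = outer ((E \<inter> V) \<union> (E - V))" by (rule arg_cong[where f = outer]) auto
    also have "\<dots> \<le> outer (E \<inter> V) + outer (E - V)"
    proof (rule subadditiveD)
      show "subadditive (Pow (topspace T)) outer"
        using outer_measure_space_outer unfolding outer_measure_space_def
        by (intro ring_of_sets.countably_subadditive_subadditive[OF ring_of_sets_Pow]) auto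
    qed (use E in auto)
    finally show "outer (E \<inter> V) + outer (E - V) = outer E"
      using outer_split_open[OF V E] by (rule antisym[rotated])
  qed
  then have "borel_sets \<subseteq> ?L" by (rule sigma_algebra.sigma_sets_subset[OF sls])
  then show ?thesis
    by (intro measure_down[OF mls] sigma_algebra_sigma_sets) (auto dest: openin_subset)
qed

definition radon :: "'p measure" where
  "radon = measure_of (topspace T) {V. openin T V} outer"

lemma sets_radon: "sets radon = borel_sets"
  unfolding radon_def by (rule sets_measure_of) (auto dest: openin_subset)

lemma space_radon: "space radon = topspace T"
  unfolding radon_def by (rule space_measure_of) (auto dest: openin_subset)

lemma emeasure_radon: "A \<in> borel_sets \<Longrightarrow> emeasure radon A = outer A"
  using measure_space_outer unfolding measure_space_def sets_radon[symmetric]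
  by (intro emeasure_measure_of[OF radon_def]) (auto dest: openin_subset)

lemma B_borel: "A \<in> B \<Longrightarrow> A \<in> borel_sets"
  using openB by (intro sigma_sets.Basic) auto

lemma measure_radon_B: "A \<in> B \<Longrightarrow> measure radon A = m A"
  using emeasure_radon[OF B_borel] outer_B m_nonneg by (simp add: measure_def)

lemma closed_borel: "closedin T K \<Longrightarrow> K \<in> borel_sets"
proof -
  assume K: "closedin T K"
  then have "topspace T - (topspace T - K) \<in> borel_sets"
    by (intro sigma_sets.Compl sigma_sets.Basic) auto
  then show ?thesis using closedin_subset[OF K] by (simp add: double_diff)
qed

lemma prob_space_radon: "prob_space radon"
  using emeasure_radon[OF B_borel[OF top]] outer_B[OF top] m_space
  by (intro prob_spaceI) (simp add: space_radon)

text \<open>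
  Outer regularity holds by construction. Applied to the complement it gives inner regularity, because
  closed subsets of a compact space are compact.
\<close>

theorem regular_borel_prob_radon:
  "regular_borel_prob T radon"
  unfolding regular_borel_prob_def
proof (intro conjI ballI)
  show "prob_space radon" by (rule prob_space_radon)
  show "sets radon = borel_sets" by (rule sets_radon)
  fix E assume "E \<in> sets radon"
  then have E: "E \<in> borel_sets" by (simp add: sets_radon)
  then have EX: "E \<subseteq> topspace T" by (metis sets.sets_into_space sets_radon space_radon)
  have out: "emeasure radon V = lower V" if "openin T V" for V
    using that emeasure_radon[of V] outer_open by (simp add: sigma_sets.Basic)
  have reg: "emeasure radon F = (INF V\<in>{V. openin T V \<and> F \<subseteq> V}. emeasure radon V)" if "F \<in> borel_sets" for F
    unfolding emeasure_radon[OF that] outer_def by (rule INF_cong) (auto simp: out)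
  show "emeasure radon E = (INF V\<in>{V. openin T V \<and> E \<subseteq> V}. emeasure radon V)" by (rule reg[OF E])
  show "emeasure radon E = (SUP K\<in>{K. compactin T K \<and> K \<subseteq> E}. emeasure radon K)"
  proof (rule antisym)
    show "(SUP K\<in>{K. compactin T K \<and> K \<subseteq> E}. emeasure radon K) \<le> emeasure radon E"
      using E by (intro SUP_least emeasure_mono) (auto simp: sets_radon)
    let ?E' = "topspace T - E"
    interpret prob_space radon by (rule prob_space_radon)
    have E': "?E' \<in> borel_sets" using E by (rule sigma_sets.Compl)
    show "emeasure radon E \<le> (SUP K\<in>{K. compactin T K \<and> K \<subseteq> E}. emeasure radon K)"
    proof (rule ennreal_le_epsilon)
      fix e :: real assume e: "0 < e"
      obtain V where V: "openin T V" "?E' \<subseteq> V" "lower V \<le> outer ?E' + ennreal e"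
        using outer_close[of ?E' e] e by auto
      let ?K = "topspace T - V"
      have K: "closedin T ?K" using V by auto
      then have Kb: "?K \<in> borel_sets" by (rule closed_borel)
      have Vb: "V \<in> borel_sets" using V by (auto intro: sigma_sets.Basic)
      have "measure radon V \<le> measure radon ?E' + e"
      proof -
        have "ennreal (measure radon V) \<le> ennreal (measure radon ?E') + ennreal e"
          using V out[OF V(1)] emeasure_radon[OF E'] by (simp flip: emeasure_eq_measure)
        also have "\<dots> = ennreal (measure radon ?E' + e)" using e by (intro ennreal_plus[symmetric]) auto
        finally show ?thesis using e by (subst (asm) ennreal_le_iff) (auto intro: add_nonneg_nonneg)
      qed
      moreover have "measure radon ?K = 1 - measure radon V"
        using prob_compl[of V] Vb by (simp add: sets_radon space_radon)
      moreover have "measure radon ?E' = 1 - measure radon E"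
        using prob_compl[of E] E by (simp add: sets_radon space_radon)
      ultimately have "measure radon E \<le> measure radon ?K + e" by linarith
      then have "emeasure radon E \<le> emeasure radon ?K + ennreal e"
        using e by (simp add: emeasure_eq_measure flip: ennreal_plus)
      also have "emeasure radon ?K \<le> (SUP K\<in>{K. compactin T K \<and> K \<subseteq> E}. emeasure radon K)"
        using V(2) EX closedin_compact_space[OF compact K] by (intro SUP_upper) auto
      finally show "emeasure radon E \<le> (SUP K\<in>{K. compactin T K \<and> K \<subseteq> E}. emeasure radon K) + ennreal e"
        by (simp add: add_right_mono)
    qed
  qed
qed

text \<open>
  A compact subset of an open set \<open>V\<close> lies in a clopen subset of \<open>V\<close>, so inner regularity forces the value
  \<open>lower V\<close> on \<open>V\<close>, and outer regularity does the rest.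
\<close>

lemma regular_borel_prob_unique:
  assumes N: "regular_borel_prob T N" and mN: "\<And>A. A \<in> B \<Longrightarrow> measure N A = m A"
  shows "N = radon"
proof (rule measure_eqI)
  interpret prob_space N using N by (simp add: regular_borel_prob_def)
  show s: "sets N = sets radon" using N sets_radon by (simp add: regular_borel_prob_def)
  have op: "emeasure N V = lower V" if V: "openin T V" for V
  proof -
    have Vs: "V \<in> sets N" using V by (simp add: s sets_radon sigma_sets.Basic)
    have Bs: "A \<in> sets N" if "A \<in> B" for A using that B_borel by (simp add: s sets_radon)
    have "emeasure N V = (SUP K\<in>{K. compactin T K \<and> K \<subseteq> V}. emeasure N K)"
      using N Vs unfolding regular_borel_prob_def by blast
    also have "\<dots> \<le> lower V"
    proof (rule SUP_least, safe)
      fix K assume "compactin T K" "K \<subseteq> V"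
      then obtain A where A: "A \<in> B" "K \<subseteq> A" "A \<subseteq> V" using separate V by metis
      have "emeasure N K \<le> emeasure N A" using A Bs by (intro emeasure_mono)
      also have "\<dots> = ennreal (m A)" using mN[OF A(1)] by (simp add: emeasure_eq_measure)
      also have "\<dots> \<le> lower V" using A by (intro lower_ge)
      finally show "emeasure N K \<le> lower V" .
    qed
    finally have "emeasure N V \<le> lower V" .
    moreover have "lower V \<le> emeasure N V"
      unfolding lower_def
    proof (rule SUP_least, safe)
      fix A assume A: "A \<in> B" "A \<subseteq> V"
      then have "ennreal (m A) = emeasure N A" using mN by (simp add: emeasure_eq_measure)
      also have "\<dots> \<le> emeasure N V" using A Vs by (intro emeasure_mono)
      finally show "ennreal (m A) \<le> emeasure N V" .
    qed
    ultimately show ?thesis by (rule antisym)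
  qed
  fix E assume E: "E \<in> sets N"
  have "emeasure N E = (INF V\<in>{V. openin T V \<and> E \<subseteq> V}. emeasure N V)"
    using N E unfolding regular_borel_prob_def by blast
  also have "\<dots> = outer E" unfolding outer_def by (rule INF_cong) (auto simp: op)
  also have "\<dots> = emeasure radon E" using E by (simp add: emeasure_radon s sets_radon)
  finally show "emeasure N E = emeasure radon E" .
qed

end

section \<open>Substitution and satisfaction\<close>

lemma tval_cong: "(\<And>w. w \<in> tfv t \<Longrightarrow> v w = v' w) \<Longrightarrow> tval M v e t = tval M v' e t"
proof (induction t)
  case (Fn f ts)
  then have "map (tval M v e) ts = map (tval M v' e) ts" by (intro map_cong) auto
  then show ?case by (simp only: tval.simps)
qed auto

lemma sat_cong: "(\<And>w. w \<in> fv \<phi> \<Longrightarrow> v w = v' w) \<Longrightarrow> sat M v e \<phi> \<longleftrightarrow> sat M v' e \<phi>"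
proof (induction \<phi> arbitrary: e)
  case (Eq t u)
  then show ?case using tval_cong[of t v v' M e] tval_cong[of u v v' M e] by simp
next
  case (Rel r ts)
  then have "map (tval M v e) ts = map (tval M v' e) ts" by (intro map_cong tval_cong) auto
  then show ?case by (simp only: sat.simps)
next
  case (Disj \<phi>1 \<phi>2)
  then have "sat M v e \<phi>1 = sat M v' e \<phi>1" "sat M v e \<phi>2 = sat M v' e \<phi>2" by simp_all
  then show ?case by simp
qed simp_all

lemma tval_tsubst:
  assumes "\<And>w. tval M v e (\<sigma> w) = v' w"
  shows "tval M v e (tsubst \<sigma> t) = tval M v' e t"
proof (induction t)
  case (Fn f ts)
  then have "map (tval M v e) (map (tsubst \<sigma>) ts) = map (tval M v' e) ts" by simp
  then show ?case by (simp only: tval.simps tsubst.simps)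
qed (simp_all add: assms)

lemma sat_subst:
  assumes "\<And>w e. tval M v e (\<sigma> w) = v' w"
  shows "sat M v e (subst \<sigma> \<phi>) \<longleftrightarrow> sat M v' e \<phi>"
proof (induction \<phi> arbitrary: e)
  case (Rel r ts)
  have "map (tval M v e) (map (tsubst \<sigma>) ts) = map (tval M v' e) ts"
    using tval_tsubst[of M v e \<sigma> v', OF assms] by simp
  then show ?case by (simp only: sat.simps subst.simps)
qed (simp_all add: tval_tsubst[of M v _ \<sigma> v', OF assms])

lemma sat_inst: "sat M v e (inst Z b \<phi>) \<longleftrightarrow> sat M (\<lambda>w. if w \<in> Z then b w else v w) e \<phi>"
  unfolding inst_def by (rule sat_subst) simp

lemma tsubst_tsubst:
  assumes "\<And>w. w \<in> tfv t \<Longrightarrow> tsubst \<sigma> (\<tau> w) = \<rho> w"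
  shows "tsubst \<sigma> (tsubst \<tau> t) = tsubst \<rho> t"
  using assms
proof (induction t)
  case (Fn f ts)
  have "tsubst \<sigma> (tsubst \<tau> t) = tsubst \<rho> t" if "t \<in> set ts" for t
    using that Fn.prems by (intro Fn.IH) auto
  then show ?case by simp
qed auto

lemma subst_subst:
  assumes "\<And>w. w \<in> fv \<phi> \<Longrightarrow> tsubst \<sigma> (\<tau> w) = \<rho> w"
  shows "subst \<sigma> (subst \<tau> \<phi>) = subst \<rho> \<phi>"
  using assms
proof (induction \<phi>)
  case (Rel r ts)
  have "tsubst \<sigma> (tsubst \<tau> t) = tsubst \<rho> t" if "t \<in> set ts" for t
    using that Rel.prems by (intro tsubst_tsubst) auto
  then show ?case by simp
qed (auto simp: tsubst_tsubst)

lemma tfv_tsubst: "tfv (tsubst \<sigma> t) = (\<Union>w\<in>tfv t. tfv (\<sigma> w))"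
  by (induction t) auto

lemma fv_subst: "fv (subst \<sigma> \<phi>) = (\<Union>w\<in>fv \<phi>. tfv (\<sigma> w))"
  by (induction \<phi>) (auto simp: tfv_tsubst)

lemma tpar_tsubst: "tpar (tsubst \<sigma> t) = tpar t \<union> (\<Union>w\<in>tfv t. tpar (\<sigma> w))"
  by (induction t) auto

lemma par_subst: "par (subst \<sigma> \<phi>) = par \<phi> \<union> (\<Union>w\<in>fv \<phi>. tpar (\<sigma> w))"
  by (induction \<phi>) (auto simp: tpar_tsubst)

lemma tm_ok_tsubst:
  assumes "\<And>w. tm_ok L B (\<sigma> w) (fst w)" "tm_ok L B t s"
  shows "tm_ok L B (tsubst \<sigma> t) s"
  using assms(2)
proof (induction t arbitrary: s)
  case (Fn f ts)
  then have "list_all2 (\<lambda>t s. tm_ok L B (tsubst \<sigma> t) s) ts (fdom L f)"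
    by (auto elim!: list.rel_mono_strong)
  with Fn show ?case by (simp add: list.rel_map)
qed (use assms(1) in auto)

lemma fm_ok_subst:
  assumes "\<And>w B. tm_ok L B (\<sigma> w) (fst w)" "fm_ok L B \<phi>"
  shows "fm_ok L B (subst \<sigma> \<phi>)"
  using assms(2)
proof (induction \<phi> arbitrary: B)
  case (Eq t u)
  then show ?case using tm_ok_tsubst[of L B \<sigma>, OF assms(1)] by auto
next
  case (Rel r ts)
  then have "list_all2 (\<lambda>t s. tm_ok L B (tsubst \<sigma> t) s) ts (rdom L r)"
    by (auto elim!: list.rel_mono_strong intro: tm_ok_tsubst[of L B \<sigma>, OF assms(1)])
  then show ?case by (simp add: list.rel_map)
qed auto

lemma subst_in_forms:
  assumes "\<phi> \<in> forms L Y A" "\<And>w B. tm_ok L B (\<sigma> w) (fst w)"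
    and "\<And>w. w \<in> Y \<Longrightarrow> tfv (\<sigma> w) \<subseteq> Z" "\<And>w. w \<in> Y \<Longrightarrow> tpar (\<sigma> w) \<subseteq> A'" "A \<subseteq> A'"
  shows "subst \<sigma> \<phi> \<in> forms L Z A'"
  using assms fm_ok_subst[of L \<sigma> "[]" \<phi>] unfolding forms_def mem_Collect_eq fv_subst par_subst
  by (intro conjI Un_least UN_least) blast+

lemma inst_in_forms:
  assumes "\<phi> \<in> forms L (Y \<union> Z) A" "\<And>w. w \<in> Z \<Longrightarrow> (fst w, b w) \<in> A'" "A \<subseteq> A'"
  shows "inst Z b \<phi> \<in> forms L Y A'"
  unfolding inst_def by (rule subst_in_forms[OF assms(1)]) (use assms in auto)

lemma forms_mono: "\<phi> \<in> forms L Z A \<Longrightarrow> Z \<subseteq> Z' \<Longrightarrow> A \<subseteq> A' \<Longrightarrow> \<phi> \<in> forms L Z' A'"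
  by (auto simp: forms_def)

lemma finite_tpar: "finite (tpar t)" and finite_tfv: "finite (tfv t)"
  by (induction t) auto

lemma finite_par: "finite (par \<phi>)"
  by (induction \<phi>) (auto simp: finite_tpar)

section \<open>Boolean combinations\<close>

definition Conj where "Conj \<phi> \<psi> = Neg (Disj (Neg \<phi>) (Neg \<psi>))"

definition Conjs where "Conjs \<phi>s = foldr Conj \<phi>s (Neg Fls)"

lemma sat_Conj [simp]: "sat M v e (Conj \<phi> \<psi>) \<longleftrightarrow> sat M v e \<phi> \<and> sat M v e \<psi>"
  by (simp add: Conj_def)

lemma sat_Conjs [simp]: "sat M v e (Conjs \<phi>s) \<longleftrightarrow> (\<forall>\<phi>\<in>set \<phi>s. sat M v e \<phi>)"
  by (induction \<phi>s) (auto simp: Conjs_def)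

lemma forms_simps [simp]:
  "Fls \<in> forms L Z A"
  "Neg \<phi> \<in> forms L Z A \<longleftrightarrow> \<phi> \<in> forms L Z A"
  "Disj \<phi> \<psi> \<in> forms L Z A \<longleftrightarrow> \<phi> \<in> forms L Z A \<and> \<psi> \<in> forms L Z A"
  "Conj \<phi> \<psi> \<in> forms L Z A \<longleftrightarrow> \<phi> \<in> forms L Z A \<and> \<psi> \<in> forms L Z A"
  by (auto simp: forms_def Conj_def)

lemma Conjs_in_forms [simp]: "Conjs \<phi>s \<in> forms L Z A \<longleftrightarrow> set \<phi>s \<subseteq> forms L Z A"
  by (induction \<phi>s) (auto simp: Conjs_def)

section \<open>Abstracting parameters\<close>

fun tunpar :: "('c \<Rightarrow> 'v) \<Rightarrow> ('v, 'f, 'c) tm \<Rightarrow> ('v, 'f, 'c) tm" where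
  "tunpar p (Var w) = Var w"
| "tunpar p (Bnd n) = Bnd n"
| "tunpar p (Par c) = Var (p c)"
| "tunpar p (Fn f ts) = Fn f (map (tunpar p) ts)"

fun unpar :: "('c \<Rightarrow> 'v) \<Rightarrow> ('v, 's, 'f, 'r, 'c) fm \<Rightarrow> ('v, 's, 'f, 'r, 'c) fm" where
  "unpar p Fls = Fls"
| "unpar p (Eq t u) = Eq (tunpar p t) (tunpar p u)"
| "unpar p (Rel r ts) = Rel r (map (tunpar p) ts)"
| "unpar p (Neg \<phi>) = Neg (unpar p \<phi>)"
| "unpar p (Disj \<phi> \<psi>) = Disj (unpar p \<phi>) (unpar p \<psi>)"
| "unpar p (Ex s \<phi>) = Ex s (unpar p \<phi>)"

lemma tfv_tunpar: "tfv (tunpar p t) = tfv t \<union> p ` tpar t"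
  by (induction t) auto

lemma fv_unpar: "fv (unpar p \<phi>) = fv \<phi> \<union> p ` par \<phi>"
  by (induction \<phi>) (auto simp: tfv_tunpar)

lemma tpar_tunpar: "tpar (tunpar p t) = {}"
  by (induction t) auto

lemma par_unpar: "par (unpar p \<phi>) = {}"
  by (induction \<phi>) (auto simp: tpar_tunpar)

lemma tm_ok_tunpar:
  assumes "\<And>c. fst (p c) = fst c" "tm_ok L B t s"
  shows "tm_ok L B (tunpar p t) s"
  using assms(2)
proof (induction t arbitrary: s)
  case (Fn f ts)
  then have "list_all2 (\<lambda>t s. tm_ok L B (tunpar p t) s) ts (fdom L f)"
    by (auto elim!: list.rel_mono_strong)
  with Fn show ?case by (simp add: list.rel_map)
qed (use assms(1) in auto)

lemma fm_ok_unpar: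
  assumes "\<And>c. fst (p c) = fst c" "fm_ok L B \<phi>"
  shows "fm_ok L B (unpar p \<phi>)"
  using assms(2)
proof (induction \<phi> arbitrary: B)
  case (Eq t u)
  then show ?case using tm_ok_tunpar[of p L B, OF assms(1)] by auto
next
  case (Rel r ts)
  then have "list_all2 (\<lambda>t s. tm_ok L B (tunpar p t) s) ts (rdom L r)"
    by (auto elim!: list.rel_mono_strong intro: tm_ok_tunpar[of p L B, OF assms(1)])
  then show ?case by (simp add: list.rel_map)
qed auto

lemma tsubst_tunpar:
  assumes "\<And>c. c \<in> tpar t \<Longrightarrow> \<sigma> (p c) = Par c" "\<And>w. w \<in> tfv t \<Longrightarrow> \<sigma> w = Var w"
  shows "tsubst \<sigma> (tunpar p t) = t"
  using assms
proof (induction t)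
  case (Fn f ts)
  have "tsubst \<sigma> (tunpar p t) = t" if "t \<in> set ts" for t
    using that Fn.prems by (intro Fn.IH) auto
  then have "map (\<lambda>t. tsubst \<sigma> (tunpar p t)) ts = ts" by (intro map_idI)
  then show ?case by (simp add: comp_def)
qed auto

lemma subst_unpar:
  assumes "\<And>c. c \<in> par \<phi> \<Longrightarrow> \<sigma> (p c) = Par c" "\<And>w. w \<in> fv \<phi> \<Longrightarrow> \<sigma> w = Var w"
  shows "subst \<sigma> (unpar p \<phi>) = \<phi>"
  using assms
proof (induction \<phi>)
  case (Rel r ts)
  then have "map (\<lambda>t. tsubst \<sigma> (tunpar p t)) ts = ts" by (intro map_idI tsubst_tunpar) auto
  then show ?case by (simp add: comp_def)
qed (auto simp: tsubst_tunpar)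

text \<open>
  Every formula is an instance of a formula without parameters: each parameter becomes a variable of
  its sort with an index above those in \<open>Y\<close>. Distinct parameters get distinct variables, so
  instantiation restores the formula itself and not only an equivalent one.
\<close>

lemma abstract_parameters:
  fixes \<phi> :: "('s, 'f, 'r, 'a) form"
  assumes \<phi>: "\<phi> \<in> forms L Y A" and Y: "finite Y"
  obtains Z b \<psi> where "finite Z" "Y \<inter> Z = {}" "\<psi> \<in> forms L (Y \<union> Z) {}" "inst Z b \<psi> = \<phi>"
    "\<And>w. w \<in> Z \<Longrightarrow> (fst w, b w) \<in> par \<phi>"
proof -
  obtain n :: "'s \<times> 'a \<Rightarrow> nat" where n: "inj_on n (par \<phi>)"
    using finite_imp_inj_to_nat_seg[OF finite_par[of \<phi>]] by blast
  obtain N where N: "\<And>w. w \<in> Y \<Longrightarrow> snd w < N"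
    using Y finite_nat_set_iff_bounded[of "snd ` Y"] by auto
  define p where "p c = (fst c, N + n c)" for c :: "'s \<times> 'a"
  define Z where "Z = p ` par \<phi>"
  define b where "b w = snd (inv_into (par \<phi>) p w)" for w
  have inj: "inj_on p (par \<phi>)" using n by (auto simp: p_def inj_on_def)
  have YZ: "Y \<inter> Z = {}" using N by (fastforce simp: Z_def p_def)
  have b: "b (p c) = snd c" if "c \<in> par \<phi>" for c
    using inv_into_f_f[OF inj that] by (simp add: b_def)
  show ?thesis
  proof (rule that[of Z "unpar p \<phi>" b])
    show "finite Z" by (simp add: Z_def finite_par)
    show "Y \<inter> Z = {}" by (rule YZ)
    show "unpar p \<phi> \<in> forms L (Y \<union> Z) {}"
      using \<phi> fm_ok_unpar[of p L "[]" \<phi>] by (auto simp: forms_def fv_unpar par_unpar Z_def p_def)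
    show "inst Z b (unpar p \<phi>) = \<phi>"
      unfolding inst_def
    proof (rule subst_unpar)
      show "(if p c \<in> Z then Par (fst (p c), b (p c)) else Var (p c)) = Par c" if "c \<in> par \<phi>" for c
        using that b by (auto simp: Z_def p_def)
      show "(if w \<in> Z then Par (fst w, b w) else Var w) = Var w" if "w \<in> fv \<phi>" for w
        using that \<phi> YZ by (auto simp: forms_def)
    qed
    show "(fst w, b w) \<in> par \<phi>" if "w \<in> Z" for w
      using that b by (auto simp: Z_def p_def)
  qed
qed

section \<open>Binding a free variable\<close>

text \<open>
  The index \<open>k\<close> is the number of quantifiers above the term, so that \<open>w\<close> becomes the outermost bound
  variable; its value comes last in the list of values of bound variables.
\<close>

fun tbind_var :: "'v \<Rightarrow> nat \<Rightarrow> ('v, 'f, 'c) tm \<Rightarrow> ('v, 'f, 'c) tm" where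
  "tbind_var w k (Var w') = (if w' = w then Bnd k else Var w')"
| "tbind_var w k (Bnd n) = Bnd n"
| "tbind_var w k (Par c) = Par c"
| "tbind_var w k (Fn f ts) = Fn f (map (tbind_var w k) ts)"

fun bind_var :: "'v \<Rightarrow> nat \<Rightarrow> ('v, 's, 'f, 'r, 'c) fm \<Rightarrow> ('v, 's, 'f, 'r, 'c) fm" where
  "bind_var w k Fls = Fls"
| "bind_var w k (Eq t u) = Eq (tbind_var w k t) (tbind_var w k u)"
| "bind_var w k (Rel r ts) = Rel r (map (tbind_var w k) ts)"
| "bind_var w k (Neg \<phi>) = Neg (bind_var w k \<phi>)"
| "bind_var w k (Disj \<phi> \<psi>) = Disj (bind_var w k \<phi>) (bind_var w k \<psi>)"
| "bind_var w k (Ex s \<phi>) = Ex s (bind_var w (Suc k) \<phi>)"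

lemma tfv_tbind_var: "tfv (tbind_var w k t) = tfv t - {w}"
  by (induction t) auto

lemma fv_bind_var: "fv (bind_var w k \<phi>) = fv \<phi> - {w}"
  by (induction \<phi> arbitrary: k) (auto simp: tfv_tbind_var)

lemma tpar_tbind_var: "tpar (tbind_var w k t) = tpar t"
  by (induction t) auto

lemma par_bind_var: "par (bind_var w k \<phi>) = par \<phi>"
  by (induction \<phi> arbitrary: k) (auto simp: tpar_tbind_var)

lemma tm_ok_tbind_var:
  assumes "tm_ok L B t s"
  shows "tm_ok L (B @ [fst w]) (tbind_var w (length B) t) s"
  using assms
proof (induction t arbitrary: s)
  case (Fn f ts)
  then have "list_all2 (\<lambda>t s. tm_ok L (B @ [fst w]) (tbind_var w (length B) t) s) ts (fdom L f)"
    by (auto elim!: list.rel_mono_strong)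
  with Fn show ?case by (simp add: list.rel_map)
qed (auto simp: nth_append)

lemma fm_ok_bind_var:
  assumes "fm_ok L B \<phi>"
  shows "fm_ok L (B @ [fst w]) (bind_var w (length B) \<phi>)"
  using assms
proof (induction \<phi> arbitrary: B)
  case (Eq t u)
  then obtain s where "tm_ok L B t s" "tm_ok L B u s" by auto
  then show ?case by (auto dest: tm_ok_tbind_var)
next
  case (Rel r ts)
  then have "list_all2 (\<lambda>t s. tm_ok L (B @ [fst w]) (tbind_var w (length B) t) s) ts (rdom L r)"
    by (auto elim!: list.rel_mono_strong intro: tm_ok_tbind_var)
  then show ?case by (simp add: list.rel_map)
next
  case (Ex s \<phi>)
  then show ?case using Ex.IH[of "s # B"] by simp
qed auto

lemma tval_tbind_var:
  assumes "tm_ok L B t s" "length B = length e"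
  shows "tval M v (e @ [a]) (tbind_var w (length e) t) = tval M (v(w := a)) e t"
  using assms
proof (induction t arbitrary: s)
  case (Fn f ts)
  have "map (tval M v (e @ [a])) (map (tbind_var w (length e)) ts) = map (tval M (v(w := a)) e) ts"
  proof (simp del: fun_upd_apply, intro ballI)
    fix t assume t: "t \<in> set ts"
    then obtain s where "tm_ok L B t s"
      using Fn.prems by (auto simp: list_all2_conv_all_nth in_set_conv_nth)
    from Fn.IH[OF t this Fn.prems(2)]
    show "tval M v (e @ [a]) (tbind_var w (length e) t) = tval M (v(w := a)) e t" .
  qed
  then show ?case by (simp only: tval.simps tbind_var.simps)
qed (auto simp: nth_append)

lemma sat_bind_var:
  assumes "fm_ok L B \<phi>" "length B = length e"
  shows "sat M v (e @ [a]) (bind_var w (length e) \<phi>) \<longleftrightarrow> sat M (v(w := a)) e \<phi>"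
  using assms
proof (induction \<phi> arbitrary: B e)
  case (Eq t u)
  then obtain s where "tm_ok L B t s" "tm_ok L B u s" by auto
  from tval_tbind_var[OF this(1) Eq.prems(2), of M v a w] tval_tbind_var[OF this(2) Eq.prems(2), of M v a w]
  show ?case by (simp only: sat.simps bind_var.simps)
next
  case (Rel r ts)
  have "map (tval M v (e @ [a])) (map (tbind_var w (length e)) ts) = map (tval M (v(w := a)) e) ts"
  proof (simp del: fun_upd_apply, intro ballI)
    fix t assume t: "t \<in> set ts"
    then obtain s where "tm_ok L B t s"
      using Rel.prems by (auto simp: list_all2_conv_all_nth in_set_conv_nth)
    from tval_tbind_var[OF this Rel.prems(2)]
    show "tval M v (e @ [a]) (tbind_var w (length e) t) = tval M (v(w := a)) e t" .
  qed
  then show ?case by (simp only: sat.simps bind_var.simps)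
next
  case (Ex s \<phi>)
  have "sat M v ((c # e) @ [a]) (bind_var w (length (c # e)) \<phi>) = sat M (v(w := a)) (c # e) \<phi>" for c
    using Ex.prems by (intro Ex.IH[of "s # B"]) auto
  then show ?case by (simp del: fun_upd_apply)
next
  case (Disj \<phi>1 \<phi>2)
  then have "fm_ok L B \<phi>1" "fm_ok L B \<phi>2" by auto
  then show ?case using Disj.IH(1)[OF _ Disj.prems(2)] Disj.IH(2)[OF _ Disj.prems(2)] by (simp del: fun_upd_apply)
qed (auto simp del: fun_upd_apply)

lemma sat_Ex_bind_var:
  assumes "\<phi> \<in> forms L Z A"
  shows "sat M v [] (Ex (fst w) (bind_var w 0 \<phi>)) \<longleftrightarrow> (\<exists>a\<in>carr M (fst w). sat M (v(w := a)) [] \<phi>)"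
  using assms sat_bind_var[of L "[]" \<phi> "[]" M v _ w] by (simp add: forms_def)

lemma Ex_bind_var_in_forms:
  assumes "\<phi> \<in> forms L (insert w Z) A"
  shows "Ex (fst w) (bind_var w 0 \<phi>) \<in> forms L Z A"
  using assms fm_ok_bind_var[of L "[]" \<phi> w] by (auto simp: forms_def fv_bind_var par_bind_var)

section \<open>Elementary substructures\<close>

lemma sat_elementary:
  assumes MU: "elementary_substruct L M U" and \<phi>: "\<phi> \<in> forms L Z (elts M)" and Z: "finite Z"
    and v: "v \<in> assign M Z"
  shows "sat M v [] \<phi> \<longleftrightarrow> sat U v [] \<phi>"
proof -
  obtain Y b \<psi> where Y: "Z \<inter> Y = {}" "\<psi> \<in> forms L (Z \<union> Y) {}" "inst Y b \<psi> = \<phi>"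
    "\<And>w. w \<in> Y \<Longrightarrow> (fst w, b w) \<in> par \<phi>"
    using abstract_parameters[OF \<phi> Z] by metis
  let ?v = "\<lambda>w. if w \<in> Y then b w else v w"
  have "(fst w, ?v w) \<in> elts M" if "w \<in> fv \<psi>" for w
  proof (cases "w \<in> Y")
    case True
    with Y(4)[of w] \<phi> show ?thesis by (auto simp: forms_def)
  next
    case False
    with that Y(2) v show ?thesis by (auto simp: forms_def elts_def assign_def)
  qed
  moreover have "\<psi> \<in> forms L UNIV {}" using Y(2) by (rule forms_mono) auto
  ultimately have "sat M ?v [] \<psi> \<longleftrightarrow> sat U ?v [] \<psi>"
    using MU unfolding elementary_substruct_def elementary_map_def by simp
  then show ?thesis unfolding Y(3)[symmetric] sat_inst .
qed

lemma elts_elementary: "elementary_substruct L M U \<Longrightarrow> elts M \<subseteq> elts U"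
  by (auto simp: elementary_substruct_def elementary_map_def elts_def)

lemma assign_elementary: "elementary_substruct L M U \<Longrightarrow> v \<in> assign M Z \<Longrightarrow> v \<in> assign U Z"
  by (auto simp: elementary_substruct_def elementary_map_def elts_def assign_def)

text \<open>
  Existential quantifiers over the variables in \<open>Z\<close>, one after the other, turn the claim into
  elementarity for a sentence over \<open>M\<close>.
\<close>

lemma sat_elementary_witness:
  assumes MU: "elementary_substruct L M U" and Z: "finite Z"
    and "\<phi> \<in> forms L Z (elts M)" "v \<in> assign U Z" "sat U v [] \<phi>"
  obtains v' where "v' \<in> assign M Z" "sat M v' [] \<phi>"
proof -
  have "\<exists>v'\<in>assign M Z. sat M v' [] \<phi>"
    using Z assms(3-5)
  proof (induction Z arbitrary: \<phi> rule: finite_induct)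
    case empty
    then have "v \<in> assign M {}" by (simp add: assign_def)
    with empty sat_elementary[OF MU, of \<phi> "{}" v] show ?case by auto
  next
    case (insert w Z)
    let ?\<phi> = "Ex (fst w) (bind_var w 0 \<phi>)"
    have \<phi>: "?\<phi> \<in> forms L Z (elts M)" by (rule Ex_bind_var_in_forms[OF insert.prems(1)])
    moreover have "sat U v [] ?\<phi>"
      unfolding sat_Ex_bind_var[OF insert.prems(1)]
      using insert.prems(2,3) by (intro bexI[of _ "v w"]) (auto simp: assign_def)
    moreover have "v \<in> assign U Z" using insert.prems by (auto simp: assign_def)
    ultimately obtain v' where v': "v' \<in> assign M Z" "sat M v' [] ?\<phi>" using insert.IH by blast
    then obtain a where "a \<in> carr M (fst w)" "sat M (v'(w := a)) [] \<phi>"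
      unfolding sat_Ex_bind_var[OF insert.prems(1)] by blast
    moreover from this(1) v'(1) have "v'(w := a) \<in> assign M (insert w Z)" by (simp add: assign_def)
    ultimately show ?case by blast
  qed
  then show ?thesis using that by blast
qed

text \<open>
  For finitely many formulas over \<open>M\<close>, a tuple of \<open>U\<close> can be replaced by one of \<open>M\<close>. Inequalities between
  averages over samples in \<open>M\<close> pass from \<open>M\<close> to \<open>U\<close> in this way.
\<close>

lemma sat_elementary_finite:
  assumes MU: "elementary_substruct L M U" and Z: "finite Z" and \<Theta>: "finite \<Theta>" "\<Theta> \<subseteq> forms L Z (elts M)"
    and v: "v \<in> assign U Z"
  obtains v' where "v' \<in> assign M Z" "\<And>\<theta>. \<theta> \<in> \<Theta> \<Longrightarrow> sat M v' [] \<theta> \<longleftrightarrow> sat U v [] \<theta>"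
proof -
  obtain \<theta>s where \<theta>s: "set \<theta>s = \<Theta>" using \<Theta>(1) finite_list by blast
  let ?\<phi> = "Conjs (map (\<lambda>\<theta>. if sat U v [] \<theta> then \<theta> else Neg \<theta>) \<theta>s)"
  have "?\<phi> \<in> forms L Z (elts M)" using \<theta>s \<Theta> by auto
  moreover have "sat U v [] ?\<phi>" by auto
  ultimately obtain v' where v': "v' \<in> assign M Z" "sat M v' [] ?\<phi>"
    using sat_elementary_witness[OF MU Z _ v] by blast
  have "sat M v' [] \<theta> \<longleftrightarrow> sat U v [] \<theta>" if "\<theta> \<in> \<Theta>" for \<theta>
  proof -
    have "sat M v' [] (if sat U v [] \<theta> then \<theta> else Neg \<theta>)"
      using v'(2) that \<theta>s unfolding sat_Conjs by fastforce
    then show ?thesis by (auto split: if_splits)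
  qed
  with v'(1) show ?thesis by (rule that)
qed

section \<open>Types\<close>

text \<open>
  Properties of types that involve finitely many formulas can be checked at realized types.
\<close>

lemma type_realized_finite:
  assumes p: "p \<in> types L M Z A" and \<Theta>: "finite \<Theta>" "\<Theta> \<subseteq> forms L Z A"
  obtains b where "b \<in> assign M Z" "\<And>\<theta>. \<theta> \<in> \<Theta> \<Longrightarrow> \<theta> \<in> p \<longleftrightarrow> sat M b [] \<theta>"
proof -
  let ?q = "(\<Theta> \<union> Neg ` \<Theta>) \<inter> p"
  have "finite ?q" "?q \<subseteq> p" using \<Theta> by auto
  then obtain b where b: "b \<in> assign M Z" "\<forall>\<phi>\<in>?q. sat M b [] \<phi>"
    using p unfolding types_def by blast
  have "\<theta> \<in> p \<longleftrightarrow> sat M b [] \<theta>" if "\<theta> \<in> \<Theta>" for \<theta>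
  proof (cases "\<theta> \<in> p")
    case True
    with b that show ?thesis by auto
  next
    case False
    then have "Neg \<theta> \<in> p" using p \<Theta> that unfolding types_def by blast
    with b that have "sat M b [] (Neg \<theta>)" by blast
    with False show ?thesis by simp
  qed
  with b(1) show ?thesis by (rule that)
qed

lemma type_Neg:
  assumes "p \<in> types L M Z A" "\<phi> \<in> forms L Z A"
  shows "Neg \<phi> \<in> p \<longleftrightarrow> \<phi> \<notin> p"
proof -
  have "finite {\<phi>, Neg \<phi>}" "{\<phi>, Neg \<phi>} \<subseteq> forms L Z A" using assms by simp_all
  from type_realized_finite[OF assms(1) this] obtain b
    where "\<forall>\<theta>\<in>{\<phi>, Neg \<phi>}. \<theta> \<in> p \<longleftrightarrow> sat M b [] \<theta>" by metis
  then show ?thesis by simp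
qed

lemma type_Disj:
  assumes "p \<in> types L M Z A" "\<phi> \<in> forms L Z A" "\<psi> \<in> forms L Z A"
  shows "Disj \<phi> \<psi> \<in> p \<longleftrightarrow> \<phi> \<in> p \<or> \<psi> \<in> p"
proof -
  have "finite {\<phi>, \<psi>, Disj \<phi> \<psi>}" "{\<phi>, \<psi>, Disj \<phi> \<psi>} \<subseteq> forms L Z A" using assms by simp_all
  from type_realized_finite[OF assms(1) this] obtain b
    where "\<forall>\<theta>\<in>{\<phi>, \<psi>, Disj \<phi> \<psi>}. \<theta> \<in> p \<longleftrightarrow> sat M b [] \<theta>" by metis
  then show ?thesis by simp
qed

lemma type_Conj:
  assumes "p \<in> types L M Z A" "\<phi> \<in> forms L Z A" "\<psi> \<in> forms L Z A"
  shows "Conj \<phi> \<psi> \<in> p \<longleftrightarrow> \<phi> \<in> p \<and> \<psi> \<in> p"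
  unfolding Conj_def using assms by (simp add: type_Neg type_Disj)

lemma type_Fls: "p \<in> types L M Z A \<Longrightarrow> Fls \<notin> p"
  using type_realized_finite[of p L M Z A "{Fls}"] by auto

lemma tp_in_types: "b \<in> assign M Z \<Longrightarrow> tp L M Z A b \<in> types L M Z A"
  unfolding types_def tp_def by auto

lemma tp_in_types_elementary:
  assumes "elementary_substruct L M U" "finite Z" "b \<in> assign U Z"
  shows "tp L U Z (elts M) b \<in> types L M Z (elts M)"
  unfolding types_def mem_Collect_eq
proof (intro conjI allI impI ballI)
  fix q assume q: "q \<subseteq> tp L U Z (elts M) b" "finite q"
  then have "q \<subseteq> forms L Z (elts M)" by (auto simp: tp_def)
  then obtain b' where b': "b' \<in> assign M Z" "\<And>\<theta>. \<theta> \<in> q \<Longrightarrow> sat M b' [] \<theta> \<longleftrightarrow> sat U b [] \<theta>"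
    using sat_elementary_finite[OF assms(1,2) q(2) _ assms(3)] by blast
  with q(1) show "\<exists>b\<in>assign M Z. \<forall>\<phi>\<in>q. sat M b [] \<phi>"
    by (intro bexI[of _ b']) (auto simp: tp_def)
qed (auto simp: tp_def)

section \<open>Type spaces are Stone spaces\<close>

lemma basic_clopen_Neg:
  "\<phi> \<in> forms L Z A \<Longrightarrow> basic_clopen L M Z A (Neg \<phi>) = types L M Z A - basic_clopen L M Z A \<phi>"
  by (auto simp: basic_clopen_def type_Neg)

lemma basic_clopen_Disj:
  "\<phi> \<in> forms L Z A \<Longrightarrow> \<psi> \<in> forms L Z A \<Longrightarrow>
    basic_clopen L M Z A (Disj \<phi> \<psi>) = basic_clopen L M Z A \<phi> \<union> basic_clopen L M Z A \<psi>"
  by (auto simp: basic_clopen_def type_Disj)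

lemma basic_clopen_Conj:
  "\<phi> \<in> forms L Z A \<Longrightarrow> \<psi> \<in> forms L Z A \<Longrightarrow>
    basic_clopen L M Z A (Conj \<phi> \<psi>) = basic_clopen L M Z A \<phi> \<inter> basic_clopen L M Z A \<psi>"
  by (auto simp: basic_clopen_def type_Conj)

lemma basic_clopen_Fls: "basic_clopen L M Z A Fls = {}"
  by (auto simp: basic_clopen_def type_Fls)

lemma topspace_type_topology [simp]: "topspace (type_topology L M Z A) = types L M Z A"
proof -
  have "basic_clopen L M Z A (Neg Fls) = types L M Z A"
    by (simp add: basic_clopen_Neg basic_clopen_Fls)
  moreover have "Neg Fls \<in> forms L Z A" by simp
  ultimately have "types L M Z A \<subseteq> \<Union> (basic_clopen L M Z A ` forms L Z A)" by blast
  moreover have "\<Union> (basic_clopen L M Z A ` forms L Z A) \<subseteq> types L M Z A"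
    unfolding basic_clopen_def by blast
  ultimately have "\<Union> (basic_clopen L M Z A ` forms L Z A) = types L M Z A" by (rule antisym[rotated])
  then show ?thesis unfolding type_topology_def by simp
qed

lemma openin_basic_clopen:
  "\<phi> \<in> forms L Z A \<Longrightarrow> openin (type_topology L M Z A) (basic_clopen L M Z A \<phi>)"
  unfolding type_topology_def by (rule topology_generated_by_Basis) simp

text \<open>The generating sets are closed under intersections, so they are a base.\<close>

lemma generated_topology_base:
  assumes "generate_topology_on (basic_clopen L M Z A ` forms L Z A) V" "q \<in> V" "q \<in> types L M Z A"
  shows "\<exists>\<theta>\<in>forms L Z A. \<theta> \<in> q \<and> basic_clopen L M Z A \<theta> \<subseteq> V"
  using assms
proof (induction rule: generate_topology_on.induct)
  case (Int a b)
  then obtain \<theta> \<theta>' where th: "\<theta> \<in> forms L Z A" "\<theta> \<in> q" "basic_clopen L M Z A \<theta> \<subseteq> a"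
    "\<theta>' \<in> forms L Z A" "\<theta>' \<in> q" "basic_clopen L M Z A \<theta>' \<subseteq> b" by blast
  with Int.prems(2) have "Conj \<theta> \<theta>' \<in> q" by (simp add: type_Conj)
  with th show ?case by (intro bexI[of _ "Conj \<theta> \<theta>'"]) (auto simp: basic_clopen_Conj)
next
  case (UN K)
  then show ?case by (meson Union_iff Union_upper subset_trans)
next
  case (Basis s)
  then show ?case by (auto simp: basic_clopen_def)
qed simp

lemma type_topology_base:
  assumes "openin (type_topology L M Z A) V" "q \<in> V"
  obtains \<theta> where "\<theta> \<in> forms L Z A" "\<theta> \<in> q" "basic_clopen L M Z A \<theta> \<subseteq> V"
proof -
  have "generate_topology_on (basic_clopen L M Z A ` forms L Z A) V"
    using assms(1) unfolding type_topology_def by (simp add: openin_topology_generated_by)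
  moreover have "q \<in> types L M Z A" using assms openin_subset by fastforce
  ultimately show ?thesis using generated_topology_base[OF _ assms(2)] that by blast
qed

text \<open>
  A maximal finitely satisfiable set of formulas, as given by Zorn's lemma, decides every formula.
\<close>

lemma extend_to_type:
  assumes P: "P \<subseteq> forms L Z A"
    and fs: "\<And>q. q \<subseteq> P \<Longrightarrow> finite q \<Longrightarrow> \<exists>b\<in>assign M Z. \<forall>\<phi>\<in>q. sat M b [] \<phi>"
  obtains p where "p \<in> types L M Z A" "P \<subseteq> p"
proof -
  let ?S = "{p. P \<subseteq> p \<and> p \<subseteq> forms L Z A \<and>
    (\<forall>q. q \<subseteq> p \<longrightarrow> finite q \<longrightarrow> (\<exists>b\<in>assign M Z. \<forall>\<phi>\<in>q. sat M b [] \<phi>))}"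
  have "\<exists>p\<in>?S. \<forall>X\<in>?S. p \<subseteq> X \<longrightarrow> X = p"
  proof (rule subset_Zorn_nonempty)
    show "?S \<noteq> {}" using P fs by blast
    fix C assume C: "C \<noteq> {}" "subset.chain ?S C"
    then have CS: "C \<subseteq> ?S" by (simp add: subset.chain_def)
    have "\<exists>b\<in>assign M Z. \<forall>\<phi>\<in>q. sat M b [] \<phi>" if q: "q \<subseteq> \<Union>C" "finite q" for q
    proof -
      obtain p where "p \<in> C" "q \<subseteq> p" using finite_subset_Union_chain[OF q(2,1) C] by blast
      with CS q(2) show ?thesis by blast
    qed
    moreover have "P \<subseteq> \<Union>C" "\<Union>C \<subseteq> forms L Z A" using C(1) CS by blast+
    ultimately show "\<Union>C \<in> ?S" by blast
  qed
  then obtain p where p: "p \<in> ?S" and "\<forall>X\<in>?S. p \<subseteq> X \<longrightarrow> X = p" ..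
  then have max: "X = p" if "X \<in> ?S" "p \<subseteq> X" for X using that by (metis (lifting))
  have "\<phi> \<in> p \<or> Neg \<phi> \<in> p" if \<phi>: "\<phi> \<in> forms L Z A" for \<phi>
  proof (rule ccontr)
    assume *: "\<not> ?thesis"
    have bad: "\<exists>q. q \<subseteq> p \<and> finite q \<and> \<not> (\<exists>b\<in>assign M Z. sat M b [] \<psi> \<and> (\<forall>\<phi>\<in>q. sat M b [] \<phi>))"
      if \<psi>: "\<psi> = \<phi> \<or> \<psi> = Neg \<phi>" for \<psi>
    proof (rule ccontr)
      assume good: "\<not> ?thesis"
      have "insert \<psi> p \<in> ?S"
      proof (clarsimp, intro conjI allI impI)
        show "P \<subseteq> insert \<psi> p" using p by auto
        show "\<psi> \<in> forms L Z A" using \<psi> \<phi> by auto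
        show "p \<subseteq> forms L Z A" using p by auto
        fix q assume q: "q \<subseteq> insert \<psi> p" "finite q"
        then have "q - {\<psi>} \<subseteq> p" "finite (q - {\<psi>})" by auto
        with good obtain b where "b \<in> assign M Z" "sat M b [] \<psi>" "\<forall>\<phi>\<in>q - {\<psi>}. sat M b [] \<phi>" by blast
        then show "\<exists>b\<in>assign M Z. \<forall>\<phi>\<in>q. sat M b [] \<phi>" by blast
      qed
      then have "insert \<psi> p = p" by (rule max) auto
      with * \<psi> show False by blast
    qed
    obtain q1 where q1: "q1 \<subseteq> p" "finite q1" "\<not> (\<exists>b\<in>assign M Z. sat M b [] \<phi> \<and> (\<forall>\<phi>\<in>q1. sat M b [] \<phi>))"
      using bad[of \<phi>] by blast
    obtain q2 where q2: "q2 \<subseteq> p" "finite q2" "\<not> (\<exists>b\<in>assign M Z. sat M b [] (Neg \<phi>) \<and> (\<forall>\<phi>\<in>q2. sat M b [] \<phi>))"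
      using bad[of "Neg \<phi>"] by blast
    have "q1 \<union> q2 \<subseteq> p" "finite (q1 \<union> q2)" using q1 q2 by auto
    then obtain b where "b \<in> assign M Z" "\<forall>\<phi>\<in>q1 \<union> q2. sat M b [] \<phi>" using p by blast
    with q1(3) q2(3) show False by auto
  qed
  with p have "p \<in> types L M Z A" unfolding types_def by blast
  with p show ?thesis using that by blast
qed

text \<open>
  If no finitely many basic clopen sets that refine the cover suffice, then the negations of their
  formulas are finitely satisfiable and lie in a common type, which no member of the cover contains.
\<close>

lemma compact_type_topology: "compact_space (type_topology L M Z A)"
  unfolding compact_space_def compactin_def
proof (intro conjI allI impI)
  show "topspace (type_topology L M Z A) \<subseteq> topspace (type_topology L M Z A)" by simp
  fix \<U> assume "Ball \<U> (openin (type_topology L M Z A)) \<and> topspace (type_topology L M Z A) \<subseteq> \<Union>\<U>"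
  then have op: "\<And>V. V \<in> \<U> \<Longrightarrow> openin (type_topology L M Z A) V" and cov: "types L M Z A \<subseteq> \<Union>\<U>" by auto
  define \<Sigma> where "\<Sigma> = {\<theta>\<in>forms L Z A. \<exists>V\<in>\<U>. basic_clopen L M Z A \<theta> \<subseteq> V}"
  have "\<exists>\<Theta>. finite \<Theta> \<and> \<Theta> \<subseteq> \<Sigma> \<and> types L M Z A \<subseteq> (\<Union>\<theta>\<in>\<Theta>. basic_clopen L M Z A \<theta>)"
  proof (rule ccontr)
    assume none: "\<not> ?thesis"
    have "\<exists>p\<in>types L M Z A. Neg ` \<Sigma> \<subseteq> p"
    proof -
      have fs: "\<exists>b\<in>assign M Z. \<forall>\<phi>\<in>q. sat M b [] \<phi>" if q: "q \<subseteq> Neg ` \<Sigma>" "finite q" for q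
      proof -
        obtain \<Theta> where \<Theta>: "\<Theta> \<subseteq> \<Sigma>" "finite \<Theta>" "q = Neg ` \<Theta>"
          using finite_subset_image[OF q(2,1)] by blast
        then obtain p where p: "p \<in> types L M Z A" "p \<notin> (\<Union>\<theta>\<in>\<Theta>. basic_clopen L M Z A \<theta>)"
          using none by blast
        have "\<Theta> \<subseteq> forms L Z A" using \<Theta>(1) by (auto simp: \<Sigma>_def)
        then obtain b where b: "b \<in> assign M Z" "\<And>\<theta>. \<theta> \<in> \<Theta> \<Longrightarrow> \<theta> \<in> p \<longleftrightarrow> sat M b [] \<theta>"
          using type_realized_finite[OF p(1) \<Theta>(2)] by blast
        have "\<not> sat M b [] \<theta>" if "\<theta> \<in> \<Theta>" for \<theta>
          using b(2)[OF that] p that by (auto simp: basic_clopen_def)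
        with b(1) \<Theta>(3) show ?thesis by auto
      qed
      have "Neg ` \<Sigma> \<subseteq> forms L Z A" by (auto simp: \<Sigma>_def)
      from extend_to_type[OF this fs] show ?thesis by metis
    qed
    then obtain p where p: "p \<in> types L M Z A" "Neg ` \<Sigma> \<subseteq> p" by blast
    with cov obtain V where V: "V \<in> \<U>" "p \<in> V" by blast
    obtain \<theta> where \<theta>: "\<theta> \<in> forms L Z A" "\<theta> \<in> p" "basic_clopen L M Z A \<theta> \<subseteq> V"
      using type_topology_base[OF op[OF V(1)] V(2)] by blast
    with V have "\<theta> \<in> \<Sigma>" by (auto simp: \<Sigma>_def)
    with p have "Neg \<theta> \<in> p" by blast
    with type_Neg[OF p(1) \<theta>(1)] \<theta>(2) show False by blast
  qed
  then obtain \<Theta> where \<Theta>: "finite \<Theta>" "\<Theta> \<subseteq> \<Sigma>" "types L M Z A \<subseteq> (\<Union>\<theta>\<in>\<Theta>. basic_clopen L M Z A \<theta>)" by blast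
  have "\<forall>\<theta>\<in>\<Theta>. \<exists>V. V \<in> \<U> \<and> basic_clopen L M Z A \<theta> \<subseteq> V" using \<Theta>(2) unfolding \<Sigma>_def by blast
  then obtain f where f: "\<forall>\<theta>\<in>\<Theta>. f \<theta> \<in> \<U> \<and> basic_clopen L M Z A \<theta> \<subseteq> f \<theta>" by metis
  show "\<exists>\<F>. finite \<F> \<and> \<F> \<subseteq> \<U> \<and> topspace (type_topology L M Z A) \<subseteq> \<Union>\<F>"
    using \<Theta>(1,3) f by (intro exI[of _ "f ` \<Theta>"]) fastforce
qed

lemma algebra_basic_clopen:
  "algebra (types L M Z A) (basic_clopen L M Z A ` forms L Z A)"
  unfolding algebra_iff_Un
proof (intro conjI ballI)
  let ?B = "basic_clopen L M Z A ` forms L Z A"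
  show "?B \<subseteq> Pow (types L M Z A)" by (auto simp: basic_clopen_def)
  show "{} \<in> ?B" using basic_clopen_Fls[of L M Z A] forms_simps(1)[of L Z A] by (metis image_eqI)
  fix a assume "a \<in> ?B"
  then obtain \<phi> where \<phi>: "\<phi> \<in> forms L Z A" "a = basic_clopen L M Z A \<phi>" by blast
  then show "types L M Z A - a \<in> ?B"
    by (intro image_eqI[of _ _ "Neg \<phi>"]) (simp_all add: basic_clopen_Neg)
  fix b assume "b \<in> ?B"
  then obtain \<psi> where \<psi>: "\<psi> \<in> forms L Z A" "b = basic_clopen L M Z A \<psi>" by blast
  with \<phi> show "a \<union> b \<in> ?B"
    by (intro image_eqI[of _ _ "Disj \<phi> \<psi>"]) (simp_all add: basic_clopen_Disj)
qed

section \<open>Continuous functions on type spaces\<close>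

lemma continuous_map_types_iff:
  "continuous_map (type_topology L M Z A) (top_of_set {0..1}) F \<longleftrightarrow>
    (\<forall>q\<in>types L M Z A. F q \<in> {0..1 :: real}) \<and>
    (\<forall>q\<in>types L M Z A. \<forall>\<epsilon>>0. \<exists>\<theta>\<in>forms L Z A. \<theta> \<in> q \<and>
       (\<forall>p\<in>types L M Z A. \<theta> \<in> p \<longrightarrow> \<bar>F p - F q\<bar> < \<epsilon>))" (is "?l \<longleftrightarrow> ?r \<and> ?c")
proof -
  let ?T = "type_topology L M Z A"
  have "?l \<longleftrightarrow> continuous_map ?T euclidean F \<and> ?r"
    unfolding continuous_map_in_subtopology by auto
  moreover have "continuous_map ?T euclidean F \<longleftrightarrow>
      (\<forall>q\<in>types L M Z A. \<forall>\<epsilon>>0. \<exists>V. openin ?T V \<and> q \<in> V \<and> (\<forall>p\<in>V. F p \<in> ball (F q) \<epsilon>))"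
    using Met_TC.continuous_map_to_metric[of ?T F] by simp
  moreover have "(\<exists>V. openin ?T V \<and> q \<in> V \<and> (\<forall>p\<in>V. F p \<in> ball (F q) \<epsilon>)) \<longleftrightarrow>
      (\<exists>\<theta>\<in>forms L Z A. \<theta> \<in> q \<and> (\<forall>p\<in>types L M Z A. \<theta> \<in> p \<longrightarrow> \<bar>F p - F q\<bar> < \<epsilon>))"
    if q: "q \<in> types L M Z A" for q \<epsilon>
  proof
    assume "\<exists>V. openin ?T V \<and> q \<in> V \<and> (\<forall>p\<in>V. F p \<in> ball (F q) \<epsilon>)"
    then obtain V where V: "openin ?T V" "q \<in> V" "\<forall>p\<in>V. F p \<in> ball (F q) \<epsilon>" by blast
    obtain \<theta> where \<theta>: "\<theta> \<in> forms L Z A" "\<theta> \<in> q" "basic_clopen L M Z A \<theta> \<subseteq> V"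
      using type_topology_base[OF V(1,2)] by blast
    with V(3) show "\<exists>\<theta>\<in>forms L Z A. \<theta> \<in> q \<and> (\<forall>p\<in>types L M Z A. \<theta> \<in> p \<longrightarrow> \<bar>F p - F q\<bar> < \<epsilon>)"
      by (intro bexI[of _ \<theta>]) (auto simp: basic_clopen_def dist_real_def abs_minus_commute)
  next
    assume "\<exists>\<theta>\<in>forms L Z A. \<theta> \<in> q \<and> (\<forall>p\<in>types L M Z A. \<theta> \<in> p \<longrightarrow> \<bar>F p - F q\<bar> < \<epsilon>)"
    then obtain \<theta> where "\<theta> \<in> forms L Z A" "\<theta> \<in> q" "\<forall>p\<in>types L M Z A. \<theta> \<in> p \<longrightarrow> \<bar>F p - F q\<bar> < \<epsilon>" by blast
    with q have "openin ?T (basic_clopen L M Z A \<theta>)" "q \<in> basic_clopen L M Z A \<theta>"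
      "\<forall>p\<in>basic_clopen L M Z A \<theta>. F p \<in> ball (F q) \<epsilon>"
      by (simp_all add: openin_basic_clopen) (simp_all add: basic_clopen_def dist_real_def abs_minus_commute)
    then show "\<exists>V. openin ?T V \<and> q \<in> V \<and> (\<forall>p\<in>V. F p \<in> ball (F q) \<epsilon>)" by blast
  qed
  ultimately show ?thesis by (simp add: conj_commute)
qed

text \<open>Realized types are dense.\<close>

lemma continuous_types_eqI:
  assumes F: "continuous_map (type_topology L M Z A) (top_of_set {0..1 :: real}) F"
    and F': "continuous_map (type_topology L M Z A) (top_of_set {0..1}) F'"
    and eq: "\<And>b. b \<in> assign M Z \<Longrightarrow> F (tp L M Z A b) = F' (tp L M Z A b)"
    and q: "q \<in> types L M Z A"
  shows "F q = F' q"
proof (rule ccontr)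
  assume "F q \<noteq> F' q"
  then have e: "\<bar>F q - F' q\<bar> / 2 > 0" by simp
  obtain \<theta> where \<theta>: "\<theta> \<in> forms L Z A" "\<theta> \<in> q" "\<forall>p\<in>types L M Z A. \<theta> \<in> p \<longrightarrow> \<bar>F p - F q\<bar> < \<bar>F q - F' q\<bar> / 2"
    using F[unfolded continuous_map_types_iff] q e by blast
  obtain \<theta>' where \<theta>': "\<theta>' \<in> forms L Z A" "\<theta>' \<in> q" "\<forall>p\<in>types L M Z A. \<theta>' \<in> p \<longrightarrow> \<bar>F' p - F' q\<bar> < \<bar>F q - F' q\<bar> / 2"
    using F'[unfolded continuous_map_types_iff] q e by blast
  have "finite {\<theta>, \<theta>'}" "{\<theta>, \<theta>'} \<subseteq> forms L Z A" using \<theta> \<theta>' by auto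
  then obtain b where b: "b \<in> assign M Z" "\<And>\<phi>. \<phi> \<in> {\<theta>, \<theta>'} \<Longrightarrow> \<phi> \<in> q \<longleftrightarrow> sat M b [] \<phi>"
    using type_realized_finite[OF q] by blast
  let ?p = "tp L M Z A b"
  have "?p \<in> types L M Z A" "\<theta> \<in> ?p" "\<theta>' \<in> ?p"
    using b \<theta> \<theta>' tp_in_types[OF b(1), of L A] by (simp_all add: tp_def)
  with \<theta>(3) \<theta>'(3) have "\<bar>F ?p - F q\<bar> < \<bar>F q - F' q\<bar> / 2" "\<bar>F' ?p - F' q\<bar> < \<bar>F q - F' q\<bar> / 2"
    by blast+
  moreover have "\<bar>F q - F' q\<bar> \<le> \<bar>F ?p - F q\<bar> + \<bar>F' ?p - F' q\<bar>"
    using abs_triangle_ineq4[of "F' ?p - F' q" "F ?p - F q"] eq[OF b(1)] by simp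
  ultimately show False by simp
qed

text \<open>
  Compactness gives finitely many clopen sets on each of which \<open>F\<close> is \<open>\<epsilon>\<close>-close to a constant; removing the
  earlier ones from each makes them disjoint.
\<close>

lemma continuous_types_partition:
  assumes F: "continuous_map (type_topology L M Z A) (top_of_set {0..1 :: real}) F" and e: "0 < \<epsilon>"
  obtains n :: nat and \<xi> t where "\<And>i. i < n \<Longrightarrow> \<xi> i \<in> forms L Z A"
    "\<And>q. q \<in> types L M Z A \<Longrightarrow> \<exists>!i. i < n \<and> \<xi> i \<in> q"
    "\<And>q i. q \<in> types L M Z A \<Longrightarrow> i < n \<Longrightarrow> \<xi> i \<in> q \<Longrightarrow> \<bar>F q - t i\<bar> \<le> \<epsilon>"
    "\<And>i. 0 \<le> t i \<and> t i \<le> 1"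
proof -
  define good where "good \<theta> s \<longleftrightarrow> \<theta> \<in> forms L Z A \<and> 0 \<le> s \<and> s \<le> 1 \<and>
    (\<forall>q\<in>types L M Z A. \<theta> \<in> q \<longrightarrow> \<bar>F q - s\<bar> \<le> \<epsilon>)" for \<theta> s
  let ?U = "{basic_clopen L M Z A \<theta> | \<theta>. \<exists>s. good \<theta> s}"
  have "types L M Z A \<subseteq> \<Union>?U"
  proof
    fix q assume q: "q \<in> types L M Z A"
    then obtain \<theta> where "\<theta> \<in> forms L Z A" "\<theta> \<in> q" "\<forall>p\<in>types L M Z A. \<theta> \<in> p \<longrightarrow> \<bar>F p - F q\<bar> < \<epsilon>"
      using F[unfolded continuous_map_types_iff] e by blast
    moreover have "F q \<in> {0..1}" using F q unfolding continuous_map_types_iff by blast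
    ultimately have "good \<theta> (F q)" "q \<in> basic_clopen L M Z A \<theta>"
      using q by (simp_all add: good_def basic_clopen_def less_imp_le)
    then show "q \<in> \<Union>?U" by blast
  qed
  moreover have "openin (type_topology L M Z A) V" if V: "V \<in> ?U" for V
  proof -
    obtain \<theta> s where "good \<theta> s" "V = basic_clopen L M Z A \<theta>" using V by blast
    then show ?thesis by (simp add: good_def openin_basic_clopen)
  qed
  ultimately have "\<exists>\<F>. finite \<F> \<and> \<F> \<subseteq> ?U \<and> types L M Z A \<subseteq> \<Union>\<F>"
    using compact_type_topology[of L M Z A, unfolded compact_space_def topspace_type_topology]
    by (intro compactinD)
  then obtain \<F> where \<F>: "finite \<F>" "\<F> \<subseteq> ?U" "types L M Z A \<subseteq> \<Union>\<F>"
    by (elim exE conjE)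
  obtain \<Theta> where \<Theta>: "finite \<Theta>" "\<Theta> \<subseteq> {\<theta>. \<exists>s. good \<theta> s}" "\<F> = basic_clopen L M Z A ` \<Theta>"
    using finite_subset_image[OF \<F>(1), of "basic_clopen L M Z A" "{\<theta>. \<exists>s. good \<theta> s}"] \<F>(2) by blast
  obtain \<theta>s where \<theta>s: "set \<theta>s = \<Theta>" using finite_list[OF \<Theta>(1)] by blast
  have ex: "\<forall>\<theta>\<in>\<Theta>. \<exists>s. good \<theta> s" using \<Theta>(2) by blast
  define \<xi> where "\<xi> i = Conj (\<theta>s ! i) (Conjs (map Neg (take i \<theta>s)))" for i
  define s where "s i = (if i < length \<theta>s then SOME s. good (\<theta>s ! i) s else 0)" for i
  have s: "good (\<theta>s ! i) (s i)" if "i < length \<theta>s" for i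
  proof -
    have "\<exists>s. good (\<theta>s ! i) s" using ex \<theta>s nth_mem[OF that] by blast
    then show ?thesis using that by (simp add: s_def someI_ex)
  qed
  have fo: "\<theta>s ! i \<in> forms L Z A" if "i < length \<theta>s" for i
    using s[OF that] by (simp add: good_def)
  have sub: "set \<theta>s \<subseteq> forms L Z A" using fo by (auto simp: in_set_conv_nth)
  have \<xi>f: "\<xi> i \<in> forms L Z A" if "i < length \<theta>s" for i
    using fo[OF that] sub by (auto simp: \<xi>_def dest: in_set_takeD)
  have \<xi>q: "\<xi> i \<in> q \<longleftrightarrow> \<theta>s ! i \<in> q \<and> (\<forall>k<i. \<theta>s ! k \<notin> q)" if i: "i < length \<theta>s" and q: "q \<in> types L M Z A" for i q
  proof -
    have "finite (insert (\<xi> i) (set \<theta>s))" "insert (\<xi> i) (set \<theta>s) \<subseteq> forms L Z A" using sub \<xi>f[OF i] by auto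
    then obtain b where b: "\<And>\<phi>. \<phi> \<in> insert (\<xi> i) (set \<theta>s) \<Longrightarrow> \<phi> \<in> q \<longleftrightarrow> sat M b [] \<phi>"
      using type_realized_finite[OF q] by blast
    have "\<theta>s ! k \<in> q \<longleftrightarrow> sat M b [] (\<theta>s ! k)" if "k \<le> i" for k using that i b by simp
    moreover have "sat M b [] (\<xi> i) \<longleftrightarrow> sat M b [] (\<theta>s ! i) \<and> (\<forall>k<i. \<not> sat M b [] (\<theta>s ! k))"
      using i by (auto simp: \<xi>_def nth_image[of i \<theta>s, symmetric])
    ultimately show ?thesis using b[of "\<xi> i"] by simp
  qed
  show ?thesis
  proof (rule that[of "length \<theta>s" \<xi> s])
    show "\<exists>!i. i < length \<theta>s \<and> \<xi> i \<in> q" if q: "q \<in> types L M Z A" for q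
    proof -
      obtain \<theta> where "\<theta> \<in> \<Theta>" "\<theta> \<in> q" using q \<F>(3) \<Theta>(3) by (auto simp: basic_clopen_def)
      then have ex: "\<exists>i. i < length \<theta>s \<and> \<theta>s ! i \<in> q" using \<theta>s by (metis in_set_conv_nth)
      let ?i = "LEAST i. i < length \<theta>s \<and> \<theta>s ! i \<in> q"
      have i: "?i < length \<theta>s" "\<theta>s ! ?i \<in> q" using LeastI_ex[OF ex] by auto
      have lt: "\<theta>s ! k \<notin> q" if "k < ?i" for k using not_less_Least[OF that] that i(1) by auto
      show ?thesis
      proof (rule ex1I[of _ ?i])
        show "?i < length \<theta>s \<and> \<xi> ?i \<in> q" using i lt \<xi>q[OF i(1) q] by blast
        fix k assume k: "k < length \<theta>s \<and> \<xi> k \<in> q"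
        then have "\<theta>s ! k \<in> q" "\<forall>l<k. \<theta>s ! l \<notin> q" using \<xi>q[of k q] q by auto
        with i(2) have "\<not> ?i < k" by blast
        moreover have "\<not> k < ?i" using lt \<open>\<theta>s ! k \<in> q\<close> by blast
        ultimately show "k = ?i" by linarith
      qed
    qed
    show "\<bar>F q - s i\<bar> \<le> \<epsilon>" if "q \<in> types L M Z A" "i < length \<theta>s" "\<xi> i \<in> q" for q i
      using s[OF that(2)] \<xi>q[OF that(2,1)] that by (auto simp: good_def)
    show "0 \<le> s i \<and> s i \<le> 1" for i
      using s[of i] by (cases "i < length \<theta>s") (auto simp: good_def s_def)
  qed (rule \<xi>f)
qed

section \<open>Keisler measures as regular Borel measures\<close>

text \<open>
  On the clopen sets of formulas, a Keisler measure is a content: formulas with the same clopen set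
  are equivalent, since they agree at realized types. The definite description in \<open>type_measure\<close> then
  denotes the regular Borel extension.
\<close>

lemma type_measure:
  assumes K: "keisler L M y A \<nu>"
  shows "regular_borel_prob (type_topology L M {y} A) (type_measure L M y A \<nu>)"
    and "\<And>\<phi>. \<phi> \<in> forms L {y} A \<Longrightarrow> measure (type_measure L M y A \<nu>) (basic_clopen L M {y} A \<phi>) = \<nu> \<phi>"
proof -
  let ?T = "type_topology L M {y} A" and ?c = "basic_clopen L M {y} A"
  define m where "m S = \<nu> (SOME \<phi>. \<phi> \<in> forms L {y} A \<and> ?c \<phi> = S)" for S
  have eqv: "sat M b [] \<phi> \<longleftrightarrow> sat M b [] \<psi>"
    if "\<phi> \<in> forms L {y} A" "\<psi> \<in> forms L {y} A" "?c \<phi> = ?c \<psi>" "b \<in> assign M {y}" for \<phi> \<psi> b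
  proof -
    have "tp L M {y} A b \<in> ?c \<phi> \<longleftrightarrow> tp L M {y} A b \<in> ?c \<psi>" using that by simp
    then show ?thesis using that tp_in_types[OF that(4), of L A] by (simp add: basic_clopen_def tp_def)
  qed
  have m: "m (?c \<phi>) = \<nu> \<phi>" if \<phi>: "\<phi> \<in> forms L {y} A" for \<phi>
  proof -
    let ?\<psi> = "SOME \<psi>. \<psi> \<in> forms L {y} A \<and> ?c \<psi> = ?c \<phi>"
    have \<psi>: "?\<psi> \<in> forms L {y} A \<and> ?c ?\<psi> = ?c \<phi>" by (rule someI_ex) (use \<phi> in blast)
    then have "\<forall>b\<in>assign M {y}. sat M b [] ?\<psi> \<longleftrightarrow> sat M b [] \<phi>" using eqv \<phi> by blast
    then have "\<nu> ?\<psi> = \<nu> \<phi>" using K \<phi> \<psi> unfolding keisler_def by blast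
    then show ?thesis by (simp add: m_def)
  qed
  have alg': "algebra (topspace ?T) (?c ` forms L {y} A)"
    unfolding topspace_type_topology by (rule algebra_basic_clopen)
  interpret cc: clopen_content ?T "?c ` forms L {y} A" m
  proof (intro clopen_content.intro[OF alg'] clopen_content_axioms.intro, unfold topspace_type_topology)
    show "compact_space ?T" by (rule compact_type_topology)
    show "openin ?T S" if "S \<in> ?c ` forms L {y} A" for S using that openin_basic_clopen by blast
    show "\<exists>S\<in>?c ` forms L {y} A. q \<in> S \<and> S \<subseteq> V" if V: "openin ?T V" "q \<in> V" for V q
    proof -
      obtain \<theta> where \<theta>: "\<theta> \<in> forms L {y} A" "\<theta> \<in> q" "?c \<theta> \<subseteq> V" using type_topology_base[OF V] by blast
      have "q \<in> types L M {y} A" using V openin_subset by fastforce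
      with \<theta> show ?thesis by (intro bexI[of _ "?c \<theta>"]) (auto simp: basic_clopen_def)
    qed
    show "0 \<le> m S" if S: "S \<in> ?c ` forms L {y} A" for S
    proof -
      obtain \<phi> where "\<phi> \<in> forms L {y} A" "S = ?c \<phi>" using S by blast
      moreover have "\<forall>\<phi>\<in>forms L {y} A. 0 \<le> \<nu> \<phi>" using K unfolding keisler_def by blast
      ultimately show ?thesis using m[of \<phi>] by simp
    qed
    have "m (?c (Neg Fls)) = 1" using m[of "Neg Fls"] K by (simp add: keisler_def)
    then show "m (types L M {y} A) = 1" by (simp add: basic_clopen_Neg basic_clopen_Fls)
    show "m (S \<union> S') = m S + m S'"
      if S: "S \<in> ?c ` forms L {y} A" and S': "S' \<in> ?c ` forms L {y} A" and disj: "S \<inter> S' = {}" for S S'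
    proof -
      obtain \<phi> \<psi> where \<phi>: "\<phi> \<in> forms L {y} A" "S = ?c \<phi>" and \<psi>: "\<psi> \<in> forms L {y} A" "S' = ?c \<psi>"
        using S S' by blast
      have "\<not> (sat M b [] \<phi> \<and> sat M b [] \<psi>)" if b: "b \<in> assign M {y}" for b
      proof
        assume "sat M b [] \<phi> \<and> sat M b [] \<psi>"
        with \<phi> \<psi> tp_in_types[OF b, of L A] have "tp L M {y} A b \<in> S \<inter> S'"
          by (simp add: basic_clopen_def tp_def)
        with disj show False by blast
      qed
      then have "\<nu> (Disj \<phi> \<psi>) = \<nu> \<phi> + \<nu> \<psi>" using K \<phi> \<psi> unfolding keisler_def by blast
      then show ?thesis using \<phi> \<psi> m[of "Disj \<phi> \<psi>"] m by (simp add: basic_clopen_Disj)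
    qed
  qed
  have "type_measure L M y A \<nu> = cc.radon"
    unfolding type_measure_def
  proof (rule the_equality)
    show "regular_borel_prob ?T cc.radon \<and> (\<forall>\<phi>\<in>forms L {y} A. measure cc.radon (?c \<phi>) = \<nu> \<phi>)"
      using cc.regular_borel_prob_radon cc.measure_radon_B m by auto
    show "N = cc.radon" if "regular_borel_prob ?T N \<and> (\<forall>\<phi>\<in>forms L {y} A. measure N (?c \<phi>) = \<nu> \<phi>)" for N
      using that m by (intro cc.regular_borel_prob_unique) auto
  qed
  then show "regular_borel_prob ?T (type_measure L M y A \<nu>)"
    "\<And>\<phi>. \<phi> \<in> forms L {y} A \<Longrightarrow> measure (type_measure L M y A \<nu>) (?c \<phi>) = \<nu> \<phi>"
    using cc.regular_borel_prob_radon cc.measure_radon_B m by auto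
qed

lemma tval_in_carr:
  assumes M: "is_struct L M" and "tm_ok L B t s" "\<And>w. w \<in> tfv t \<Longrightarrow> v w \<in> carr M (fst w)"
    "list_all2 (\<lambda>c s. c \<in> carr M s) e B" "tpar t \<subseteq> elts M"
  shows "tval M v e t \<in> carr M s"
  using assms(2-)
proof (induction t arbitrary: s)
  case (Fn f ts)
  have "tval M v e (ts ! n) \<in> carr M (fdom L f ! n)" if n: "n < length ts" for n
  proof (rule Fn.IH)
    show "ts ! n \<in> set ts" using n by simp
    show "tm_ok L B (ts ! n) (fdom L f ! n)" using Fn.prems(1) n by (auto intro: list_all2_nthD)
    show "v w \<in> carr M (fst w)" if "w \<in> tfv (ts ! n)" for w
      using Fn.prems(2)[of w] that n by (auto intro: nth_mem)
    show "tpar (ts ! n) \<subseteq> elts M" using Fn.prems(4) nth_mem[OF n] by auto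
  qed (rule Fn.prems(3))
  then have "map (tval M v e) ts \<in> args M (fdom L f)"
    using Fn.prems(1) by (simp add: args_def list_all2_conv_all_nth)
  then show ?case using M Fn.prems(1) by (auto simp: is_struct_def)
qed (auto simp: list_all2_conv_all_nth elts_def)

lemma list_all2_argE: "list_all2 P ts ss \<Longrightarrow> t \<in> set ts \<Longrightarrow> \<exists>s. P t s"
  by (induction rule: list_all2_induct) auto

section \<open>Isomorphisms\<close>

abbreviation tmap_par ::
  "('s \<Rightarrow> 'a \<Rightarrow> 'b) \<Rightarrow> ('s, 'f, 'a) trm \<Rightarrow> ('s, 'f, 'b) trm"
  where "tmap_par g \<equiv> map_tm id (\<lambda>(s, a). (s, g s a))"

lemma tmap_par_simps:
  "tmap_par g (Var w) = Var w"
  "tmap_par g (Bnd n) = Bnd n"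
  "tmap_par g (Par c) = Par (fst c, g (fst c) (snd c))"
  "tmap_par g (Fn f ts) = Fn f (map (tmap_par g) ts)"
  by (simp_all only: tm.map id_apply case_prod_beta)

lemma map_par_simps:
  "map_par g Fls = Fls"
  "map_par g (Eq t u) = Eq (tmap_par g t) (tmap_par g u)"
  "map_par g (Rel r ts) = Rel r (map (tmap_par g) ts)"
  "map_par g (Neg \<phi>) = Neg (map_par g \<phi>)"
  "map_par g (Disj \<phi> \<psi>) = Disj (map_par g \<phi>) (map_par g \<psi>)"
  "map_par g (Ex s \<phi>) = Ex s (map_par g \<phi>)"
  by (simp_all only: fm.map)

text \<open>
  Simplification would rewrite the unapplied \<open>id\<close> in \<open>map_par\<close> and thereby keep the equations above from
  applying.
\<close>

declare id_apply [simp del] tm.map [simp del] fm.map [simp del] tmap_par_simps [simp] map_par_simps [simp]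

abbreviation jtval :: "('s, 'f, 'r, 'b) struct \<Rightarrow> ('s \<Rightarrow> 'a \<Rightarrow> 'b) \<Rightarrow> 's list \<Rightarrow> ('s var \<Rightarrow> 'a) \<Rightarrow> 'a list \<Rightarrow> ('s, 'f, 'a) trm \<Rightarrow> 'b"
  where "jtval M j B v e t \<equiv> tval M (\<lambda>w. j (fst w) (v w)) (map2 j B e) (tmap_par j t)"

lemma tval_isomorphism:
  assumes P: "is_struct L P" and j: "isomorphism L P M j" and "tm_ok L B t s"
    "\<And>w. w \<in> tfv t \<Longrightarrow> v w \<in> carr P (fst w)"
    "list_all2 (\<lambda>c s. c \<in> carr P s) e B" "tpar t \<subseteq> elts P"
  shows "jtval M j B v e t = j s (tval P v e t)"
  using assms(3-)
proof (induction t arbitrary: s)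
  case (Fn f ts)
  have len: "length ts = length (fdom L f)" using Fn.prems(1) by (auto dest: list_all2_lengthD)
  have IH: "jtval M j B v e (ts ! n) = j (fdom L f ! n) (tval P v e (ts ! n))"
    "tval P v e (ts ! n) \<in> carr P (fdom L f ! n)"
    if n: "n < length ts" for n
  proof -
    have "tm_ok L B (ts ! n) (fdom L f ! n)" using Fn.prems(1) n by (auto intro: list_all2_nthD)
    moreover have "tpar (ts ! n) \<subseteq> elts P" using Fn.prems(4) nth_mem[OF n] by auto
    moreover have "v w \<in> carr P (fst w)" if "w \<in> tfv (ts ! n)" for w
      using Fn.prems(2)[of w] that n by (auto intro: nth_mem)
    ultimately have ok: "tm_ok L B (ts ! n) (fdom L f ! n)" "tpar (ts ! n) \<subseteq> elts P"
      "\<And>w. w \<in> tfv (ts ! n) \<Longrightarrow> v w \<in> carr P (fst w)" by blast+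
    show "jtval M j B v e (ts ! n) = j (fdom L f ! n) (tval P v e (ts ! n))"
      using n ok Fn.prems(3) by (intro Fn.IH) auto
    show "tval P v e (ts ! n) \<in> carr P (fdom L f ! n)"
      using n ok Fn.prems(3) by (intro tval_in_carr[OF P]) auto
  qed
  have "map (tval P v e) ts \<in> args P (fdom L f)"
    using IH(2) len by (simp add: args_def list_all2_conv_all_nth)
  then have "j (fcod L f) (fint P f (map (tval P v e) ts)) = fint M f (map2 j (fdom L f) (map (tval P v e) ts))"
    using j by (simp add: isomorphism_def)
  also have "map2 j (fdom L f) (map (tval P v e) ts) =
      map (\<lambda>t. jtval M j B v e t) ts"
    using IH(1) len by (intro nth_equalityI) auto
  finally show ?case using Fn.prems(1) by (simp add: comp_def)
qed (auto simp: list_all2_conv_all_nth)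

text \<open>
  Surjectivity of \<open>j\<close> on each sort serves for the quantifiers, injectivity for equality.
\<close>

lemma sat_isomorphism:
  assumes P: "is_struct L P" and j: "isomorphism L P M j" and "fm_ok L B \<phi>"
    "\<And>w. w \<in> fv \<phi> \<Longrightarrow> v w \<in> carr P (fst w)"
    "list_all2 (\<lambda>c s. c \<in> carr P s) e B" "par \<phi> \<subseteq> elts P"
  shows "sat M (\<lambda>w. j (fst w) (v w)) (map2 j B e) (map_par j \<phi>) \<longleftrightarrow> sat P v e \<phi>"
  using assms(3-)
proof (induction \<phi> arbitrary: B e)
  case (Eq t u)
  then obtain s where s: "tm_ok L B t s" "tm_ok L B u s" by auto
  have "jtval M j B v e t = j s (tval P v e t)"
    "jtval M j B v e u = j s (tval P v e u)"
    using Eq.prems s by (intro tval_isomorphism[OF P j]; simp)+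
  moreover have "tval P v e t \<in> carr P s" "tval P v e u \<in> carr P s"
    using Eq.prems s by (intro tval_in_carr[OF P]; simp)+
  moreover have "inj_on (j s) (carr P s)" using j by (auto simp: isomorphism_def bij_betw_def)
  ultimately show ?case by (simp add: inj_on_eq_iff)
next
  case (Rel r ts)
  have len: "length ts = length (rdom L r)" using Rel.prems(1) by (auto dest: list_all2_lengthD)
  have IH: "jtval M j B v e (ts ! n) = j (rdom L r ! n) (tval P v e (ts ! n))"
    "tval P v e (ts ! n) \<in> carr P (rdom L r ! n)"
    if n: "n < length ts" for n
  proof -
    have "tm_ok L B (ts ! n) (rdom L r ! n)" using Rel.prems(1) n by (auto intro: list_all2_nthD)
    moreover have "tpar (ts ! n) \<subseteq> elts P" using Rel.prems(4) nth_mem[OF n] by auto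
    moreover have "v w \<in> carr P (fst w)" if "w \<in> tfv (ts ! n)" for w
      using Rel.prems(2)[of w] that n by (auto intro: nth_mem)
    ultimately have ok: "tm_ok L B (ts ! n) (rdom L r ! n)" "tpar (ts ! n) \<subseteq> elts P"
      "\<And>w. w \<in> tfv (ts ! n) \<Longrightarrow> v w \<in> carr P (fst w)" by blast+
    show "jtval M j B v e (ts ! n) = j (rdom L r ! n) (tval P v e (ts ! n))"
      using n ok Rel.prems(3) by (intro tval_isomorphism[OF P j]) auto
    show "tval P v e (ts ! n) \<in> carr P (rdom L r ! n)"
      using n ok Rel.prems(3) by (intro tval_in_carr[OF P]) auto
  qed
  have "map (tval P v e) ts \<in> args P (rdom L r)"
    using IH(2) len by (simp add: args_def list_all2_conv_all_nth)
  then have "rint P r (map (tval P v e) ts) \<longleftrightarrow> rint M r (map2 j (rdom L r) (map (tval P v e) ts))"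
    using j by (simp add: isomorphism_def)
  also have "map2 j (rdom L r) (map (tval P v e) ts) =
      map (\<lambda>t. jtval M j B v e t) ts"
    using IH(1) len by (intro nth_equalityI) auto
  finally show ?case by (simp add: comp_def)
next
  case (Disj \<phi>1 \<phi>2)
  have "sat M (\<lambda>w. j (fst w) (v w)) (map2 j B e) (map_par j \<phi>1) \<longleftrightarrow> sat P v e \<phi>1"
    using Disj.prems by (intro Disj.IH) auto
  moreover have "sat M (\<lambda>w. j (fst w) (v w)) (map2 j B e) (map_par j \<phi>2) \<longleftrightarrow> sat P v e \<phi>2"
    using Disj.prems by (intro Disj.IH) auto
  ultimately show ?case by simp
next
  case (Ex s \<phi>)
  have surj: "carr M s = j s ` carr P s" using j by (auto simp: isomorphism_def bij_betw_def)
  have "sat M (\<lambda>w. j (fst w) (v w)) (map2 j (s # B) (c # e)) (map_par j \<phi>) \<longleftrightarrow> sat P v (c # e) \<phi>"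
    if "c \<in> carr P s" for c
    using Ex.prems that by (intro Ex.IH) auto
  then show ?case by (simp add: surj)
qed simp_all

lemma map_par_cong: "(\<And>s a. (s, a) \<in> par \<phi> \<Longrightarrow> g s a = h s a) \<Longrightarrow> map_par g \<phi> = map_par h \<phi>"
  by (rule fm.map_cong) auto

lemma map_par_no_par: "par \<phi> = {} \<Longrightarrow> map_par g \<phi> = map_par h \<phi>"
  by (rule map_par_cong) auto

lemma fv_map_par [simp]: "fv (map_par g \<phi>) = fv \<phi>"
  by (simp add: fm.set_map id_apply)

lemma par_map_par: "par (map_par g \<phi>) = (\<lambda>(s, a). (s, g s a)) ` par \<phi>"
  by (simp add: fm.set_map)

lemma tm_ok_map_par: "tm_ok L B t s \<Longrightarrow> tm_ok L B (tmap_par g t) s"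
proof (induction t arbitrary: s)
  case (Fn f ts)
  then have "list_all2 (\<lambda>t s. tm_ok L B (tmap_par g t) s) ts (fdom L f)"
    by (auto elim!: list.rel_mono_strong)
  with Fn show ?case by (simp add: list.rel_map)
qed (auto split: prod.split)

lemma fm_ok_map_par: "fm_ok L B \<phi> \<Longrightarrow> fm_ok L B (map_par g \<phi>)"
proof (induction \<phi> arbitrary: B)
  case (Eq t u)
  then show ?case by (auto dest: tm_ok_map_par)
next
  case (Rel r ts)
  then have "list_all2 (\<lambda>t s. tm_ok L B (tmap_par g t) s) ts (rdom L r)"
    by (auto elim!: list.rel_mono_strong intro: tm_ok_map_par)
  then show ?case by (simp add: list.rel_map)
qed auto

lemma map_par_in_forms:
  assumes "\<phi> \<in> forms L Z A" "\<And>s a. (s, a) \<in> A \<Longrightarrow> (s, g s a) \<in> A'"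
  shows "map_par g \<phi> \<in> forms L Z A'"
  using assms fm_ok_map_par[of L "[]" \<phi> g] by (auto simp: forms_def par_map_par)

lemma tmap_par_tsubst:
  assumes "\<And>w. w \<in> tfv t \<Longrightarrow> tmap_par g (\<sigma> w) = \<tau> w"
  shows "tmap_par g (tsubst \<sigma> t) = tsubst \<tau> (tmap_par g t)"
  using assms
proof (induction t)
  case (Fn f ts)
  have "tmap_par g (tsubst \<sigma> t) = tsubst \<tau> (tmap_par g t)" if "t \<in> set ts" for t
    using that Fn.prems by (intro Fn.IH) auto
  then show ?case by simp
qed auto

lemma map_par_subst:
  assumes "\<And>w. w \<in> fv \<phi> \<Longrightarrow> tmap_par g (\<sigma> w) = \<tau> w"
  shows "map_par g (subst \<sigma> \<phi>) = subst \<tau> (map_par g \<phi>)"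
  using assms
proof (induction \<phi>)
  case (Rel r ts)
  then have "map (\<lambda>t. tmap_par g (tsubst \<sigma> t)) ts = map (\<lambda>t. tsubst \<tau> (tmap_par g t)) ts"
    by (intro map_cong tmap_par_tsubst) auto
  then show ?case by (simp add: comp_def)
qed (auto simp: tmap_par_tsubst)

lemma map_par_inst: "map_par g (inst Z b \<phi>) = inst Z (\<lambda>w. g (fst w) (b w)) (map_par g \<phi>)"
  unfolding inst_def by (rule map_par_subst) auto

lemma map_par_map_par: "map_par g (map_par h \<phi>) = map_par (\<lambda>s a. g s (h s a)) \<phi>"
  by (auto simp: fm.map_comp comp_def id_apply intro!: fm.map_cong)

lemma map_par_ident: "(\<And>s a. (s, a) \<in> par \<phi> \<Longrightarrow> g s a = a) \<Longrightarrow> map_par g \<phi> = \<phi>"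
proof -
  assume "\<And>s a. (s, a) \<in> par \<phi> \<Longrightarrow> g s a = a"
  then have "map_par g \<phi> = map_fm id id \<phi>" by (intro fm.map_cong) (auto simp: id_apply)
  then show ?thesis by (simp add: fm.map_id)
qed

section \<open>Ultraproducts\<close>

lemma ultrafilter_Not: "ultrafilter D \<Longrightarrow> eventually (\<lambda>i. \<not> P i) D \<longleftrightarrow> \<not> eventually P D"
proof
  assume "ultrafilter D" "eventually (\<lambda>i. \<not> P i) D"
  then show "\<not> eventually P D"
    using eventually_conj[of "\<lambda>i. \<not> P i" D P] by (auto simp: ultrafilter_def eventually_False)
qed (auto simp: ultrafilter_def)

lemma ultrafilter_disj:
  assumes "ultrafilter D"
  shows "eventually (\<lambda>i. P i \<or> Q i) D \<longleftrightarrow> eventually P D \<or> eventually Q D"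
proof
  assume *: "eventually (\<lambda>i. P i \<or> Q i) D"
  show "eventually P D \<or> eventually Q D"
  proof (rule ccontr)
    assume "\<not> ?thesis"
    then have "eventually (\<lambda>i. \<not> P i) D" "eventually (\<lambda>i. \<not> Q i) D"
      using ultrafilter_Not[OF assms] by auto
    with * have "eventually (\<lambda>i. False) D" by eventually_elim auto
    then show False using assms by (simp add: ultrafilter_def eventually_False)
  qed
qed (auto elim: eventually_mono)

locale ultra_struct =
  fixes L :: "('s, 'f, 'r) glang" and D :: "'i filter" and G :: "'i \<Rightarrow> ('s, 'f, 'r, 'a) struct"
  assumes ultra: "ultrafilter D" and struct: "\<And>i. is_struct L (G i)"
begin

abbreviation \<G> where "\<G> \<equiv> ultraproduct L D G"
abbreviation rep where "rep i \<equiv> \<lambda>c. representative c i"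

abbreviation factor_val where
  "factor_val i v e t \<equiv> tval (G i) (\<lambda>w. rep i (v w)) (map (rep i) e) (tmap_par (\<lambda>s. rep i) t)"

abbreviation factor_sat where
  "factor_sat i v e \<phi> \<equiv> sat (G i) (\<lambda>w. rep i (v w)) (map (rep i) e) (map_par (\<lambda>s. rep i) \<phi>)"

lemma rep_ultraclass:
  assumes "\<And>i. g i \<in> carr (G i) s"
  shows "eventually (\<lambda>i. rep i (ultraclass D G s g) = g i) D" "\<And>i. rep i (ultraclass D G s g) \<in> carr (G i) s"
    "ultraclass D G s g \<in> carr \<G> s"
proof -
  have "g \<in> ultraclass D G s g" using assms by (simp add: ultraclass_def)
  then have "representative (ultraclass D G s g) \<in> ultraclass D G s g"
    unfolding representative_def by (rule someI[where P = "\<lambda>h. h \<in> ultraclass D G s g"])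
  then show "eventually (\<lambda>i. rep i (ultraclass D G s g) = g i) D" "\<And>i. rep i (ultraclass D G s g) \<in> carr (G i) s"
    by (auto simp: ultraclass_def)
  show "ultraclass D G s g \<in> carr \<G> s" using assms by (auto simp: ultraproduct_def)
qed

lemma rep_in_carr: "c \<in> carr \<G> s \<Longrightarrow> rep i c \<in> carr (G i) s"
  using rep_ultraclass(2)[of _ s] by (auto simp: ultraproduct_def)

lemma ultraclass_eqI:
  assumes "eventually (\<lambda>i. g i = h i) D"
  shows "ultraclass D G s g = ultraclass D G s h"
proof -
  have "eventually (\<lambda>i. f i = g i) D \<longleftrightarrow> eventually (\<lambda>i. f i = h i) D" for f
    by (rule eventually_subst) (use assms in \<open>auto elim!: eventually_mono\<close>)
  then show ?thesis by (simp add: ultraclass_def)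
qed

lemma ultraclass_rep: "c \<in> carr \<G> s \<Longrightarrow> ultraclass D G s (representative c) = c"
proof -
  assume "c \<in> carr \<G> s"
  then obtain g where g: "\<And>i. g i \<in> carr (G i) s" "c = ultraclass D G s g" by (auto simp: ultraproduct_def)
  show ?thesis unfolding g(2) using rep_ultraclass(1)[of g s] g(1) by (intro ultraclass_eqI) auto
qed

lemma eq_iff_eventually_rep:
  assumes "c \<in> carr \<G> s" "c' \<in> carr \<G> s"
  shows "c = c' \<longleftrightarrow> eventually (\<lambda>i. rep i c = rep i c') D"
  using ultraclass_eqI[of "representative c" "representative c'" s] ultraclass_rep[OF assms(1)] ultraclass_rep[OF assms(2)]
  by auto

lemma rep_args: "cs \<in> args \<G> ss \<Longrightarrow> map (rep i) cs \<in> args (G i) ss"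
  unfolding args_def by (auto simp: list_all2_map1 elim!: list_all2_mono dest: rep_in_carr)

lemma fint_in_carr:
  assumes "cs \<in> args \<G> (fdom L f)"
  shows "fint (G i) f (map (rep i) cs) \<in> carr (G i) (fcod L f)"
  using struct[of i] rep_args[OF assms] by (auto simp: is_struct_def)

lemma fint_ultraproduct:
  assumes "cs \<in> args \<G> (fdom L f)"
  shows "fint \<G> f cs \<in> carr \<G> (fcod L f)"
    "eventually (\<lambda>i. rep i (fint \<G> f cs) = fint (G i) f (map (rep i) cs)) D"
  using rep_ultraclass[of "\<lambda>i. fint (G i) f (map (rep i) cs)" "fcod L f", OF fint_in_carr[OF assms]]
  by (simp_all add: ultraproduct_def)

lemma is_struct_ultraproduct: "is_struct L \<G>"
  unfolding is_struct_def
proof (intro conjI allI ballI)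
  fix s
  have "\<exists>a. a \<in> carr (G i) s" for i using struct[of i] by (auto simp: is_struct_def)
  then obtain g where "\<And>i. g i \<in> carr (G i) s" by metis
  from rep_ultraclass(3)[OF this] show "carr \<G> s \<noteq> {}" by blast
qed (rule fint_ultraproduct)

lemma tval_ultraproduct:
  assumes "tm_ok L B t s" "\<And>w. w \<in> tfv t \<Longrightarrow> v w \<in> carr \<G> (fst w)"
    "list_all2 (\<lambda>c s. c \<in> carr \<G> s) e B" "tpar t \<subseteq> elts \<G>"
  shows "eventually (\<lambda>i. rep i (tval \<G> v e t) =
    factor_val i v e t) D"
  using assms
proof (induction t arbitrary: s)
  case (Fn f ts)
  have ok: "tm_ok L B (ts ! n) (fdom L f ! n)" "tpar (ts ! n) \<subseteq> elts \<G>"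
      "\<And>w. w \<in> tfv (ts ! n) \<Longrightarrow> v w \<in> carr \<G> (fst w)" if n: "n < length ts" for n
  proof -
    show "tm_ok L B (ts ! n) (fdom L f ! n)" using Fn.prems(1) n by (auto intro: list_all2_nthD)
    show "tpar (ts ! n) \<subseteq> elts \<G>" using Fn.prems(4) nth_mem[OF n] by auto
    show "v w \<in> carr \<G> (fst w)" if "w \<in> tfv (ts ! n)" for w
      using Fn.prems(2)[of w] that n by (auto intro: nth_mem)
  qed
  have len: "length ts = length (fdom L f)" using Fn.prems(1) by (auto dest: list_all2_lengthD)
  have "tval \<G> v e (ts ! n) \<in> carr \<G> (fdom L f ! n)" if "n < length ts" for n
    using that ok Fn.prems(3) by (intro tval_in_carr[OF is_struct_ultraproduct]) auto
  then have args: "map (tval \<G> v e) ts \<in> args \<G> (fdom L f)"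
    using len by (simp add: args_def list_all2_conv_all_nth)
  have "\<forall>t\<in>set ts. eventually (\<lambda>i. rep i (tval \<G> v e t) =
    factor_val i v e t) D"
  proof
    fix t assume "t \<in> set ts"
    then obtain n where n: "n < length ts" "t = ts ! n" by (metis in_set_conv_nth)
    show "eventually (\<lambda>i. rep i (tval \<G> v e t) =
      factor_val i v e t) D"
      unfolding n(2) using n ok Fn.prems(3) by (intro Fn.IH) auto
  qed
  then have "eventually (\<lambda>i. \<forall>t\<in>set ts. rep i (tval \<G> v e t) =
    factor_val i v e t) D"
    by (intro eventually_ball_finite) auto
  with fint_ultraproduct(2)[OF args] show ?case
  proof eventually_elim
    case (elim i)
    have "map (rep i) (map (tval \<G> v e) ts) =
      map (tval (G i) (\<lambda>w. rep i (v w)) (map (rep i) e)) (map (tmap_par (\<lambda>s. rep i)) ts)"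
      using elim(2) by simp
    with elim(1) show ?case by (simp only: tval.simps tmap_par_simps)
  qed
qed (auto simp: list_all2_conv_all_nth)

text \<open>
  Los's theorem. An ultrafilter commutes with negation and disjunction; for a quantifier, witnesses in
  the factors are chosen where they exist and their class is a witness in the ultraproduct.
\<close>

theorem los:
  assumes "fm_ok L B \<phi>" "\<And>w. w \<in> fv \<phi> \<Longrightarrow> v w \<in> carr \<G> (fst w)"
    "list_all2 (\<lambda>c s. c \<in> carr \<G> s) e B" "par \<phi> \<subseteq> elts \<G>"
  shows "sat \<G> v e \<phi> \<longleftrightarrow>
    eventually (\<lambda>i. factor_sat i v e \<phi>) D"
  using assms
proof (induction \<phi> arbitrary: B e)
  case Fls
  then show ?case using ultra by (simp add: ultrafilter_def eventually_False)
next
  case (Eq t u)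
  then obtain s where s: "tm_ok L B t s" "tm_ok L B u s" by auto
  have "tval \<G> v e t \<in> carr \<G> s" "tval \<G> v e u \<in> carr \<G> s"
    using Eq.prems s by (intro tval_in_carr[OF is_struct_ultraproduct]; simp)+
  then have "sat \<G> v e (Eq t u) \<longleftrightarrow> eventually (\<lambda>i. rep i (tval \<G> v e t) = rep i (tval \<G> v e u)) D"
    unfolding sat.simps by (rule eq_iff_eventually_rep)
  also have "\<dots> \<longleftrightarrow> eventually (\<lambda>i. factor_val i v e t =
      factor_val i v e u) D"
  proof (rule eventually_subst)
    have "eventually (\<lambda>i. rep i (tval \<G> v e t) =
        factor_val i v e t) D"
      using Eq.prems s by (intro tval_ultraproduct) auto
    moreover have "eventually (\<lambda>i. rep i (tval \<G> v e u) =
        factor_val i v e u) D"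
      using Eq.prems s by (intro tval_ultraproduct) auto
    ultimately show "eventually (\<lambda>i. (rep i (tval \<G> v e t) = rep i (tval \<G> v e u)) =
      (factor_val i v e t =
      factor_val i v e u)) D"
      by eventually_elim simp
  qed
  finally show ?case by simp
next
  case (Rel r ts)
  have "\<forall>t\<in>set ts. eventually (\<lambda>i. rep i (tval \<G> v e t) =
    factor_val i v e t) D"
  proof
    fix t assume t: "t \<in> set ts"
    obtain s where "tm_ok L B t s"
      using list_all2_argE[OF _ t, of "tm_ok L B" "rdom L r"] Rel.prems(1) by auto
    then show "eventually (\<lambda>i. rep i (tval \<G> v e t) =
      factor_val i v e t) D"
      using t Rel.prems by (intro tval_ultraproduct) auto
  qed
  then have "eventually (\<lambda>i. \<forall>t\<in>set ts. rep i (tval \<G> v e t) =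
    factor_val i v e t) D"
    by (intro eventually_ball_finite) auto
  then have "eventually (\<lambda>i. map (rep i) (map (tval \<G> v e) ts) =
    map (tval (G i) (\<lambda>w. rep i (v w)) (map (rep i) e)) (map (tmap_par (\<lambda>s. rep i)) ts)) D"
    by eventually_elim simp
  then have "eventually (\<lambda>i. rint (G i) r (map (rep i) (map (tval \<G> v e) ts)) =
    rint (G i) r (map (tval (G i) (\<lambda>w. rep i (v w)) (map (rep i) e)) (map (tmap_par (\<lambda>s. rep i)) ts))) D"
    by eventually_elim (simp only:)
  then have "eventually (\<lambda>i. rint (G i) r (map (rep i) (map (tval \<G> v e) ts))) D \<longleftrightarrow>
    eventually (\<lambda>i. rint (G i) r (map (tval (G i) (\<lambda>w. rep i (v w)) (map (rep i) e)) (map (tmap_par (\<lambda>s. rep i)) ts))) D"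
    by (rule eventually_subst)
  moreover have "sat \<G> v e (Rel r ts) \<longleftrightarrow> eventually (\<lambda>i. rint (G i) r (map (rep i) (map (tval \<G> v e) ts))) D"
    by (simp add: ultraproduct_def)
  ultimately show ?case by (simp only: sat.simps map_par_simps)
next
  case (Neg \<phi>)
  have "sat \<G> v e \<phi> \<longleftrightarrow>
    eventually (\<lambda>i. factor_sat i v e \<phi>) D"
    using Neg.prems by (intro Neg.IH) auto
  then show ?case by (simp add: ultrafilter_Not[OF ultra])
next
  case (Disj \<phi>1 \<phi>2)
  have "sat \<G> v e \<phi>1 \<longleftrightarrow>
    eventually (\<lambda>i. factor_sat i v e \<phi>1) D"
    using Disj.prems by (intro Disj.IH) auto
  moreover have "sat \<G> v e \<phi>2 \<longleftrightarrow>
    eventually (\<lambda>i. factor_sat i v e \<phi>2) D"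
    using Disj.prems by (intro Disj.IH) auto
  ultimately show ?case by (simp add: ultrafilter_disj[OF ultra])
next
  case (Ex s \<phi>)
  let ?S = "\<lambda>i a. sat (G i) (\<lambda>w. rep i (v w)) (a # map (rep i) e) (map_par (\<lambda>s. rep i) \<phi>)"
  have IH: "sat \<G> v (c # e) \<phi> \<longleftrightarrow> eventually (\<lambda>i. ?S i (rep i c)) D" if c: "c \<in> carr \<G> s" for c
  proof -
    have "sat \<G> v (c # e) \<phi> \<longleftrightarrow>
      eventually (\<lambda>i. sat (G i) (\<lambda>w. rep i (v w)) (map (rep i) (c # e)) (map_par (\<lambda>s. rep i) \<phi>)) D"
      using Ex.prems c by (intro Ex.IH[of "s # B"]) auto
    then show ?thesis by simp
  qed
  have "(\<exists>c\<in>carr \<G> s. sat \<G> v (c # e) \<phi>) \<longleftrightarrow> eventually (\<lambda>i. \<exists>a\<in>carr (G i) s. ?S i a) D"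
  proof
    assume "\<exists>c\<in>carr \<G> s. sat \<G> v (c # e) \<phi>"
    then obtain c where c: "c \<in> carr \<G> s" "eventually (\<lambda>i. ?S i (rep i c)) D" using IH by blast
    from c(2) show "eventually (\<lambda>i. \<exists>a\<in>carr (G i) s. ?S i a) D"
      by eventually_elim (use rep_in_carr[OF c(1)] in blast)
  next
    assume ev: "eventually (\<lambda>i. \<exists>a\<in>carr (G i) s. ?S i a) D"
    have "\<exists>a. a \<in> carr (G i) s \<and> ((\<exists>a\<in>carr (G i) s. ?S i a) \<longrightarrow> ?S i a)" for i
      using struct[of i] unfolding is_struct_def by (metis ex_in_conv)
    then obtain g where g: "\<And>i. g i \<in> carr (G i) s" "\<And>i. (\<exists>a\<in>carr (G i) s. ?S i a) \<Longrightarrow> ?S i (g i)"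
      by metis
    let ?c = "ultraclass D G s g"
    have "eventually (\<lambda>i. ?S i (rep i ?c)) D"
      using ev rep_ultraclass(1)[of g s, OF g(1)] by eventually_elim (use g(2) in \<open>simp only:\<close>)
    with rep_ultraclass(3)[of g s, OF g(1)] IH show "\<exists>c\<in>carr \<G> s. sat \<G> v (c # e) \<phi>" by blast
  qed
  then show ?case by simp
qed

end

section \<open>Samples in ultraproducts\<close>

text \<open>
  A formula without parameters makes sense over every structure, but its type mentions the type of
  the parameters.
\<close>

definition retype :: "('s, 'f, 'r, 'a) form \<Rightarrow> ('s, 'f, 'r, 'b) form" where
  "retype = map_par (\<lambda>_ _. undefined)"

text \<open>
  Meant for formulas in one free variable \<open>x\<close>: the constant assignment is one of those that send \<open>x\<close> to
  \<open>a\<close>.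
\<close>

definition solset :: "('s, 'f, 'r, 'a) struct \<Rightarrow> ('s, 'f, 'r, 'a) form \<Rightarrow> 'a set" where
  "solset M \<phi> = {a. sat M (\<lambda>_. a) [] \<phi>}"

lemma retype_eq_map_par: "\<psi> \<in> forms L Z {} \<Longrightarrow> map_par g \<psi> = retype \<psi>"
  unfolding retype_def by (rule map_par_no_par) (auto simp: forms_def)

lemma retype_in_forms: "\<psi> \<in> forms L Z {} \<Longrightarrow> retype \<psi> \<in> forms L Z {}"
  unfolding retype_def by (rule map_par_in_forms) auto

lemma sat_cong_forms:
  "\<phi> \<in> forms L Z A \<Longrightarrow> (\<And>w. w \<in> Z \<Longrightarrow> v w = v' w) \<Longrightarrow> sat M v e \<phi> \<longleftrightarrow> sat M v' e \<phi>"
  by (rule sat_cong) (auto simp: forms_def)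

lemma mem_solset_inst: "a \<in> solset M (inst Z b \<psi>) \<longleftrightarrow> sat M (\<lambda>w. if w \<in> Z then b w else a) [] \<psi>"
  by (simp add: solset_def sat_inst)

lemma uniform_measure_on_eq:
  assumes "finite H" "\<phi> \<in> forms L {x} (elts M)"
  shows "uniform_measure_on L M x H \<phi> = card (H \<inter> solset M \<phi>) / card H"
proof -
  have "(\<Sum>h\<in>H. dirac_tp (tp L M {x} (elts M) (\<lambda>_. h)) \<phi>) = (\<Sum>h\<in>H. if h \<in> solset M \<phi> then 1 else 0)"
    using assms(2) by (intro sum.cong) (auto simp: dirac_tp_def tp_def solset_def)
  also have "\<dots> = real (card (H \<inter> solset M \<phi>))" using assms(1) by (simp add: sum.If_cases)
  finally show ?thesis using assms(2) by (simp add: uniform_measure_on_def)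
qed

text \<open>
  By compactness the values cluster at some \<open>l\<close>; along an ultrafilter they converge to a cluster point.
\<close>

lemma ultrafilter_convergent:
  fixes f :: "'i \<Rightarrow> real"
  assumes D: "ultrafilter D" and f: "\<And>i. f i \<in> {0..1}"
  obtains l where "(f \<longlongrightarrow> l) D"
proof -
  have "compact {0..1 :: real}" by simp
  moreover have "filtermap f D \<noteq> bot" using D by (simp add: ultrafilter_def filtermap_bot_iff)
  moreover have "eventually (\<lambda>y. y \<in> {0..1}) (filtermap f D)" using f by (simp add: eventually_filtermap)
  ultimately obtain l where l: "inf (nhds l) (filtermap f D) \<noteq> bot" unfolding compact_filter by blast
  have "(f \<longlongrightarrow> l) D"
  proof (rule topological_tendstoI)
    fix S assume S: "open S" "l \<in> S"
    show "eventually (\<lambda>i. f i \<in> S) D"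
    proof (rule ccontr)
      assume "\<not> ?thesis"
      then have "eventually (\<lambda>y. y \<notin> S) (filtermap f D)"
        using ultrafilter_Not[OF D] by (simp add: eventually_filtermap)
      moreover have "eventually (\<lambda>y. y \<in> S) (nhds l)" using S by (simp add: eventually_nhds_in_open)
      ultimately have "eventually (\<lambda>y. False) (inf (nhds l) (filtermap f D))"
        unfolding eventually_inf by blast
      then show False using l by (simp add: eventually_False)
    qed
  qed
  then show ?thesis by (rule that)
qed

abbreviation av :: "('s, 'f, 'r, 'a) struct \<Rightarrow> ('s, 'f, 'r, 'a) form \<Rightarrow> nat \<times> (nat \<Rightarrow> 'a) \<Rightarrow> real" where
  "av M \<phi> \<equiv> \<lambda>(n, l). avg n l (solset M \<phi>)"

lemma avg_cong: "(\<And>k. k < n \<Longrightarrow> l k \<in> S \<longleftrightarrow> l' k \<in> S') \<Longrightarrow> avg n l S = avg n l' S'"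
  unfolding avg_def by (intro arg_cong2[where f = "(/)"] sum.cong) auto

lemma exp_beats_power:
  assumes "\<delta> > 0"
  shows "(\<lambda>n. 2 * (2 * real n + 1) ^ d / (real n * \<delta>) * exp (- (real n * \<delta>\<^sup>2 / 2))) \<longlonglongrightarrow> 0"
  using assms by real_asymp

text \<open>
  The sample size depends on the exponents \<open>d\<close> and on \<open>\<epsilon>\<close> only, as a polynomial number of traces is beaten
  by the exponential decay. Several set systems are handled through their union, whose number of
  traces is at most the sum of theirs.
\<close>

lemma uniform_approximation_polynomial:
  fixes d :: "'b \<Rightarrow> nat"
  assumes \<Phi>: "finite \<Phi>" and e: "0 < \<epsilon>"
  obtains n where "n \<noteq> 0"
    "\<And>(H :: 'a set) F. finite H \<Longrightarrow> H \<noteq> {} \<Longrightarrow>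
      (\<And>W p. finite W \<Longrightarrow> W \<subseteq> H \<Longrightarrow> p \<in> \<Phi> \<Longrightarrow> card ((\<inter>) W ` F p) \<le> (card W + 1) ^ d p) \<Longrightarrow>
      \<exists>l. (\<forall>k<n. l k \<in> H) \<and> (\<forall>p\<in>\<Phi>. \<forall>S\<in>F p. \<bar>avg n l S - card (H \<inter> S) / card H\<bar> \<le> \<epsilon>)"
proof -
  define \<delta> where "\<delta> = \<epsilon> / 2"
  have \<delta>: "\<delta> > 0" using e by (simp add: \<delta>_def)
  let ?f = "\<lambda>n. \<Sum>p\<in>\<Phi>. 2 * (2 * real n + 1) ^ d p / (real n * \<delta>) * exp (- (real n * \<delta>\<^sup>2 / 2))"
  have "?f \<longlonglongrightarrow> (\<Sum>p\<in>\<Phi>. 0)" by (intro tendsto_sum exp_beats_power[OF \<delta>])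
  then have "eventually (\<lambda>n. ?f n < \<delta>) sequentially" using \<delta> by (auto dest: order_tendstoD(2))
  then have "eventually (\<lambda>n. ?f n < \<delta> \<and> n \<noteq> 0) sequentially"
    using eventually_gt_at_top[of 0] by eventually_elim auto
  then obtain n where n: "?f n < \<delta>" "n \<noteq> 0" by (auto dest: eventually_happens)
  show ?thesis
  proof (rule that[OF n(2)])
    fix H :: "'a set" and F
    assume H: "finite H" "H \<noteq> {}"
      and F: "\<And>W p. finite W \<Longrightarrow> W \<subseteq> H \<Longrightarrow> p \<in> \<Phi> \<Longrightarrow> card ((\<inter>) W ` F p) \<le> (card W + 1) ^ d p"
    let ?K = "\<Sum>p\<in>\<Phi>. (2 * real n + 1) ^ d p"
    have K: "real (card ((\<inter>) W ` (\<Union>p\<in>\<Phi>. F p))) \<le> ?K" if W: "finite W" "W \<subseteq> H" "card W \<le> 2 * n" for W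
    proof -
      have "card ((\<inter>) W ` (\<Union>p\<in>\<Phi>. F p)) = card (\<Union>p\<in>\<Phi>. (\<inter>) W ` F p)" by (simp add: image_UN)
      also have "\<dots> \<le> (\<Sum>p\<in>\<Phi>. card ((\<inter>) W ` F p))" using \<Phi> by (rule card_UN_le)
      also have "\<dots> \<le> (\<Sum>p\<in>\<Phi>. (2 * n + 1) ^ d p)"
      proof (rule sum_mono)
        fix p assume "p \<in> \<Phi>"
        with F W have "card ((\<inter>) W ` F p) \<le> (card W + 1) ^ d p" by blast
        also have "\<dots> \<le> (2 * n + 1) ^ d p" using W(3) by (intro power_mono) auto
        finally show "card ((\<inter>) W ` F p) \<le> (2 * n + 1) ^ d p" .
      qed
      finally have "real (card ((\<inter>) W ` (\<Union>p\<in>\<Phi>. F p))) \<le> real (\<Sum>p\<in>\<Phi>. (2 * n + 1) ^ d p)"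
        by (rule of_nat_mono)
      then show ?thesis by (simp add: add.commute)
    qed
    have "2 * ?K / (n * \<delta>) * exp (- (n * \<delta>\<^sup>2 / 2)) = ?f n"
      by (simp only: sum_distrib_left sum_distrib_right sum_divide_distrib)
    then have small: "2 * ?K / (n * \<delta>) * exp (- (n * \<delta>\<^sup>2 / 2)) \<le> \<delta>" using n by simp
    obtain l where "\<And>k. k < n \<Longrightarrow> l k \<in> H"
      "\<And>S. S \<in> (\<Union>p\<in>\<Phi>. F p) \<Longrightarrow> \<bar>avg n l S - card (H \<inter> S) / card H\<bar> \<le> 2 * \<delta>"
      using uniform_approximation[OF H n(2) \<delta> K small] by blast
    then show "\<exists>l. (\<forall>k<n. l k \<in> H) \<and> (\<forall>p\<in>\<Phi>. \<forall>S\<in>F p. \<bar>avg n l S - card (H \<inter> S) / card H\<bar> \<le> \<epsilon>)"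
      by (intro exI[of _ l]) (auto simp: \<delta>_def)
  qed
qed

context ultra_struct
begin

lemma D_not_bot: "D \<noteq> bot"
  using ultra by (simp add: ultrafilter_def)

lemma rep_assign: "b \<in> assign \<G> Z \<Longrightarrow> (\<lambda>w. rep i (b w)) \<in> assign (G i) Z"
  by (auto simp: assign_def intro: rep_in_carr)

lemma los_assign:
  assumes "\<psi> \<in> forms L Z {}" "b \<in> assign \<G> Z"
  shows "sat \<G> b [] \<psi> \<longleftrightarrow> eventually (\<lambda>i. sat (G i) (\<lambda>w. rep i (b w)) [] (retype \<psi>)) D"
proof -
  have "map_par (\<lambda>s. rep i) \<psi> = retype \<psi>" for i by (rule retype_eq_map_par[OF assms(1)])
  moreover have "fm_ok L [] \<psi>" "par \<psi> \<subseteq> elts \<G>" "\<And>w. w \<in> fv \<psi> \<Longrightarrow> b w \<in> carr \<G> (fst w)"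
    using assms by (auto simp: forms_def assign_def)
  ultimately show ?thesis using los[of "[]" \<psi> b "[]"] by simp
qed

lemma los_tuple:
  assumes \<psi>: "\<psi> \<in> forms L Z {}" and Z: "finite Z" and b: "\<And>i. b i \<in> assign (G i) Z"
  defines "b' \<equiv> \<lambda>w. ultraclass D G (fst w) (\<lambda>i. b i w)"
  shows "b' \<in> assign \<G> Z" "sat \<G> b' [] \<psi> \<longleftrightarrow> eventually (\<lambda>i. sat (G i) (b i) [] (retype \<psi>)) D"
proof -
  have bw: "b i w \<in> carr (G i) (fst w)" if "w \<in> Z" for i w using b[of i] that by (auto simp: assign_def)
  show b': "b' \<in> assign \<G> Z"
    unfolding assign_def b'_def using rep_ultraclass(3)[OF bw] by blast
  have "eventually (\<lambda>i. \<forall>w\<in>Z. rep i (b' w) = b i w) D"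
    unfolding b'_def using rep_ultraclass(1)[OF bw] Z by (intro eventually_ball_finite) auto
  then have "eventually (\<lambda>i. sat (G i) (\<lambda>w. rep i (b' w)) [] (retype \<psi>) \<longleftrightarrow> sat (G i) (b i) [] (retype \<psi>)) D"
    by eventually_elim (rule sat_cong_forms[OF retype_in_forms[OF \<psi>]], blast)
  then show "sat \<G> b' [] \<psi> \<longleftrightarrow> eventually (\<lambda>i. sat (G i) (b i) [] (retype \<psi>)) D"
    unfolding los_assign[OF \<psi> b'] by (rule eventually_subst)
qed

definition instances :: "'s var set \<Rightarrow> ('s, 'f, 'r, ('i \<Rightarrow> 'a) set) form \<Rightarrow> 'i \<Rightarrow> 'a set set" where
  "instances Z \<psi> i = {solset (G i) (inst Z b (retype \<psi>)) | b. b \<in> assign (G i) Z}"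

text \<open>
  Suppose that instances of \<open>\<psi>\<close> shatter sets of size \<open>n\<close> in \<open>D\<close>-most factors. The classes of the points of
  these sets and of the parameters that cut out their subsets violate NIP for \<open>n\<close> in the ultraproduct,
  by Los's theorem.
\<close>

lemma NIP_bounds_shattering:
  assumes N: "NIP L \<G>" and \<psi>: "\<psi> \<in> forms L (insert x Z) {}" and Z: "finite Z" "x \<notin> Z"
  obtains d where "eventually (\<lambda>i. \<forall>S. S \<subseteq> carr (G i) (fst x) \<longrightarrow> finite S \<longrightarrow> card S = d \<longrightarrow>
    \<not> shatters (instances Z \<psi> i) S) D"
proof -
  have xZ: "{x} \<union> Z = insert x Z" by auto
  obtain n :: nat where n: "\<not> (\<exists>a b. (\<forall>k<n. a k \<in> assign \<G> {x}) \<and> (\<forall>S \<subseteq> {..<n}. b S \<in> assign \<G> Z) \<and>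
           (\<forall>k<n. \<forall>S \<subseteq> {..<n}. sat \<G> (\<lambda>w. if w \<in> {x} then a k w else b S w) [] \<psi> \<longleftrightarrow> k \<in> S))"
    using N[unfolded NIP_def, rule_format, of \<psi> "{x}" Z] \<psi> Z by auto
  let ?bad = "\<lambda>i. \<exists>S. S \<subseteq> carr (G i) (fst x) \<and> finite S \<and> card S = n \<and> shatters (instances Z \<psi> i) S"
  have "\<not> eventually ?bad D"
  proof
    assume bad: "eventually ?bad D"
    let ?Q = "\<lambda>i (a :: nat \<Rightarrow> 'a) b. \<forall>k<n. \<forall>S \<subseteq> {..<n}. sat (G i) (\<lambda>w. if w = x then a k else b S w) [] (retype \<psi>) \<longleftrightarrow> k \<in> S"
    have "\<exists>a b. (\<forall>k. a k \<in> carr (G i) (fst x)) \<and> (\<forall>S. b S \<in> assign (G i) Z) \<and> (?bad i \<longrightarrow> ?Q i a b)" for i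
    proof (cases "?bad i")
      case False
      have "\<forall>s. \<exists>c. c \<in> carr (G i) s" using struct[of i] by (auto simp: is_struct_def)
      then obtain c where "\<And>s. c s \<in> carr (G i) s" by metis
      then show ?thesis using False
        by (intro exI[of _ "\<lambda>_. c (fst x)"] exI[of _ "\<lambda>_ w. c (fst w)"]) (auto simp: assign_def)
    next
      case True
      then obtain S where S: "S \<subseteq> carr (G i) (fst x)" "finite S" "card S = n" "shatters (instances Z \<psi> i) S"
        by blast
      obtain h where h: "bij_betw h {0..<n} S" using ex_bij_betw_nat_finite[OF S(2)] S(3) by auto
      have c0: "\<exists>c. c \<in> carr (G i) (fst x)" using struct[of i] by (auto simp: is_struct_def)
      define a where "a k = (if k < n then h k else SOME c. c \<in> carr (G i) (fst x))" for k
      have "\<exists>b. b \<in> assign (G i) Z \<and> S \<inter> solset (G i) (inst Z b (retype \<psi>)) = h ` (T \<inter> {..<n})" for T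
      proof -
        have "h ` (T \<inter> {..<n}) \<in> Pow S" using h by (auto simp: bij_betw_def)
        then have "h ` (T \<inter> {..<n}) \<in> (\<inter>) S ` instances Z \<psi> i" using S(4) unfolding shatters_def by blast
        then show ?thesis unfolding instances_def by blast
      qed
      then obtain b where b: "\<And>T. b T \<in> assign (G i) Z"
        "\<And>T. S \<inter> solset (G i) (inst Z (b T) (retype \<psi>)) = h ` (T \<inter> {..<n})" by metis
      have "sat (G i) (\<lambda>w. if w = x then a k else b T w) [] (retype \<psi>) \<longleftrightarrow> k \<in> T" if "k < n" "T \<subseteq> {..<n}" for k T
      proof -
        have "sat (G i) (\<lambda>w. if w = x then a k else b T w) [] (retype \<psi>) \<longleftrightarrow>
            sat (G i) (\<lambda>w. if w \<in> Z then b T w else h k) [] (retype \<psi>)"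
          by (rule sat_cong_forms[OF retype_in_forms[OF \<psi>]]) (use Z that in \<open>auto simp: a_def\<close>)
        also have "\<dots> \<longleftrightarrow> h k \<in> solset (G i) (inst Z (b T) (retype \<psi>))"
          by (simp only: mem_solset_inst)
        also have "\<dots> \<longleftrightarrow> h k \<in> h ` (T \<inter> {..<n})"
          using b(2)[of T] h that by (auto simp: bij_betw_def)
        also have "\<dots> \<longleftrightarrow> k \<in> T"
          using h that by (subst inj_on_image_mem_iff[of h "{0..<n}"]) (auto simp: bij_betw_def)
        finally show ?thesis .
      qed
      moreover have "a k \<in> carr (G i) (fst x)" for k
        using someI_ex[OF c0] h S(1) by (auto simp: a_def bij_betw_def)
      ultimately show ?thesis using b(1) by blast
    qed
    then have "\<forall>i. \<exists>a b. (\<forall>k. a k \<in> carr (G i) (fst x)) \<and> (\<forall>S. b S \<in> assign (G i) Z) \<and> (?bad i \<longrightarrow> ?Q i a b)"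
      by (rule allI)
    from choice[OF this] obtain a where "\<forall>i. \<exists>b. (\<forall>k. a i k \<in> carr (G i) (fst x)) \<and>
      (\<forall>S. b S \<in> assign (G i) Z) \<and> (?bad i \<longrightarrow> ?Q i (a i) b)" by (elim exE)
    from choice[OF this] obtain b where b: "\<forall>i. (\<forall>k. a i k \<in> carr (G i) (fst x)) \<and>
      (\<forall>S. b i S \<in> assign (G i) Z) \<and> (?bad i \<longrightarrow> ?Q i (a i) (b i))" by (elim exE)
    have ab: "a i k \<in> carr (G i) (fst x)" "b i S \<in> assign (G i) Z" "?bad i \<longrightarrow> ?Q i (a i) (b i)" for i k S
      using spec[OF b, of i] by blast+
    define v where "v k S i w = (if w = x then a i k else b i S w)" for k S i w
    have v: "v k S i \<in> assign (G i) (insert x Z)" for k S i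
      using ab(1)[of i k] ab(2)[of i S] by (auto simp: v_def assign_def)
    define a' where "a' k w = ultraclass D G (fst x) (\<lambda>i. a i k)" for k and w :: "'s var"
    define b' where "b' S w = ultraclass D G (fst w) (\<lambda>i. b i S w)" for S w
    have eq: "(\<lambda>w. if w \<in> {x} then a' k w else b' S w) = (\<lambda>w. ultraclass D G (fst w) (\<lambda>i. v k S i w))" for k S
      unfolding a'_def b'_def v_def by (rule ext) simp
    have "\<forall>k<n. a' k \<in> assign \<G> {x}" using rep_ultraclass(3)[OF ab(1)] by (simp add: a'_def assign_def)
    moreover have "\<forall>S\<subseteq>{..<n}. b' S \<in> assign \<G> Z"
      using rep_ultraclass(3)[of "\<lambda>i. b i _ _"] ab(2) by (auto simp: b'_def assign_def)
    moreover have "\<forall>k<n. \<forall>S\<subseteq>{..<n}. sat \<G> (\<lambda>w. if w \<in> {x} then a' k w else b' S w) [] \<psi> \<longleftrightarrow> k \<in> S"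
    proof (intro allI impI)
      fix k S assume kS: "k < n" "S \<subseteq> {..<n}"
      have "sat \<G> (\<lambda>w. if w \<in> {x} then a' k w else b' S w) [] \<psi> \<longleftrightarrow>
          eventually (\<lambda>i. sat (G i) (v k S i) [] (retype \<psi>)) D"
        unfolding eq using Z by (intro los_tuple(2)[OF \<psi> _ v]) auto
      also have "\<dots> \<longleftrightarrow> eventually (\<lambda>i. k \<in> S) D"
      proof (rule eventually_subst)
        show "eventually (\<lambda>i. sat (G i) (v k S i) [] (retype \<psi>) \<longleftrightarrow> k \<in> S) D"
          using bad
        proof eventually_elim
          case (elim i)
          have "?Q i (a i) (b i)" by (rule mp[OF ab(3)[of i] elim])
          then show ?case using kS unfolding v_def by blast
        qed
      qed
      also have "\<dots> \<longleftrightarrow> k \<in> S" using D_not_bot by (simp add: eventually_const)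
      finally show "sat \<G> (\<lambda>w. if w \<in> {x} then a' k w else b' S w) [] \<psi> \<longleftrightarrow> k \<in> S" .
    qed
    ultimately show False using n by blast
  qed
  then have "eventually (\<lambda>i. \<not> ?bad i) D" using ultrafilter_Not[OF ultra] by blast
  then show ?thesis by (intro that[of n]) (auto elim!: eventually_mono)
qed

end

locale ultra_finite = ultra_struct L D G
  for L :: "('s, 'f, 'r) glang" and D :: "'i filter" and G :: "'i \<Rightarrow> ('s, 'f, 'r, 'a) struct" +
  fixes H :: "'i \<Rightarrow> 'a set" and x :: "'s var"
  assumes finite_H: "\<And>i. finite (H i)" and H_ne: "\<And>i. H i \<noteq> {}"
    and H_carr: "\<And>i. H i \<subseteq> carr (G i) (fst x)" and NIP: "NIP L \<G>"
begin

definition \<mu> where "\<mu> = ultralimit L D G x (\<lambda>i. uniform_measure_on L (G i) x (H i))"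

text \<open>
  The internal set defined by the sets \<open>H i\<close>, that is, their ultraproduct.
\<close>

definition ultra_H :: "('i \<Rightarrow> 'a) set set" where
  "ultra_H = {ultraclass D G (fst x) h | h. \<forall>i. h i \<in> H i}"

text \<open>
  The bounds on shattering hold simultaneously for finitely many formulas in \<open>D\<close>-most factors. There the
  traces grow polynomially, and the exponents, hence the sample size, do not depend on the factor.
\<close>

lemma approximation_in_factors:
  assumes \<Phi>: "finite \<Phi>" and e: "0 < \<epsilon>"
    and ok: "\<And>\<psi> Z. (\<psi>, Z) \<in> \<Phi> \<Longrightarrow> \<psi> \<in> forms L (insert x Z) {} \<and> finite Z \<and> x \<notin> Z"
  obtains n where "n \<noteq> 0" "eventually (\<lambda>i. \<exists>l. (\<forall>k<n. l k \<in> H i) \<and>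
    (\<forall>(\<psi>, Z)\<in>\<Phi>. \<forall>S\<in>instances Z \<psi> i. \<bar>avg n l S - card (H i \<inter> S) / card (H i)\<bar> \<le> \<epsilon>)) D"
proof -
  let ?sh = "\<lambda>p d i. \<forall>S. S \<subseteq> carr (G i) (fst x) \<longrightarrow> finite S \<longrightarrow> card S = d \<longrightarrow>
    \<not> shatters (instances (snd p) (fst p) i) S"
  have "\<exists>d. eventually (?sh p d) D" if p: "p \<in> \<Phi>" for p
  proof -
    have "fst p \<in> forms L (insert x (snd p)) {}" "finite (snd p)" "x \<notin> snd p"
      using ok[of "fst p" "snd p"] p by auto
    from NIP_bounds_shattering[OF NIP this] show ?thesis by metis
  qed
  then have "\<forall>p\<in>\<Phi>. \<exists>d. eventually (?sh p d) D" by (rule ballI)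
  from bchoice[OF this] obtain d where d: "\<forall>p\<in>\<Phi>. eventually (?sh p (d p)) D" by (elim exE)
  have sh: "eventually (\<lambda>i. \<forall>p\<in>\<Phi>. ?sh p (d p) i) D" by (rule eventually_ball_finite[OF \<Phi> d])
  obtain n where n: "n \<noteq> 0"
    "\<And>(H :: 'a set) F. finite H \<Longrightarrow> H \<noteq> {} \<Longrightarrow>
      (\<And>W p. finite W \<Longrightarrow> W \<subseteq> H \<Longrightarrow> p \<in> \<Phi> \<Longrightarrow> card ((\<inter>) W ` F p) \<le> (card W + 1) ^ d p) \<Longrightarrow>
      \<exists>l. (\<forall>k<n. l k \<in> H) \<and> (\<forall>p\<in>\<Phi>. \<forall>S\<in>F p. \<bar>avg n l S - card (H \<inter> S) / card H\<bar> \<le> \<epsilon>)"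
    by (rule uniform_approximation_polynomial[OF \<Phi> e, of d]) blast
  from sh have "eventually (\<lambda>i. \<exists>l. (\<forall>k<n. l k \<in> H i) \<and>
    (\<forall>p\<in>\<Phi>. \<forall>S\<in>instances (snd p) (fst p) i. \<bar>avg n l S - card (H i \<inter> S) / card (H i)\<bar> \<le> \<epsilon>)) D"
  proof eventually_elim
    case (elim i)
    show ?case
    proof (rule n(2)[OF finite_H H_ne])
      fix W p assume W: "finite W" "W \<subseteq> H i" "p \<in> \<Phi>"
      show "card ((\<inter>) W ` instances (snd p) (fst p) i) \<le> (card W + 1) ^ d p"
      proof (rule sauer_shelah[OF W(1)])
        fix S assume S: "S \<subseteq> W" "card S = d p"
        then have "S \<subseteq> carr (G i) (fst x)" "finite S" using W H_carr[of i] finite_subset by auto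
        with elim W(3) S(2) show "\<not> shatters (instances (snd p) (fst p) i) S" by blast
      qed
    qed
  qed
  then show ?thesis using n(1) by (intro that[of n]) (auto simp: case_prod_beta)
qed

lemma \<mu>_inst:
  assumes \<psi>: "\<psi> \<in> forms L (insert x Z) {}" and b: "b \<in> assign \<G> Z"
  shows "((\<lambda>i. card (H i \<inter> solset (G i) (inst Z (\<lambda>w. rep i (b w)) (retype \<psi>))) / card (H i))
    \<longlongrightarrow> \<mu> (inst Z b \<psi>)) D"
proof -
  let ?m = "\<lambda>i. real (card (H i \<inter> solset (G i) (inst Z (\<lambda>w. rep i (b w)) (retype \<psi>)))) / card (H i)"
  have "inst Z b \<psi> \<in> forms L {x} (elts \<G>)"
    by (rule inst_in_forms[of _ _ _ _ "{}"]) (use \<psi> b in \<open>auto simp: elts_def assign_def\<close>)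
  moreover have "map_par (\<lambda>s. rep i) (inst Z b \<psi>) = inst Z (\<lambda>w. rep i (b w)) (retype \<psi>)" for i
    by (simp only: map_par_inst retype_eq_map_par[OF \<psi>])
  moreover have "inst Z (\<lambda>w. rep i (b w)) (retype \<psi>) \<in> forms L {x} (elts (G i))" for i
    by (rule inst_in_forms[of _ _ _ _ "{}"])
      (use retype_in_forms[OF \<psi>] rep_assign[OF b, of i] in \<open>auto simp: elts_def assign_def\<close>)
  ultimately have "\<mu> (inst Z b \<psi>) = Lim D ?m"
    unfolding \<mu>_def ultralimit_def restrict_def by (simp only: uniform_measure_on_eq[OF finite_H] if_True)
  moreover obtain l where l: "(?m \<longlongrightarrow> l) D"
  proof (rule ultrafilter_convergent[OF ultra])
    show "?m i \<in> {0..1}" for i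
      using finite_H[of i] H_ne[of i] card_mono[of "H i"] by (auto simp: divide_le_eq_1 card_gt_0_iff)
  qed
  ultimately show ?thesis using tendsto_Lim[of D ?m l] D_not_bot by simp
qed

text \<open>
  The classes of the samples in the factors form the sample. At a fixed instance, Los's theorem makes
  its average equal to those of \<open>D\<close>-most factors, which are \<open>\<epsilon>\<close>-close to the measures of the instance there;
  the bound survives in the limit.
\<close>

theorem approximation_in_ultraproduct:
  assumes \<Phi>: "finite \<Phi>" and e: "0 < \<epsilon>"
    and ok: "\<And>\<psi> Z. (\<psi>, Z) \<in> \<Phi> \<Longrightarrow> \<psi> \<in> forms L (insert x Z) {} \<and> finite Z \<and> x \<notin> Z"
  shows "\<exists>n l. n \<noteq> 0 \<and> (\<forall>k<n. l k \<in> ultra_H) \<and> (\<forall>\<psi> Z b. (\<psi>, Z) \<in> \<Phi> \<longrightarrow> b \<in> assign \<G> Z \<longrightarrow>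
    \<bar>avg n l (solset \<G> (inst Z b \<psi>)) - \<mu> (inst Z b \<psi>)\<bar> \<le> \<epsilon>)"
proof -
  let ?good = "\<lambda>n i l. \<forall>(\<psi>, Z)\<in>\<Phi>. \<forall>S\<in>instances Z \<psi> i. \<bar>avg n l S - card (H i \<inter> S) / card (H i)\<bar> \<le> \<epsilon>"
  obtain n where n: "n \<noteq> 0" "eventually (\<lambda>i. \<exists>l. (\<forall>k<n. l k \<in> H i) \<and> ?good n i l) D"
    using approximation_in_factors[OF \<Phi> e ok] by blast
  have "\<exists>l. (\<forall>k. l k \<in> H i) \<and> ((\<exists>l. (\<forall>k<n. l k \<in> H i) \<and> ?good n i l) \<longrightarrow> ?good n i l)" for i
  proof -
    obtain h where h: "h \<in> H i" using H_ne[of i] by blast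
    show ?thesis
    proof (cases "\<exists>l. (\<forall>k<n. l k \<in> H i) \<and> ?good n i l")
      case True
      then obtain l where l: "\<forall>k<n. l k \<in> H i" "?good n i l" by blast
      have "avg n (\<lambda>k. if k < n then l k else h) S = avg n l S" for S by (rule avg_cong) simp
      then show ?thesis using l h by (intro exI[of _ "\<lambda>k. if k < n then l k else h"]) auto
    next
      case False
      then show ?thesis using h by (intro exI[of _ "\<lambda>_. h"] conjI impI allI) (assumption, erule notE)
    qed
  qed
  then have "\<forall>i. \<exists>l. (\<forall>k. l k \<in> H i) \<and> ((\<exists>l. (\<forall>k<n. l k \<in> H i) \<and> ?good n i l) \<longrightarrow> ?good n i l)"
    by (rule allI)
  from choice[OF this] obtain l where l': "\<forall>i. (\<forall>k. l i k \<in> H i) \<and>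
    ((\<exists>l. (\<forall>k<n. l k \<in> H i) \<and> ?good n i l) \<longrightarrow> ?good n i (l i))" by (elim exE)
  have l: "l i k \<in> H i" for i k using l' by blast
  have lg: "?good n i (l i)" if "\<exists>l. (\<forall>k<n. l k \<in> H i) \<and> ?good n i l" for i
    using spec[OF l', of i] that by (elim conjE mp)
  have good: "eventually (\<lambda>i. ?good n i (l i)) D" using n(2) by eventually_elim (rule lg)
  define l' where "l' k = ultraclass D G (fst x) (\<lambda>i. l i k)" for k
  show ?thesis
  proof (intro exI[of _ n] exI[of _ l'] conjI allI impI)
    show "n \<noteq> 0" by (rule n(1))
    show "l' k \<in> ultra_H" for k using l by (auto simp: l'_def ultra_H_def)
    fix \<psi> Z b assume \<psi>Z: "(\<psi>, Z) \<in> \<Phi>" and b: "b \<in> assign \<G> Z"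
    then have \<psi>: "\<psi> \<in> forms L (insert x Z) {}" and Z: "finite Z" "x \<notin> Z" using ok by auto
    let ?S = "\<lambda>i. solset (G i) (inst Z (\<lambda>w. rep i (b w)) (retype \<psi>))"
    have mem: "l' k \<in> solset \<G> (inst Z b \<psi>) \<longleftrightarrow> eventually (\<lambda>i. l i k \<in> ?S i) D" for k
    proof -
      let ?v = "\<lambda>i w. if w \<in> Z then rep i (b w) else l i k"
      have v: "?v i \<in> assign (G i) (insert x Z)" for i
        using rep_assign[OF b, of i] l[of i k] H_carr[of i] Z(2) by (auto simp: assign_def)
      have "sat \<G> (\<lambda>w. if w \<in> Z then b w else l' k) [] \<psi> \<longleftrightarrow>
          sat \<G> (\<lambda>w. ultraclass D G (fst w) (\<lambda>i. ?v i w)) [] \<psi>"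
        by (rule sat_cong_forms[OF \<psi>]) (use b Z(2) in \<open>auto simp: l'_def assign_def ultraclass_rep\<close>)
      also have "\<dots> \<longleftrightarrow> eventually (\<lambda>i. sat (G i) (?v i) [] (retype \<psi>)) D"
        using Z by (intro los_tuple(2)[OF \<psi> _ v]) auto
      finally show ?thesis by (simp only: mem_solset_inst)
    qed
    have "eventually (\<lambda>i. \<forall>k\<in>{..<n}. l i k \<in> ?S i \<longleftrightarrow> l' k \<in> solset \<G> (inst Z b \<psi>)) D"
    proof (intro eventually_ball_finite ballI)
      show "eventually (\<lambda>i. l i k \<in> ?S i \<longleftrightarrow> l' k \<in> solset \<G> (inst Z b \<psi>)) D" for k
        using mem[of k] ultrafilter_Not[OF ultra, of "\<lambda>i. l i k \<in> ?S i"]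
        by (cases "l' k \<in> solset \<G> (inst Z b \<psi>)") auto
    qed simp
    with good have ev: "eventually (\<lambda>i. \<bar>avg n l' (solset \<G> (inst Z b \<psi>)) - card (H i \<inter> ?S i) / card (H i)\<bar> \<le> \<epsilon>) D"
    proof eventually_elim
      case (elim i)
      have "?S i \<in> instances Z \<psi> i" using rep_assign[OF b] by (auto simp: instances_def)
      then have "\<bar>avg n (l i) (?S i) - card (H i \<inter> ?S i) / card (H i)\<bar> \<le> \<epsilon>" using elim(1) \<psi>Z by blast
      moreover have "avg n (l i) (?S i) = avg n l' (solset \<G> (inst Z b \<psi>))"
        using elim(2) by (intro avg_cong) auto
      ultimately show ?case by simp
    qed
    have "((\<lambda>i. \<bar>avg n l' (solset \<G> (inst Z b \<psi>)) - card (H i \<inter> ?S i) / card (H i)\<bar>) \<longlongrightarrow>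
      \<bar>avg n l' (solset \<G> (inst Z b \<psi>)) - \<mu> (inst Z b \<psi>)\<bar>) D"
      by (intro tendsto_intros \<mu>_inst[OF \<psi> b])
    then show "\<bar>avg n l' (solset \<G> (inst Z b \<psi>)) - \<mu> (inst Z b \<psi>)\<bar> \<le> \<epsilon>"
      using ev D_not_bot by (rule tendsto_upperbound)
  qed
qed

end

section \<open>Translations\<close>

definition ltrans :: "('s, 'f, 'r) glang \<Rightarrow> 's var \<Rightarrow> 'a \<Rightarrow> 's var \<Rightarrow> ('s, 'f, 'a) trm" where
  "ltrans L x a = Var(x := Fn (gmul L) [Par (gsort L, a), Var x])"

lemma mem_solset_ltrans:
  assumes "\<phi> \<in> forms L {x} A"
  shows "g \<in> solset M (subst (ltrans L x a) \<phi>) \<longleftrightarrow> fint M (gmul L) [a, g] \<in> solset M \<phi>"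
proof -
  have "sat M (\<lambda>_. g) [] (subst (ltrans L x a) \<phi>) \<longleftrightarrow>
      sat M (\<lambda>w. if w = x then fint M (gmul L) [a, g] else g) [] \<phi>"
    by (rule sat_subst) (simp add: ltrans_def)
  also have "\<dots> \<longleftrightarrow> sat M (\<lambda>_. fint M (gmul L) [a, g]) [] \<phi>"
    by (rule sat_cong_forms[OF assms]) simp
  finally show ?thesis by (simp add: solset_def)
qed

lemma ltrans_in_forms:
  assumes "group_lang L" "fst x = gsort L" "(gsort L, a) \<in> A" "\<phi> \<in> forms L {x} A"
  shows "subst (ltrans L x a) \<phi> \<in> forms L {x} A"
  by (rule subst_in_forms[OF assms(4)]) (use assms(1-3) in \<open>auto simp: ltrans_def group_lang_def\<close>)

text \<open>
  A left translate of an instance is an instance of a formula with a further variable \<open>w\<close> for the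
  translating element. Statements about all instances of a formula thus apply to translates.
\<close>

lemma ltrans_inst:
  assumes \<psi>: "\<psi> \<in> forms L (insert x Z) {}" and Z: "x \<notin> Z" and w: "w \<notin> insert x Z"
  shows "subst (Var(x := Fn (gmul L) [Par (fst w, a), Var x])) (inst Z b \<psi>) =
    inst (insert w Z) (b(w := a)) (subst (Var(x := Fn (gmul L) [Var w, Var x])) \<psi>)"
proof -
  let ?\<rho> = "\<lambda>v. if v = x then Fn (gmul L) [Par (fst w, a), Var x] else if v \<in> Z then Par (fst v, b v) else Var v"
  have v: "v = x \<or> v \<in> Z" if "v \<in> fv \<psi>" for v using that \<psi> by (auto simp: forms_def)
  have "subst (Var(x := Fn (gmul L) [Par (fst w, a), Var x])) (inst Z b \<psi>) = subst ?\<rho> \<psi>"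
    unfolding inst_def by (rule subst_subst) (use Z in auto)
  also have "\<dots> = inst (insert w Z) (b(w := a)) (subst (Var(x := Fn (gmul L) [Var w, Var x])) \<psi>)"
    unfolding inst_def by (rule subst_subst[symmetric]) (use v w Z in auto)
  finally show ?thesis .
qed

lemma product_in_forms:
  assumes "group_lang L" "fst x = gsort L" "fst w = gsort L" "\<psi> \<in> forms L (insert x Z) A"
  shows "subst (Var(x := Fn (gmul L) [Var w, Var x])) \<psi> \<in> forms L (insert x (insert w Z)) A"
  by (rule subst_in_forms[OF assms(4)]) (use assms(1-3) in \<open>auto simp: group_lang_def\<close>)

lemma map_par_ltrans:
  "map_par g (subst (ltrans L x a) \<phi>) = subst (ltrans L x (g (gsort L) a)) (map_par g \<phi>)"
  by (rule map_par_subst) (simp add: ltrans_def)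

lemma (in group) card_subgroup_translate:
  assumes "subgroup K G" "a \<in> K" "finite K"
  shows "card {g \<in> K. a \<otimes> g \<in> S} = card (K \<inter> S)"
proof -
  have K: "K \<subseteq> carrier G" using assms(1) by (rule subgroup.subset)
  have "inj_on (\<lambda>g. a \<otimes> g) {g \<in> K. a \<otimes> g \<in> S}"
    using assms(2) K by (intro inj_on_subset[OF inj_on_cmult]) auto
  moreover have "(\<lambda>g. a \<otimes> g) ` {g \<in> K. a \<otimes> g \<in> S} = K \<inter> S"
  proof
    show "(\<lambda>g. a \<otimes> g) ` {g \<in> K. a \<otimes> g \<in> S} \<subseteq> K \<inter> S"
      using subgroup.m_closed[OF assms(1,2)] by auto
    show "K \<inter> S \<subseteq> (\<lambda>g. a \<otimes> g) ` {g \<in> K. a \<otimes> g \<in> S}"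
    proof
      fix h assume h: "h \<in> K \<inter> S"
      have "inv a \<otimes> h \<in> K"
        using h subgroup.m_closed[OF assms(1)] subgroup.m_inv_closed[OF assms(1,2)] by auto
      moreover have "a \<otimes> (inv a \<otimes> h) = h"
        using h K assms(2) by (subst m_assoc[symmetric]) (auto simp: subset_iff)
      ultimately show "h \<in> (\<lambda>g. a \<otimes> g) ` {g \<in> K. a \<otimes> g \<in> S}"
        using h by (intro image_eqI[of _ _ "inv a \<otimes> h"]) auto
    qed
  qed
  ultimately show ?thesis using card_image by fastforce
qed

lemma fresh_variable:
  assumes "finite Z"
  obtains w :: "'s var" where "fst w = s" "w \<notin> Z"
proof -
  obtain N where "\<And>w. w \<in> Z \<Longrightarrow> snd w < N"
    using assms finite_nat_set_iff_bounded[of "snd ` Z"] by auto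
  then show ?thesis by (intro that[of "(s, N)"]) force+
qed

locale ultra_finite_subgroups = ultra_struct L D G
  for L :: "('s, 'f, 'r) glang" and D :: "'i filter" and G :: "'i \<Rightarrow> ('s, 'f, 'r, 'a) struct" +
  fixes H :: "'i \<Rightarrow> 'a set" and x :: "'s var"
  assumes group_L: "group_lang L" and x: "fst x = gsort L"
    and group_G: "\<And>i. expands_group L (G i)"
    and subgroup_H: "\<And>i. subgroup (H i) (grp L (G i))"
    and finite_H: "\<And>i. finite (H i)" and NIP: "NIP L \<G>"
begin

sublocale ultra_finite L D G H x
proof
  fix i
  interpret subgroup "H i" "grp L (G i)" by (rule subgroup_H)
  show "H i \<noteq> {}" using one_closed by blast
  show "H i \<subseteq> carr (G i) (fst x)" using subset by (simp add: grp_def x)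
qed (use finite_H NIP in auto)

text \<open>
  In \<open>D\<close>-most factors the translating element is represented in \<open>H i\<close>, where left translation is a
  permutation; the two sequences with the limits in question agree there.
\<close>

lemma \<mu>_ltrans:
  assumes c: "c \<in> ultra_H" and \<phi>: "\<phi> \<in> forms L {x} (elts \<G>)"
  shows "\<mu> (subst (ltrans L x c) \<phi>) = \<mu> \<phi>"
proof -
  obtain h where h: "\<And>i. h i \<in> H i" "c = ultraclass D G (fst x) h" using c by (auto simp: ultra_H_def)
  have hc: "h i \<in> carr (G i) (fst x)" for i using h(1) H_carr by blast
  have cc: "c \<in> carr \<G> (gsort L)" using rep_ultraclass(3)[of h, OF hc] h(2) x by simp
  obtain Z b \<psi> where Z: "finite Z" "{x} \<inter> Z = {}" "\<psi> \<in> forms L ({x} \<union> Z) {}" "inst Z b \<psi> = \<phi>"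
    "\<And>w. w \<in> Z \<Longrightarrow> (fst w, b w) \<in> par \<phi>"
    by (rule abstract_parameters[OF \<phi>]) auto
  have \<psi>: "\<psi> \<in> forms L (insert x Z) {}" using Z(3) by simp
  have b: "b \<in> assign \<G> Z" using Z(5) \<phi> by (force simp: assign_def forms_def elts_def)
  obtain w where w: "fst w = gsort L" "w \<notin> insert x Z" using fresh_variable[of "insert x Z" "gsort L"] Z(1) by auto
  define \<sigma> :: "'s var \<Rightarrow> ('s, 'f, ('i \<Rightarrow> 'a) set) trm" where "\<sigma> = Var(x := Fn (gmul L) [Var w, Var x])"
  have \<psi>': "subst \<sigma> \<psi> \<in> forms L (insert x (insert w Z)) {}"
    unfolding \<sigma>_def by (rule product_in_forms[OF group_L x w(1) \<psi>])
  have b': "b(w := c) \<in> assign \<G> (insert w Z)" using b cc w by (auto simp: assign_def)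
  have eq: "subst (ltrans L x c) \<phi> = inst (insert w Z) (b(w := c)) (subst \<sigma> \<psi>)"
    using ltrans_inst[OF \<psi> _ w(2), of c b] Z(2,4) by (simp add: \<sigma>_def w(1) ltrans_def)
  let ?S = "\<lambda>i. solset (G i) (inst Z (\<lambda>w. rep i (b w)) (retype \<psi>))"
  let ?S' = "\<lambda>i. solset (G i) (inst (insert w Z) (\<lambda>v. rep i ((b(w := c)) v)) (retype (subst \<sigma> \<psi>)))"
  have S': "?S' i = {g. fint (G i) (gmul L) [rep i c, g] \<in> ?S i}" for i
  proof -
    have rt: "retype (subst \<sigma> \<psi>) = subst (Var(x := Fn (gmul L) [Var w, Var x])) (retype \<psi>)"
      unfolding retype_def by (rule map_par_subst) (simp add: \<sigma>_def)
    have "g \<in> ?S' i \<longleftrightarrow> fint (G i) (gmul L) [rep i c, g] \<in> ?S i" for g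
    proof -
      let ?v = "\<lambda>v. if v \<in> insert w Z then rep i ((b(w := c)) v) else g"
      have "sat (G i) ?v [] (subst (Var(x := Fn (gmul L) [Var w, Var x])) (retype \<psi>)) \<longleftrightarrow>
          sat (G i) (\<lambda>v. if v = x then fint (G i) (gmul L) [rep i c, g] else ?v v) [] (retype \<psi>)"
        by (rule sat_subst) (use w Z(2) in auto)
      also have "\<dots> \<longleftrightarrow> sat (G i) (\<lambda>v. if v \<in> Z then rep i (b v) else fint (G i) (gmul L) [rep i c, g]) [] (retype \<psi>)"
        by (rule sat_cong_forms[OF retype_in_forms[OF \<psi>]]) (use w Z(2) in auto)
      finally show ?thesis by (simp only: mem_solset_inst rt)
    qed
    then show ?thesis by blast
  qed
  have "eventually (\<lambda>i. rep i c = h i) D" unfolding h(2) by (rule rep_ultraclass(1)[OF hc])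
  then have ev: "eventually (\<lambda>i. real (card (H i \<inter> ?S' i)) / card (H i) = card (H i \<inter> ?S i) / card (H i)) D"
  proof eventually_elim
    case (elim i)
    interpret group "grp L (G i)" using group_G[of i] by (simp add: expands_group_def)
    have "card (H i \<inter> ?S' i) = card {g \<in> H i. h i \<otimes>\<^bsub>grp L (G i)\<^esub> g \<in> ?S i}"
      unfolding S' elim by (rule arg_cong[where f = card]) (auto simp: grp_def)
    also have "\<dots> = card (H i \<inter> ?S i)" by (rule card_subgroup_translate[OF subgroup_H h(1) finite_H])
    finally show ?case by simp
  qed
  have "((\<lambda>i. real (card (H i \<inter> ?S' i)) / card (H i)) \<longlongrightarrow> \<mu> (subst (ltrans L x c) \<phi>)) D"
    unfolding eq by (rule \<mu>_inst[OF \<psi>' b'])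
  then have "((\<lambda>i. card (H i \<inter> ?S i) / card (H i)) \<longlongrightarrow> \<mu> (subst (ltrans L x c) \<phi>)) D"
    by (rule Lim_transform_eventually[OF _ ev])
  moreover have "((\<lambda>i. card (H i \<inter> ?S i) / card (H i)) \<longlongrightarrow> \<mu> \<phi>) D"
    using \<mu>_inst[OF \<psi> b] unfolding Z(4) .
  ultimately show ?thesis by (rule tendsto_unique[OF D_not_bot])
qed

end

text \<open>
  The ultraproduct enters \<open>U\<close> through an isomorphic copy \<open>M\<close>; its measure and samples are carried along.
\<close>

locale transported = ultra_finite_subgroups L D G H x
  for L :: "('s, 'f, 'r) glang" and D :: "'i filter" and G :: "'i \<Rightarrow> ('s, 'f, 'r, 'a) struct"
    and H :: "'i \<Rightarrow> 'a set" and x :: "'s var" +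
  fixes M :: "('s, 'f, 'r, 'u) struct" and j :: "'s \<Rightarrow> ('i \<Rightarrow> 'a) set \<Rightarrow> 'u"
  assumes iso: "isomorphism L \<G> M j"
begin

abbreviation jinv where "jinv \<equiv> \<lambda>s. inv_into (carr \<G> s) (j s)"
abbreviation m where "m \<equiv> transport L \<G> M j x \<mu>"
abbreviation K where "K \<equiv> j (fst x) ` ultra_H"

lemma jinv: "a \<in> carr M s \<Longrightarrow> jinv s a \<in> carr \<G> s" "a \<in> carr M s \<Longrightarrow> j s (jinv s a) = a"
proof -
  assume a: "a \<in> carr M s"
  have "carr M s = j s ` carr \<G> s" using iso by (auto simp: isomorphism_def bij_betw_def)
  with a show "jinv s a \<in> carr \<G> s" "j s (jinv s a) = a"
    by (auto intro: inv_into_into f_inv_into_f)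
qed

lemma ultra_H_carr: "ultra_H \<subseteq> carr \<G> (fst x)"
proof
  fix c assume "c \<in> ultra_H"
  then obtain h where h: "\<And>i. h i \<in> H i" "c = ultraclass D G (fst x) h" by (auto simp: ultra_H_def)
  have "h i \<in> carr (G i) (fst x)" for i using h(1) H_carr by blast
  from rep_ultraclass(3)[of h, OF this] h(2) show "c \<in> carr \<G> (fst x)" by simp
qed

lemma K_carr: "K \<subseteq> carr M (fst x)"
  using ultra_H_carr iso by (auto simp: isomorphism_def bij_betw_def)

lemma m_inst:
  assumes "\<psi> \<in> forms L (insert x Z) {}" "b \<in> assign M Z"
  shows "m (inst Z b \<psi>) = \<mu> (inst Z (\<lambda>w. jinv (fst w) (b w)) (retype \<psi>))"
proof -
  have "inst Z b \<psi> \<in> forms L {x} (elts M)"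
    by (rule inst_in_forms[of _ _ _ _ "{}"]) (use assms in \<open>auto simp: elts_def assign_def\<close>)
  then show ?thesis by (simp add: transport_def map_par_inst retype_eq_map_par[OF assms(1)])
qed

lemma solset_transport:
  assumes \<psi>: "\<psi> \<in> forms L (insert x Z) {}" and x: "x \<notin> Z" and b: "b \<in> assign M Z" and c: "c \<in> carr \<G> (fst x)"
  shows "j (fst x) c \<in> solset M (inst Z b \<psi>) \<longleftrightarrow>
    c \<in> solset \<G> (inst Z (\<lambda>w. jinv (fst w) (b w)) (retype \<psi>))"
proof -
  let ?v = "\<lambda>w. if w \<in> Z then jinv (fst w) (b w) else c"
  have r: "retype \<psi> \<in> forms L (insert x Z) {}" by (rule retype_in_forms[OF \<psi>])
  have "sat M (\<lambda>w. j (fst w) (?v w)) (map2 j [] []) (map_par j (retype \<psi>)) \<longleftrightarrow> sat \<G> ?v [] (retype \<psi>)"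
  proof (rule sat_isomorphism[OF is_struct_ultraproduct iso])
    show "fm_ok L [] (retype \<psi>)" "par (retype \<psi>) \<subseteq> elts \<G>" using r by (auto simp: forms_def)
    fix w assume "w \<in> fv (retype \<psi>)"
    then have "w \<in> insert x Z" using r by (auto simp: forms_def)
    then show "?v w \<in> carr \<G> (fst w)" using b c jinv(1) by (auto simp: assign_def)
  qed simp
  moreover have "map_par j (retype \<psi>) = \<psi>"
  proof -
    have "map_par j (retype \<psi>) = map_par (\<lambda>s a. j s undefined) \<psi>"
      unfolding retype_def by (rule map_par_map_par)
    also have "\<dots> = \<psi>" by (rule map_par_ident) (use \<psi> in \<open>auto simp: forms_def\<close>)
    finally show ?thesis .
  qed
  moreover have "sat M (\<lambda>w. j (fst w) (?v w)) [] \<psi> \<longleftrightarrow> sat M (\<lambda>w. if w \<in> Z then b w else j (fst x) c) [] \<psi>"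
    by (rule sat_cong_forms[OF \<psi>]) (use x b jinv(2) in \<open>auto simp: assign_def\<close>)
  ultimately show ?thesis by (simp add: mem_solset_inst)
qed

theorem approximation_transported:
  assumes \<Phi>: "finite \<Phi>" and e: "0 < \<epsilon>"
    and ok: "\<And>\<psi> Z. (\<psi>, Z) \<in> \<Phi> \<Longrightarrow> \<psi> \<in> forms L (insert x Z) {} \<and> finite Z \<and> x \<notin> Z"
  shows "\<exists>n l. n \<noteq> 0 \<and> (\<forall>k<n. l k \<in> K) \<and> (\<forall>(\<psi>, Z)\<in>\<Phi>. \<forall>b\<in>assign M Z.
    \<bar>avg n l (solset M (inst Z b \<psi>)) - m (inst Z b \<psi>)\<bar> \<le> \<epsilon>)"
proof -
  let ?\<Phi> = "(\<lambda>(\<psi>, Z). (retype \<psi>, Z)) ` \<Phi>"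
  have "finite ?\<Phi>" using \<Phi> by simp
  moreover have "\<psi>' \<in> forms L (insert x Z) {} \<and> finite Z \<and> x \<notin> Z" if "(\<psi>', Z) \<in> ?\<Phi>" for \<psi>' Z
    using that ok by (auto intro: retype_in_forms)
  ultimately have "\<exists>n l. n \<noteq> 0 \<and> (\<forall>k<n. l k \<in> ultra_H) \<and> (\<forall>\<psi> Z b. (\<psi>, Z) \<in> ?\<Phi> \<longrightarrow> b \<in> assign \<G> Z \<longrightarrow>
      \<bar>avg n l (solset \<G> (inst Z b \<psi>)) - \<mu> (inst Z b \<psi>)\<bar> \<le> \<epsilon>)"
    by (rule approximation_in_ultraproduct[OF _ e])
  then obtain n l where nl: "n \<noteq> 0" "\<And>k. k < n \<Longrightarrow> l k \<in> ultra_H"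
    "\<And>\<psi> Z b. (\<psi>, Z) \<in> ?\<Phi> \<Longrightarrow> b \<in> assign \<G> Z \<Longrightarrow> \<bar>avg n l (solset \<G> (inst Z b \<psi>)) - \<mu> (inst Z b \<psi>)\<bar> \<le> \<epsilon>"
    by metis
  let ?l = "\<lambda>k. j (fst x) (l k)"
  have "\<bar>avg n ?l (solset M (inst Z b \<psi>)) - m (inst Z b \<psi>)\<bar> \<le> \<epsilon>"
    if p: "(\<psi>, Z) \<in> \<Phi>" and b: "b \<in> assign M Z" for \<psi> Z b
  proof -
    have \<psi>: "\<psi> \<in> forms L (insert x Z) {}" and Z: "x \<notin> Z" using ok p by auto
    let ?b = "\<lambda>w. jinv (fst w) (b w)"
    have "?b \<in> assign \<G> Z" using b jinv(1) by (auto simp: assign_def)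
    moreover have "(retype \<psi>, Z) \<in> ?\<Phi>" using p by force
    ultimately have "\<bar>avg n l (solset \<G> (inst Z ?b (retype \<psi>))) - \<mu> (inst Z ?b (retype \<psi>))\<bar> \<le> \<epsilon>"
      by (rule nl(3)[rotated])
    moreover have "avg n ?l (solset M (inst Z b \<psi>)) = avg n l (solset \<G> (inst Z ?b (retype \<psi>)))"
      using solset_transport[OF \<psi> Z b] nl(2) ultra_H_carr by (intro avg_cong) blast
    ultimately show ?thesis by (simp only: m_inst[OF \<psi> b])
  qed
  then show ?thesis
    using nl(1,2) by (intro exI[of _ n] exI[of _ ?l]) auto
qed

theorem m_ltrans:
  assumes a: "a \<in> K" and \<phi>: "\<phi> \<in> forms L {x} (elts M)"
  shows "m (subst (ltrans L x a) \<phi>) = m \<phi>"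
proof -
  obtain c where c: "c \<in> ultra_H" "a = j (fst x) c" using a by blast
  have ca: "jinv (gsort L) a = c"
  proof -
    have "inj_on (j (gsort L)) (carr \<G> (gsort L))" using iso by (auto simp: isomorphism_def bij_betw_def)
    then show ?thesis using c ultra_H_carr x by (auto intro!: inv_into_f_f)
  qed
  have "(gsort L, a) \<in> elts M" using a K_carr x by (auto simp: elts_def)
  then have "subst (ltrans L x a) \<phi> \<in> forms L {x} (elts M)" by (rule ltrans_in_forms[OF group_L x _ \<phi>])
  then have "m (subst (ltrans L x a) \<phi>) = \<mu> (subst (ltrans L x c) (map_par jinv \<phi>))"
    by (simp only: transport_def restrict_def if_True map_par_ltrans ca)
  also have "\<dots> = \<mu> (map_par jinv \<phi>)"
    by (rule \<mu>_ltrans[OF c(1)], rule map_par_in_forms[OF \<phi>]) (auto simp: elts_def jinv(1))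
  also have "\<dots> = m \<phi>" using \<phi> by (simp only: transport_def restrict_def if_True)
  finally show ?thesis .
qed

end

section \<open>The definable extension of an approximable measure\<close>

lemma cauchy_filter_limit:
  fixes f :: "'p \<Rightarrow> real"
  assumes F: "F \<noteq> bot"
    and cauchy: "\<And>\<epsilon>. 0 < \<epsilon> \<Longrightarrow> \<exists>P. eventually P F \<and> (\<forall>p p'. P p \<and> P p' \<longrightarrow> \<bar>f p - f p'\<bar> < \<epsilon>)"
  shows "(f \<longlongrightarrow> Lim F f) F"
proof -
  have "cauchy_filter (filtermap f F)"
    unfolding cauchy_filter_metric_filtermap using cauchy by (simp add: dist_real_def)
  moreover have "filtermap f F \<noteq> bot" using F by (simp add: filtermap_bot_iff)
  ultimately have "\<exists>l\<in>UNIV. filtermap f F \<le> nhds l"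
    using complete_UNIV[where 'a = real, unfolded complete_uniform] by simp
  then obtain l where "filtermap f F \<le> nhds l" by blast
  then have "(f \<longlongrightarrow> l) F" by (simp add: filterlim_def)
  with tendsto_Lim[OF F this] show ?thesis by simp
qed

lemma avg_nonneg: "0 \<le> avg n l S" and avg_le_1: "avg n l S \<le> 1"
proof -
  show "0 \<le> avg n l S" by (simp add: avg_def)
  have "(\<Sum>k<n. of_bool (l k \<in> S)) \<le> (\<Sum>k<n. 1 :: real)" by (intro sum_mono) auto
  then show "avg n l S \<le> 1" by (auto simp: avg_def divide_le_eq_1)
qed

text \<open>
  The properties of the measure on which its definable extension rests: on finitely many formulas at a
  time, it is uniformly approximated by averages over samples from \<open>K\<close>.
\<close>

locale approximable =
  fixes L :: "('s, 'f, 'r) glang" and U M :: "('s, 'f, 'r, 'u) struct" and x :: "'s var"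
    and K :: "'u set" and m :: "('s, 'f, 'r, 'u) form \<Rightarrow> real"
  assumes MU: "elementary_substruct L M U" and K: "K \<subseteq> carr M (fst x)"
    and m_ext: "m \<in> extensional (forms L {x} (elts M))"
    and approx: "\<And>\<Phi> \<epsilon>. finite \<Phi> \<Longrightarrow> 0 < \<epsilon> \<Longrightarrow>
      (\<And>\<psi> Z. (\<psi>, Z) \<in> \<Phi> \<Longrightarrow> \<psi> \<in> forms L (insert x Z) {} \<and> finite Z \<and> x \<notin> Z) \<Longrightarrow>
      \<exists>n l. n \<noteq> 0 \<and> (\<forall>k<n. l k \<in> K) \<and> (\<forall>(\<psi>, Z)\<in>\<Phi>. \<forall>b\<in>assign M Z.
        \<bar>avg n l (solset M (inst Z b \<psi>)) - m (inst Z b \<psi>)\<bar> \<le> \<epsilon>)"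
begin

definition partitioned :: "('s, 'f, 'r, 'u) form \<Rightarrow> 's var set \<Rightarrow> bool" where
  "partitioned \<psi> Z \<longleftrightarrow> \<psi> \<in> forms L (insert x Z) {} \<and> finite Z \<and> x \<notin> Z"

definition samples :: "(('s, 'f, 'r, 'u) form \<times> 's var set) set \<Rightarrow> real \<Rightarrow> (nat \<times> (nat \<Rightarrow> 'u)) set" where
  "samples \<Phi> \<epsilon> = {(n, l). n \<noteq> 0 \<and> (\<forall>k<n. l k \<in> K) \<and> (\<forall>(\<psi>, Z)\<in>\<Phi>. \<forall>b\<in>assign M Z.
    \<bar>avg n l (solset M (inst Z b \<psi>)) - m (inst Z b \<psi>)\<bar> \<le> \<epsilon>)}"

text \<open>
  Samples that are good for more formulas and smaller errors form a filter base, because the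
  approximation property covers several formulas at once. Limits along this filter make additivity
  of the extension evident, since all formulas use the same samples.
\<close>

definition sample_filter :: "(nat \<times> (nat \<Rightarrow> 'u)) filter" where
  "sample_filter = (INF (\<Phi>, \<epsilon>)\<in>{(\<Phi>, \<epsilon>). finite \<Phi> \<and> (\<forall>(\<psi>, Z)\<in>\<Phi>. partitioned \<psi> Z) \<and> 0 < \<epsilon>}. principal (samples \<Phi> \<epsilon>))"

lemma eventually_sample_filter:
  "eventually P sample_filter \<longleftrightarrow>
    (\<exists>\<Phi> \<epsilon>. finite \<Phi> \<and> (\<forall>(\<psi>, Z)\<in>\<Phi>. partitioned \<psi> Z) \<and> 0 < \<epsilon> \<and> (\<forall>p\<in>samples \<Phi> \<epsilon>. P p))"
proof -
  let ?B = "{(\<Phi>, \<epsilon> :: real). finite \<Phi> \<and> (\<forall>(\<psi>, Z)\<in>\<Phi>. partitioned \<psi> Z) \<and> 0 < \<epsilon>}"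
  let ?F = "\<lambda>(\<Phi>, \<epsilon>). principal (samples \<Phi> \<epsilon>)"
  have "eventually P sample_filter \<longleftrightarrow> (\<exists>b\<in>?B. eventually P (?F b))"
    unfolding sample_filter_def
  proof (rule eventually_INF_base)
    have "({}, 1) \<in> ?B" by simp
    then show "?B \<noteq> {}" by blast
    fix a b assume "a \<in> ?B" "b \<in> ?B"
    then obtain \<Phi> \<epsilon> \<Phi>' \<epsilon>' where ab: "a = (\<Phi>, \<epsilon>)" "b = (\<Phi>', \<epsilon>')" "(\<Phi>, \<epsilon>) \<in> ?B" "(\<Phi>', \<epsilon>') \<in> ?B" by (cases a, cases b) auto
    have "(\<Phi> \<union> \<Phi>', min \<epsilon> \<epsilon>') \<in> ?B" using ab(3,4) by auto
    moreover have "samples (\<Phi> \<union> \<Phi>') (min \<epsilon> \<epsilon>') \<subseteq> samples \<Phi> \<epsilon> \<inter> samples \<Phi>' \<epsilon>'" unfolding samples_def by fastforce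
    ultimately show "\<exists>c\<in>?B. ?F c \<le> inf (?F a) (?F b)"
      unfolding ab by (intro bexI[of _ "(\<Phi> \<union> \<Phi>', min \<epsilon> \<epsilon>')"]) auto
  qed
  also have "\<dots> \<longleftrightarrow> (\<exists>\<Phi> \<epsilon>. finite \<Phi> \<and> (\<forall>(\<psi>, Z)\<in>\<Phi>. partitioned \<psi> Z) \<and> 0 < \<epsilon> \<and> (\<forall>p\<in>samples \<Phi> \<epsilon>. P p))"
    by (simp add: eventually_principal)
  finally show ?thesis .
qed

lemma sample_filter_not_bot: "sample_filter \<noteq> bot"
proof
  assume "sample_filter = bot"
  then have "eventually (\<lambda>_. False) sample_filter" by simp
  then obtain \<Phi> \<epsilon> where *: "finite \<Phi>" "\<forall>(\<psi>, Z)\<in>\<Phi>. partitioned \<psi> Z" "0 < \<epsilon>" "samples \<Phi> \<epsilon> = {}"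
    unfolding eventually_sample_filter by blast
  have "\<psi> \<in> forms L (insert x Z) {} \<and> finite Z \<and> x \<notin> Z" if "(\<psi>, Z) \<in> \<Phi>" for \<psi> Z
    using *(2) that unfolding partitioned_def by blast
  from approx[OF *(1,3) this] obtain n l where "(n, l) \<in> samples \<Phi> \<epsilon>" unfolding samples_def by auto
  with *(4) show False by blast
qed

lemma eventually_samples: "partitioned \<psi> Z \<Longrightarrow> 0 < \<epsilon> \<Longrightarrow> eventually (\<lambda>p. p \<in> samples {(\<psi>, Z)} \<epsilon>) sample_filter"
  unfolding eventually_sample_filter by (intro exI[of _ "{(\<psi>, Z)}"] exI[of _ \<epsilon>]) auto

lemma eventually_in_K: "eventually (\<lambda>(n, l). n \<noteq> 0 \<and> (\<forall>k<n. l k \<in> K)) sample_filter"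
  unfolding eventually_sample_filter by (intro exI[of _ "{}"] exI[of _ 1]) (auto simp: samples_def)

text \<open>
  The average of the sample at the instances \<open>\<psi>(x, b)\<close> with \<open>b\<close> realizing \<open>q\<close>.
\<close>

definition type_avg :: "('s, 'f, 'r, 'u) form \<Rightarrow> ('s, 'f, 'r, 'u) form set \<Rightarrow> nat \<times> (nat \<Rightarrow> 'u) \<Rightarrow> real" where
  "type_avg \<psi> q = (\<lambda>(n, l). avg n l {a. inst {x} (\<lambda>_. a) \<psi> \<in> q})"

lemma inst_x_in_forms:
  assumes "partitioned \<psi> Z" "a \<in> K"
  shows "inst {x} (\<lambda>_. a) \<psi> \<in> forms L Z (elts M)"
  by (rule inst_in_forms[of _ _ _ _ "{}"])
    (use assms K in \<open>auto simp: partitioned_def elts_def\<close>)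

lemma sat_inst_x:
  assumes "partitioned \<psi> Z"
  shows "sat N b [] (inst {x} (\<lambda>_. a) \<psi>) \<longleftrightarrow> a \<in> solset N (inst Z b \<psi>)"
  unfolding mem_solset_inst sat_inst
  by (rule sat_cong_forms[of _ L "insert x Z" "{}"]) (use assms in \<open>auto simp: partitioned_def\<close>)

text \<open>
  Both averages depend on finitely many formulas in \<open>q\<close>, which some tuple \<open>b\<close> of \<open>M\<close> realizes; at \<open>b\<close> both are
  \<open>\<epsilon>\<close>-close to \<open>m\<close>.
\<close>

lemma type_avg_samples:
  assumes \<psi>: "partitioned \<psi> Z" and q: "q \<in> types L M Z (elts M)" and p: "p \<in> samples {(\<psi>, Z)} \<epsilon>" and p': "p' \<in> samples {(\<psi>, Z)} \<epsilon>"
  shows "\<bar>type_avg \<psi> q p - type_avg \<psi> q p'\<bar> \<le> 2 * \<epsilon>"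
proof -
  obtain n l n' l' where [simp]: "p = (n, l)" "p' = (n', l')" by (cases p, cases p')
  let ?A = "l ` {..<n} \<union> l' ` {..<n'}"
  let ?\<Theta> = "(\<lambda>a. inst {x} (\<lambda>_. a) \<psi>) ` ?A"
  have "?A \<subseteq> K" using p p' by (auto simp: samples_def)
  then have "?\<Theta> \<subseteq> forms L Z (elts M)" using inst_x_in_forms[OF \<psi>] by blast
  moreover have "finite ?\<Theta>" by simp
  ultimately obtain b where b: "b \<in> assign M Z" "\<And>\<theta>. \<theta> \<in> ?\<Theta> \<Longrightarrow> \<theta> \<in> q \<longleftrightarrow> sat M b [] \<theta>"
    using type_realized_finite[OF q] by metis
  have mem: "inst {x} (\<lambda>_. a) \<psi> \<in> q \<longleftrightarrow> a \<in> solset M (inst Z b \<psi>)" if "a \<in> ?A" for a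
    using b(2)[of "inst {x} (\<lambda>_. a) \<psi>"] that sat_inst_x[OF \<psi>, of M b a] by blast
  have "type_avg \<psi> q p = avg n l (solset M (inst Z b \<psi>))" "type_avg \<psi> q p' = avg n' l' (solset M (inst Z b \<psi>))"
    unfolding type_avg_def using mem by (auto intro!: avg_cong)
  moreover have "\<bar>avg n l (solset M (inst Z b \<psi>)) - m (inst Z b \<psi>)\<bar> \<le> \<epsilon>"
    "\<bar>avg n' l' (solset M (inst Z b \<psi>)) - m (inst Z b \<psi>)\<bar> \<le> \<epsilon>"
    using p p' b(1) by (auto simp: samples_def)
  ultimately show ?thesis by linarith
qed

text \<open>
  This is the map \<open>F\<^sup>\<psi>\<close> of the extension \<open>\<rho>\<close>.
\<close>

definition fibre :: "('s, 'f, 'r, 'u) form \<Rightarrow> ('s, 'f, 'r, 'u) form set \<Rightarrow> real" where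
  "fibre \<psi> q = Lim sample_filter (type_avg \<psi> q)"

lemma tendsto_fibre:
  assumes \<psi>: "partitioned \<psi> Z" and q: "q \<in> types L M Z (elts M)"
  shows "(type_avg \<psi> q \<longlongrightarrow> fibre \<psi> q) sample_filter"
  unfolding fibre_def
proof (rule cauchy_filter_limit[OF sample_filter_not_bot])
  fix \<epsilon> :: real assume e: "0 < \<epsilon>"
  have "\<bar>type_avg \<psi> q p - type_avg \<psi> q p'\<bar> < \<epsilon>" if "p \<in> samples {(\<psi>, Z)} (\<epsilon> / 3) \<and> p' \<in> samples {(\<psi>, Z)} (\<epsilon> / 3)" for p p'
    using type_avg_samples[OF \<psi> q, of p "\<epsilon> / 3" p'] that e by auto
  then show "\<exists>P. eventually P sample_filter \<and> (\<forall>p p'. P p \<and> P p' \<longrightarrow> \<bar>type_avg \<psi> q p - type_avg \<psi> q p'\<bar> < \<epsilon>)"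
    using eventually_samples[OF \<psi>, of "\<epsilon> / 3"] e by (intro exI[of _ "\<lambda>p. p \<in> samples {(\<psi>, Z)} (\<epsilon> / 3)"]) auto
qed

lemma fibre_approx:
  assumes \<psi>: "partitioned \<psi> Z" and q: "q \<in> types L M Z (elts M)" and p: "p \<in> samples {(\<psi>, Z)} \<epsilon>" and e: "0 < \<epsilon>"
  shows "\<bar>type_avg \<psi> q p - fibre \<psi> q\<bar> \<le> 2 * \<epsilon>"
proof (rule tendsto_upperbound[OF _ _ sample_filter_not_bot])
  show "((\<lambda>p'. \<bar>type_avg \<psi> q p - type_avg \<psi> q p'\<bar>) \<longlongrightarrow> \<bar>type_avg \<psi> q p - fibre \<psi> q\<bar>) sample_filter"
    by (intro tendsto_intros tendsto_fibre[OF \<psi> q])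
  show "eventually (\<lambda>p'. \<bar>type_avg \<psi> q p - type_avg \<psi> q p'\<bar> \<le> 2 * \<epsilon>) sample_filter"
    using eventually_samples[OF \<psi> e] by eventually_elim (rule type_avg_samples[OF \<psi> q p])
qed

lemma fibre_bounds:
  assumes \<psi>: "partitioned \<psi> Z" and q: "q \<in> types L M Z (elts M)"
  shows "fibre \<psi> q \<in> {0..1}"
proof -
  have "0 \<le> type_avg \<psi> q p" "type_avg \<psi> q p \<le> 1" for p
    by (auto simp: type_avg_def avg_nonneg avg_le_1 split: prod.split)
  then have "0 \<le> fibre \<psi> q" "fibre \<psi> q \<le> 1"
    using tendsto_lowerbound[OF tendsto_fibre[OF \<psi> q] _ sample_filter_not_bot, of 0]
      tendsto_upperbound[OF tendsto_fibre[OF \<psi> q] _ sample_filter_not_bot, of 1] by simp_all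
  then show ?thesis by simp
qed

text \<open>
  A uniform limit of functions that are locally constant: the average over a sample depends on
  finitely many formulas.
\<close>

lemma continuous_fibre:
  assumes \<psi>: "partitioned \<psi> Z"
  shows "continuous_map (type_topology L M Z (elts M)) (top_of_set {0..1}) (fibre \<psi>)"
  unfolding continuous_map_types_iff
proof (intro conjI ballI allI impI)
  show "fibre \<psi> q \<in> {0..1}" if "q \<in> types L M Z (elts M)" for q by (rule fibre_bounds[OF \<psi> that])
  fix q and \<epsilon> :: real assume q: "q \<in> types L M Z (elts M)" and e: "0 < \<epsilon>"
  have "eventually (\<lambda>p. p \<in> samples {(\<psi>, Z)} (\<epsilon> / 5)) sample_filter" using e by (intro eventually_samples[OF \<psi>]) auto
  then obtain p where p: "p \<in> samples {(\<psi>, Z)} (\<epsilon> / 5)" using eventually_happens'[OF sample_filter_not_bot] by blast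
  obtain n l where nl: "p = (n, l)" by (cases p)
  have lK: "l k \<in> K" if "k < n" for k using p that by (auto simp: nl samples_def)
  define lit where "lit k = (if inst {x} (\<lambda>_. l k) \<psi> \<in> q then inst {x} (\<lambda>_. l k) \<psi>
    else Neg (inst {x} (\<lambda>_. l k) \<psi>))" for k
  let ?\<theta>s = "map lit [0..<n]"
  have fo: "inst {x} (\<lambda>_. l k) \<psi> \<in> forms L Z (elts M)" if "k < n" for k
    by (rule inst_x_in_forms[OF \<psi> lK[OF that]])
  have "lit k \<in> forms L Z (elts M)" if "k < n" for k using fo[OF that] by (simp add: lit_def)
  then have sub: "set ?\<theta>s \<subseteq> forms L Z (elts M)" by auto
  have Conjs_iff: "Conjs ?\<theta>s \<in> r \<longleftrightarrow> (\<forall>\<theta>\<in>set ?\<theta>s. \<theta> \<in> r)" if r: "r \<in> types L M Z (elts M)" for r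
  proof -
    have "finite (insert (Conjs ?\<theta>s) (set ?\<theta>s))" "insert (Conjs ?\<theta>s) (set ?\<theta>s) \<subseteq> forms L Z (elts M)"
      using sub by auto
    from type_realized_finite[OF r this] obtain b
      where b: "\<forall>\<theta>\<in>insert (Conjs ?\<theta>s) (set ?\<theta>s). \<theta> \<in> r \<longleftrightarrow> sat M b [] \<theta>" by metis
    have "Conjs ?\<theta>s \<in> r \<longleftrightarrow> sat M b [] (Conjs ?\<theta>s)" using b by blast
    also have "\<dots> \<longleftrightarrow> (\<forall>\<theta>\<in>set ?\<theta>s. sat M b [] \<theta>)" by (rule sat_Conjs)
    also have "\<dots> \<longleftrightarrow> (\<forall>\<theta>\<in>set ?\<theta>s. \<theta> \<in> r)" using b by blast
    finally show ?thesis .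
  qed
  show "\<exists>\<theta>\<in>forms L Z (elts M). \<theta> \<in> q \<and> (\<forall>r\<in>types L M Z (elts M). \<theta> \<in> r \<longrightarrow> \<bar>fibre \<psi> r - fibre \<psi> q\<bar> < \<epsilon>)"
  proof (intro bexI[of _ "Conjs ?\<theta>s"] conjI ballI impI)
    show "Conjs ?\<theta>s \<in> forms L Z (elts M)" using sub by simp
    show "Conjs ?\<theta>s \<in> q"
    proof -
      have "lit k \<in> q" if "k < n" for k using type_Neg[OF q fo[OF that]] by (simp add: lit_def)
      then show ?thesis unfolding Conjs_iff[OF q] by simp
    qed
    fix r assume r: "r \<in> types L M Z (elts M)" "Conjs ?\<theta>s \<in> r"
    have "inst {x} (\<lambda>_. l k) \<psi> \<in> r \<longleftrightarrow> inst {x} (\<lambda>_. l k) \<psi> \<in> q" if k: "k < n" for k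
    proof -
      let ?\<theta> = "inst {x} (\<lambda>_. l k) \<psi>"
      have "lit k \<in> r" using r(2) k unfolding Conjs_iff[OF r(1)] by simp
      then show ?thesis using type_Neg[OF r(1) fo[OF k]] by (auto simp: lit_def split: if_splits)
    qed
    then have "type_avg \<psi> r p = type_avg \<psi> q p" by (auto simp: type_avg_def nl intro!: avg_cong)
    then have "\<bar>fibre \<psi> r - fibre \<psi> q\<bar> \<le> \<bar>type_avg \<psi> r p - fibre \<psi> r\<bar> + \<bar>type_avg \<psi> q p - fibre \<psi> q\<bar>"
      using abs_triangle_ineq4[of "type_avg \<psi> q p - fibre \<psi> q" "type_avg \<psi> q p - fibre \<psi> r"] by simp
    also have "\<dots> \<le> 2 * (\<epsilon> / 5) + 2 * (\<epsilon> / 5)"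
      using e by (intro add_mono fibre_approx[OF \<psi> r(1) p] fibre_approx[OF \<psi> q p]) auto
    finally show "\<bar>fibre \<psi> r - fibre \<psi> q\<bar> < \<epsilon>" using e by simp
  qed
qed

text \<open>The definable extension of \<open>m\<close>, as \<open>hat_eq_\<rho>\<close> shows.\<close>

definition \<rho> :: "('s, 'f, 'r, 'u) form \<Rightarrow> real" where
  "\<rho> = (\<lambda>\<phi>\<in>forms L {x} (elts U). Lim sample_filter (av U \<phi>))"

lemma K_U: "K \<subseteq> carr U (fst x)"
  using K elts_elementary[OF MU] by (auto simp: elts_def)

lemma inst_in_forms_x:
  "partitioned \<psi> Z \<Longrightarrow> b \<in> assign N Z \<Longrightarrow> inst Z b \<psi> \<in> forms L {x} (elts N)"
  by (rule inst_in_forms[of _ _ _ _ "{}"]) (auto simp: partitioned_def elts_def assign_def)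

lemma as_instance:
  fixes N :: "('s, 'f, 'r, 'u) struct"
  assumes "\<phi> \<in> forms L {x} (elts N)"
  obtains Z b \<psi> where "partitioned \<psi> Z" "b \<in> assign N Z" "inst Z b \<psi> = \<phi>"
proof -
  obtain Z b \<psi> where Z: "finite Z" "{x} \<inter> Z = {}" "\<psi> \<in> forms L ({x} \<union> Z) {}" "inst Z b \<psi> = \<phi>"
    "\<And>w. w \<in> Z \<Longrightarrow> (fst w, b w) \<in> par \<phi>"
    by (rule abstract_parameters[OF assms]) auto
  have "b \<in> assign N Z" using Z(5) assms by (force simp: assign_def forms_def elts_def)
  with Z show ?thesis by (intro that[of \<psi> Z b]) (auto simp: partitioned_def)
qed

lemma tp_U_in_types: "partitioned \<psi> Z \<Longrightarrow> b \<in> assign U Z \<Longrightarrow> tp L U Z (elts M) b \<in> types L M Z (elts M)"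
  by (rule tp_in_types_elementary[OF MU]) (auto simp: partitioned_def)

lemma type_avg_U:
  assumes \<psi>: "partitioned \<psi> Z" and b: "b \<in> assign U Z" and l: "\<And>k. k < n \<Longrightarrow> l k \<in> K"
  shows "type_avg \<psi> (tp L U Z (elts M) b) (n, l) = avg n l (solset U (inst Z b \<psi>))"
proof -
  have "inst {x} (\<lambda>_. l k) \<psi> \<in> tp L U Z (elts M) b \<longleftrightarrow> l k \<in> solset U (inst Z b \<psi>)" if "k < n" for k
    using inst_x_in_forms[OF \<psi> l[OF that]] sat_inst_x[OF \<psi>, of U b] by (simp add: tp_def)
  then show ?thesis by (auto simp: type_avg_def intro!: avg_cong)
qed

lemma \<rho>_inst_limit:
  assumes \<psi>: "partitioned \<psi> Z" and b: "b \<in> assign U Z"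
  shows "((av U (inst Z b \<psi>)) \<longlongrightarrow> fibre \<psi> (tp L U Z (elts M) b)) sample_filter"
    "\<rho> (inst Z b \<psi>) = fibre \<psi> (tp L U Z (elts M) b)"
proof -
  have "eventually (\<lambda>p. type_avg \<psi> (tp L U Z (elts M) b) p = (av U (inst Z b \<psi>)) p) sample_filter"
    using eventually_in_K by eventually_elim (auto simp: type_avg_U[OF \<psi> b])
  with tendsto_fibre[OF \<psi> tp_U_in_types[OF \<psi> b]]
  show lim: "((av U (inst Z b \<psi>)) \<longlongrightarrow> fibre \<psi> (tp L U Z (elts M) b)) sample_filter"
    by (rule Lim_transform_eventually)
  show "\<rho> (inst Z b \<psi>) = fibre \<psi> (tp L U Z (elts M) b)"
    using tendsto_Lim[OF sample_filter_not_bot lim] inst_in_forms_x[OF \<psi> b] by (simp add: \<rho>_def)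
qed

lemma \<rho>_limit:
  assumes "\<phi> \<in> forms L {x} (elts U)"
  shows "((av U \<phi>) \<longlongrightarrow> \<rho> \<phi>) sample_filter"
  using as_instance[OF assms] \<rho>_inst_limit by metis

lemma \<rho>_uniform:
  assumes \<psi>: "partitioned \<psi> Z" and e: "0 < \<epsilon>"
  obtains n l where "n \<noteq> 0" "\<And>k. k < n \<Longrightarrow> l k \<in> K"
    "\<And>b. b \<in> assign U Z \<Longrightarrow> \<bar>avg n l (solset U (inst Z b \<psi>)) - \<rho> (inst Z b \<psi>)\<bar> \<le> \<epsilon>"
proof -
  have e2: "0 < \<epsilon> / 2" using e by simp
  obtain p where p: "p \<in> samples {(\<psi>, Z)} (\<epsilon> / 2)"
    using eventually_happens'[OF sample_filter_not_bot eventually_samples[OF \<psi> e2]] by blast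
  obtain n l where nl: "p = (n, l)" by (cases p)
  have l: "n \<noteq> 0" "\<And>k. k < n \<Longrightarrow> l k \<in> K" using p by (auto simp: nl samples_def)
  have "\<bar>avg n l (solset U (inst Z b \<psi>)) - \<rho> (inst Z b \<psi>)\<bar> \<le> \<epsilon>" if b: "b \<in> assign U Z" for b
    using fibre_approx[OF \<psi> tp_U_in_types[OF \<psi> b] p e2] type_avg_U[OF \<psi> b l(2)] \<rho>_inst_limit(2)[OF \<psi> b] by (simp add: nl)
  with l show ?thesis by (rule that)
qed

text \<open>
  Averages over nonempty samples are probability measures, and the conditions are closed under limits.
\<close>

lemma keisler_limit:
  assumes y: "fst y = fst x" and ext: "\<nu> \<in> extensional (forms L {y} A)"
    and lim: "\<And>\<phi>. \<phi> \<in> forms L {y} A \<Longrightarrow> ((av U \<phi>) \<longlongrightarrow> \<nu> \<phi>) sample_filter"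
  shows "keisler L U y A \<nu>"
  unfolding keisler_def
proof (intro conjI ballI impI)
  show "\<nu> \<in> extensional (forms L {y} A)" by (rule ext)
  have K_assign: "(\<lambda>_. a) \<in> assign U {y}" if "a \<in> K" for a using that K_U by (auto simp: assign_def y)
  fix \<phi> assume \<phi>: "\<phi> \<in> forms L {y} A"
  show "0 \<le> \<nu> \<phi>"
    by (rule tendsto_lowerbound[OF lim[OF \<phi>] _ sample_filter_not_bot])
      (auto simp: avg_nonneg split: prod.split)
  fix \<psi> assume \<psi>: "\<psi> \<in> forms L {y} A"
  show "\<nu> \<phi> = \<nu> \<psi>" if eq: "\<forall>b\<in>assign U {y}. sat U b [] \<phi> \<longleftrightarrow> sat U b [] \<psi>"
  proof (rule tendsto_unique[OF sample_filter_not_bot lim[OF \<phi>]])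
    have "eventually (\<lambda>p. (av U \<psi>) p = (av U \<phi>) p) sample_filter"
      using eventually_in_K
    proof eventually_elim
      case (elim p)
      then show ?case using eq K_assign by (auto simp: solset_def intro!: avg_cong)
    qed
    with lim[OF \<psi>] show "((av U \<phi>) \<longlongrightarrow> \<nu> \<psi>) sample_filter"
      by (rule Lim_transform_eventually)
  qed
  show "\<nu> (Disj \<phi> \<psi>) = \<nu> \<phi> + \<nu> \<psi>" if dj: "\<forall>b\<in>assign U {y}. \<not> (sat U b [] \<phi> \<and> sat U b [] \<psi>)"
  proof (rule tendsto_unique[OF sample_filter_not_bot])
    show "((av U (Disj \<phi> \<psi>)) \<longlongrightarrow> \<nu> (Disj \<phi> \<psi>)) sample_filter"
      using \<phi> \<psi> by (intro lim) simp
    have "((\<lambda>p. (av U \<phi>) p + (av U \<psi>) p) \<longlongrightarrow> \<nu> \<phi> + \<nu> \<psi>) sample_filter"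
      by (intro tendsto_add lim \<phi> \<psi>)
    moreover have "eventually (\<lambda>p. (av U \<phi>) p + (av U \<psi>) p
        = (av U (Disj \<phi> \<psi>)) p) sample_filter"
      using eventually_in_K
    proof eventually_elim
      case (elim p)
      obtain n l where nl: "p = (n, l)" by (cases p)
      have "of_bool (l k \<in> solset U \<phi>) + of_bool (l k \<in> solset U \<psi>) = (of_bool (l k \<in> solset U (Disj \<phi> \<psi>)) :: real)"
        if "k < n" for k
        using elim that dj K_assign[of "l k"] by (auto simp: nl solset_def)
      then have "(\<Sum>k<n. of_bool (l k \<in> solset U \<phi>) + of_bool (l k \<in> solset U \<psi>)) =
          (\<Sum>k<n. of_bool (l k \<in> solset U (Disj \<phi> \<psi>)) :: real)" by (intro sum.cong) auto
      then show ?case unfolding nl avg_def case_prod_conv sum.distrib by (simp only: add_divide_distrib[symmetric])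
    qed
    ultimately show "((av U (Disj \<phi> \<psi>)) \<longlongrightarrow> \<nu> \<phi> + \<nu> \<psi>) sample_filter"
      by (rule Lim_transform_eventually)
  qed
next
  show "\<nu> (Neg Fls) = 1"
  proof (rule tendsto_unique[OF sample_filter_not_bot])
    show "((av U (Neg Fls)) \<longlongrightarrow> \<nu> (Neg Fls)) sample_filter" by (intro lim) simp
    have "eventually (\<lambda>p. 1 = (av U (Neg Fls)) p) sample_filter"
      using eventually_in_K by eventually_elim (auto simp: avg_def solset_def)
    with tendsto_const show "((av U (Neg Fls)) \<longlongrightarrow> 1) sample_filter"
      by (rule Lim_transform_eventually)
  qed
qed

lemma keisler_\<rho>: "keisler L U x (elts U) \<rho>"
  by (rule keisler_limit[OF refl _ \<rho>_limit]) (simp_all only: \<rho>_def restrict_extensional)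

lemma fibre_tp_M:
  assumes \<psi>: "partitioned \<psi> Z" and b: "b \<in> assign M Z"
  shows "fibre \<psi> (tp L M Z (elts M) b) = m (inst Z b \<psi>)"
proof (rule tendsto_unique[OF sample_filter_not_bot tendsto_fibre[OF \<psi> tp_in_types[OF b]]])
  show "(type_avg \<psi> (tp L M Z (elts M) b) \<longlongrightarrow> m (inst Z b \<psi>)) sample_filter"
  proof (rule tendstoI)
    fix \<epsilon> :: real assume e: "0 < \<epsilon>"
    then have "eventually (\<lambda>p. p \<in> samples {(\<psi>, Z)} (\<epsilon> / 2)) sample_filter" by (intro eventually_samples[OF \<psi>]) simp
    then show "eventually (\<lambda>p. dist (type_avg \<psi> (tp L M Z (elts M) b) p) (m (inst Z b \<psi>)) < \<epsilon>) sample_filter"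
    proof eventually_elim
      case (elim p)
      obtain n l where nl: "p = (n, l)" by (cases p)
      have "inst {x} (\<lambda>_. l k) \<psi> \<in> tp L M Z (elts M) b \<longleftrightarrow> l k \<in> solset M (inst Z b \<psi>)" if "k < n" for k
        using inst_x_in_forms[OF \<psi>, of "l k"] that elim sat_inst_x[OF \<psi>, of M b "l k"]
        by (auto simp: tp_def nl samples_def)
      then have "type_avg \<psi> (tp L M Z (elts M) b) p = avg n l (solset M (inst Z b \<psi>))"
        by (auto simp: type_avg_def nl intro!: avg_cong)
      moreover have "\<bar>avg n l (solset M (inst Z b \<psi>)) - m (inst Z b \<psi>)\<bar> \<le> \<epsilon> / 2"
        using elim b by (auto simp: nl samples_def)
      ultimately show ?case using e by (simp add: dist_real_def)
    qed
  qed
qed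

lemma restrict_\<rho>: "restrict \<rho> (forms L {x} (elts M)) = m"
proof
  fix \<phi>
  show "restrict \<rho> (forms L {x} (elts M)) \<phi> = m \<phi>"
  proof (cases "\<phi> \<in> forms L {x} (elts M)")
    case True
    then obtain Z b \<psi> where \<psi>: "partitioned \<psi> Z" and b: "b \<in> assign M Z" and \<phi>: "inst Z b \<psi> = \<phi>"
      by (rule as_instance)
    have bU: "b \<in> assign U Z" using assign_elementary[OF MU b] .
    have "tp L U Z (elts M) b = tp L M Z (elts M) b"
      using sat_elementary[OF MU _ _ b] \<psi> by (auto simp: tp_def partitioned_def)
    with \<rho>_inst_limit(2)[OF \<psi> bU] fibre_tp_M[OF \<psi> b] True show ?thesis by (simp add: \<phi>)
  next
    case False
    then show ?thesis by (simp only: restrict_def if_False extensional_arb[OF m_ext False])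
  qed
qed

lemma definable_\<rho>:
  assumes "small_model L \<kappa> U M"
  shows "definable_over L \<kappa> U x M \<rho>"
  unfolding definable_over_def restrict_\<rho> defining_map_def
proof (intro conjI allI ballI impI assms)
  fix Z and \<psi> :: "('s, 'f, 'r, 'u) form"
  assume "\<psi> \<in> forms L (insert x Z) {}" "finite Z \<and> x \<notin> Z"
  then have \<psi>: "partitioned \<psi> Z" by (simp add: partitioned_def)
  show "\<exists>F. (continuous_map (type_topology L M Z (elts M)) (top_of_set {0..1}) F \<and>
      (\<forall>b\<in>assign M Z. F (tp L M Z (elts M) b) = m (inst Z b \<psi>))) \<and>
      (\<forall>b\<in>assign U Z. \<rho> (inst Z b \<psi>) = F (tp L U Z (elts M) b))"
    using continuous_fibre[OF \<psi>] fibre_tp_M[OF \<psi>] \<rho>_inst_limit(2)[OF \<psi>] by blast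
qed

text \<open>
  The maps of two definable extensions of \<open>m\<close> agree at the types realized in \<open>M\<close>, hence everywhere.
\<close>

lemma hat_eq_\<rho>:
  assumes "small_model L \<kappa> U M"
  shows "hat L \<kappa> U x M m = \<rho>"
  unfolding hat_def
proof (rule the_equality)
  show "keisler L U x (elts U) \<rho> \<and> restrict \<rho> (forms L {x} (elts M)) = m \<and> definable_over L \<kappa> U x M \<rho>"
    using keisler_\<rho> restrict_\<rho> definable_\<rho>[OF assms] by blast
  fix \<rho>' assume \<rho>': "keisler L U x (elts U) \<rho>' \<and> restrict \<rho>' (forms L {x} (elts M)) = m \<and> definable_over L \<kappa> U x M \<rho>'"
  show "\<rho>' = \<rho>"
  proof
    fix \<phi>
    show "\<rho>' \<phi> = \<rho> \<phi>"
    proof (cases "\<phi> \<in> forms L {x} (elts U)")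
      case True
      then obtain Z b \<psi> where \<psi>: "partitioned \<psi> Z" and b: "b \<in> assign U Z" and \<phi>: "inst Z b \<psi> = \<phi>"
        by (rule as_instance)
      have "\<exists>F. defining_map L M m Z \<psi> F \<and> (\<forall>b\<in>assign U Z. \<rho>' (inst Z b \<psi>) = F (tp L U Z (elts M) b))"
        using \<rho>' \<psi> unfolding definable_over_def partitioned_def by metis
      then obtain F where F: "defining_map L M m Z \<psi> F" "\<rho>' \<phi> = F (tp L U Z (elts M) b)"
        using b \<phi> by blast
      have "F (tp L U Z (elts M) b) = fibre \<psi> (tp L U Z (elts M) b)"
      proof (rule continuous_types_eqI[OF _ continuous_fibre[OF \<psi>] _ tp_U_in_types[OF \<psi> b]])
        show "continuous_map (type_topology L M Z (elts M)) (top_of_set {0..1}) F"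
          using F(1) by (simp add: defining_map_def)
        show "F (tp L M Z (elts M) c) = fibre \<psi> (tp L M Z (elts M) c)" if "c \<in> assign M Z" for c
          using F(1) that fibre_tp_M[OF \<psi> that] by (simp add: defining_map_def)
      qed
      then show ?thesis using F(2) \<rho>_inst_limit(2)[OF \<psi> b] \<phi> by simp
    next
      case False
      have "\<rho>' \<in> extensional (forms L {x} (elts U))" "\<rho> \<in> extensional (forms L {x} (elts U))"
        using \<rho>' keisler_\<rho> by (simp_all only: keisler_def)
      then show ?thesis using extensional_arb[OF _ False] by metis
    qed
  qed
qed

text \<open>
  If the limit of the averages is positive, then so is some average, and a sample point in \<open>K\<close> satisfies
  the formula.
\<close>

lemma finitely_satisfiable_\<rho>: "finitely_satisfiable_in L U x M \<rho>"
  unfolding finitely_satisfiable_in_def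
proof (intro ballI impI)
  fix \<phi> assume \<phi>: "\<phi> \<in> forms L {x} (elts U)" "0 < \<rho> \<phi>"
  have "eventually (\<lambda>p. 0 < (av U \<phi>) p) sample_filter"
    using order_tendstoD(1)[OF \<rho>_limit[OF \<phi>(1)] \<phi>(2)] .
  then have "eventually (\<lambda>p. 0 < (av U \<phi>) p \<and> (\<lambda>(n, l). n \<noteq> 0 \<and> (\<forall>k<n. l k \<in> K)) p) sample_filter"
    using eventually_in_K by (rule eventually_conj)
  then obtain n l where nl: "0 < avg n l (solset U \<phi>)" "\<And>k. k < n \<Longrightarrow> l k \<in> K"
    using eventually_happens'[OF sample_filter_not_bot] by fastforce
  have "\<exists>k<n. l k \<in> solset U \<phi>"
  proof (rule ccontr)
    assume "\<not> ?thesis"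
    then have "avg n l (solset U \<phi>) = 0" by (auto simp: avg_def)
    with nl(1) show False by simp
  qed
  then obtain k where "k < n" "l k \<in> solset U \<phi>" by blast
  with nl(2) K show "\<exists>b\<in>assign M {x}. sat U b [] \<phi>"
    by (intro bexI[of _ "\<lambda>_. l k"]) (auto simp: solset_def assign_def)
qed

lemma generically_stable_\<rho>: "small_model L \<kappa> U M \<Longrightarrow> generically_stable L \<kappa> U x \<rho>"
  unfolding generically_stable_def using definable_\<rho> finitely_satisfiable_\<rho> by blast

end

section \<open>Integration over type spaces\<close>

text \<open>Regularity is stated for the sets of the measure; its space is recovered from them.\<close>

lemma type_measure_space:
  assumes K: "keisler L U y A \<nu>"
  defines "N \<equiv> type_measure L U y A \<nu>"
  shows "prob_space N" "space N = types L U {y} A"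
    "\<And>\<phi>. \<phi> \<in> forms L {y} A \<Longrightarrow> basic_clopen L U {y} A \<phi> \<in> sets N"
    "\<And>\<phi>. \<phi> \<in> forms L {y} A \<Longrightarrow> measure N (basic_clopen L U {y} A \<phi>) = \<nu> \<phi>"
proof -
  have rb: "regular_borel_prob (type_topology L U {y} A) N" unfolding N_def by (rule type_measure(1)[OF K])
  then show "prob_space N" by (simp add: regular_borel_prob_def)
  have s: "sets N = sigma_sets (topspace (type_topology L U {y} A)) {V. openin (type_topology L U {y} A) V}"
    using rb by (simp add: regular_borel_prob_def)
  let ?T = "topspace (type_topology L U {y} A)"
  have "sets N = sets (sigma ?T {V. openin (type_topology L U {y} A) V})"
    unfolding s by (rule sets_measure_of[symmetric]) (use openin_subset in blast)
  then have "space N = space (sigma ?T {V. openin (type_topology L U {y} A) V})" by (rule sets_eq_imp_space_eq)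
  also have "\<dots> = ?T" by (rule space_measure_of) (use openin_subset in blast)
  finally show "space N = types L U {y} A" by simp
  show "basic_clopen L U {y} A \<phi> \<in> sets N" if "\<phi> \<in> forms L {y} A" for \<phi>
    unfolding s using openin_basic_clopen[OF that] by (intro sigma_sets.Basic) simp
  show "measure N (basic_clopen L U {y} A \<phi>) = \<nu> \<phi>" if "\<phi> \<in> forms L {y} A" for \<phi>
    unfolding N_def by (rule type_measure(2)[OF K that])
qed

definition step_approximation ::
  "('s, 'f, 'r) glang \<Rightarrow> ('s, 'f, 'r, 'u) struct \<Rightarrow> 's var \<Rightarrow> ('s \<times> 'u) set \<Rightarrow>
    (('s, 'f, 'r, 'u) form set \<Rightarrow> real) \<Rightarrow> real \<Rightarrow> nat \<Rightarrow> (nat \<Rightarrow> ('s, 'f, 'r, 'u) form) \<Rightarrow> (nat \<Rightarrow> real) \<Rightarrow> bool"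
where
  "step_approximation L U y A F \<epsilon> n \<eta> t \<longleftrightarrow>
    (\<forall>i<n. \<eta> i \<in> forms L {y} A) \<and> (\<forall>i. 0 \<le> t i \<and> t i \<le> 1) \<and>
    (\<forall>q\<in>types L U {y} A. \<exists>i<n. (\<forall>k<n. \<eta> k \<in> q \<longleftrightarrow> k = i) \<and> \<bar>F q - t i\<bar> \<le> \<epsilon>)"

text \<open>
  A uniform limit of step functions on clopen sets is measurable, and the integral of such a step
  function is the obvious sum.
\<close>

lemma integral_step_approximation:
  assumes K: "keisler L U y A \<nu>"
    and step: "\<And>\<epsilon>. 0 < \<epsilon> \<Longrightarrow> \<exists>n \<eta> t. step_approximation L U y A F \<epsilon> n \<eta> t"
    and fit: "step_approximation L U y A F \<epsilon> n \<eta> t"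
  shows "\<bar>(\<integral>q. F q \<partial>type_measure L U y A \<nu>) - (\<Sum>i<n. t i * \<nu> (\<eta> i))\<bar> \<le> \<epsilon>"
proof -
  let ?N = "type_measure L U y A \<nu>"
  interpret prob_space ?N by (rule type_measure_space(1)[OF K])
  have sp: "space ?N = types L U {y} A" by (rule type_measure_space(2)[OF K])
  let ?c = "basic_clopen L U {y} A"
  define S :: "nat \<Rightarrow> (nat \<Rightarrow> ('a, 'b, 'c, 'd) form) \<Rightarrow> (nat \<Rightarrow> real) \<Rightarrow> ('a, 'b, 'c, 'd) form set \<Rightarrow> real"
    where "S n \<eta> t q = (\<Sum>i<n. t i * indicator (?c (\<eta> i)) q)" for n \<eta> t q
  have S_int: "integrable ?N (S n \<eta> t)" "(\<integral>q. S n \<eta> t q \<partial>?N) = (\<Sum>i<n. t i * \<nu> (\<eta> i))"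
    if "\<And>i. i < n \<Longrightarrow> \<eta> i \<in> forms L {y} A" for n \<eta> t
  proof -
    have i: "integrable ?N (\<lambda>q. t i * indicator (?c (\<eta> i)) q)" if "i < n" for i
      using type_measure_space(3)[OF K \<open>\<And>i. i < n \<Longrightarrow> \<eta> i \<in> forms L {y} A\<close>[OF that]]
      by (intro integrable_mult_right) (auto simp: emeasure_eq_measure)
    then show "integrable ?N (S n \<eta> t)" unfolding S_def by (intro Bochner_Integration.integrable_sum) auto
    have "(\<integral>q. S n \<eta> t q \<partial>?N) = (\<Sum>i<n. \<integral>q. t i * indicator (?c (\<eta> i)) q \<partial>?N)"
      unfolding S_def using i by (intro Bochner_Integration.integral_sum) auto
    also have "\<dots> = (\<Sum>i<n. t i * \<nu> (\<eta> i))"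
    proof (rule sum.cong)
      fix i assume "i \<in> {..<n}"
      then have \<eta>: "\<eta> i \<in> forms L {y} A" using that by simp
      have "(\<integral>q. t i * indicator (?c (\<eta> i)) q \<partial>?N) = t i * measure ?N (?c (\<eta> i))"
        using type_measure_space(3)[OF K \<eta>] by simp
      then show "(\<integral>q. t i * indicator (?c (\<eta> i)) q \<partial>?N) = t i * \<nu> (\<eta> i)"
        by (simp only: type_measure_space(4)[OF K \<eta>])
    qed simp
    finally show "(\<integral>q. S n \<eta> t q \<partial>?N) = (\<Sum>i<n. t i * \<nu> (\<eta> i))" .
  qed
  have S_eq: "\<bar>F q - S n \<eta> t q\<bar> \<le> \<epsilon> \<and> \<bar>S n \<eta> t q\<bar> \<le> 1"
    if st: "step_approximation L U y A F \<epsilon> n \<eta> t" and q: "q \<in> types L U {y} A" for \<epsilon> n \<eta> t q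
  proof -
    obtain i where i: "i < n" "\<And>k. k < n \<Longrightarrow> \<eta> k \<in> q \<longleftrightarrow> k = i" "\<bar>F q - t i\<bar> \<le> \<epsilon>"
      using st q unfolding step_approximation_def by blast
    have "t k * indicator (?c (\<eta> k)) q = (if k = i then t i else 0)" if "k < n" for k
      using i(2)[OF that] q by (simp add: basic_clopen_def indicator_def)
    then have "S n \<eta> t q = (\<Sum>k<n. if k = i then t i else 0)"
      unfolding S_def by (intro sum.cong) auto
    then have "S n \<eta> t q = t i" using i(1) by simp
    moreover have "0 \<le> t i \<and> t i \<le> 1" using st unfolding step_approximation_def by blast
    ultimately show ?thesis using i(3) by simp
  qed
  have "\<forall>k. \<exists>g. integrable ?N g \<and> (\<forall>q\<in>types L U {y} A. \<bar>F q - g q\<bar> \<le> 1 / real (Suc k) \<and> \<bar>g q\<bar> \<le> 1)"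
  proof
    fix k
    have "0 < 1 / real (Suc k)" by simp
    from step[OF this] obtain n \<eta> t where st: "step_approximation L U y A F (1 / real (Suc k)) n \<eta> t"
      by (elim exE)
    then have "integrable ?N (S n \<eta> t)" by (intro S_int) (simp add: step_approximation_def)
    with S_eq[OF st] show "\<exists>g. integrable ?N g \<and>
      (\<forall>q\<in>types L U {y} A. \<bar>F q - g q\<bar> \<le> 1 / real (Suc k) \<and> \<bar>g q\<bar> \<le> 1)" by blast
  qed
  from choice[OF this] obtain f where f': "\<forall>k. integrable ?N (f k) \<and>
      (\<forall>q\<in>types L U {y} A. \<bar>F q - f k q\<bar> \<le> 1 / real (Suc k) \<and> \<bar>f k q\<bar> \<le> 1)" by (elim exE)
  then have f: "\<And>k. integrable ?N (f k)"
    "\<And>k q. q \<in> types L U {y} A \<Longrightarrow> \<bar>F q - f k q\<bar> \<le> 1 / real (Suc k)"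
    "\<And>k q. q \<in> types L U {y} A \<Longrightarrow> \<bar>f k q\<bar> \<le> 1" by blast+
  have lim: "(\<lambda>k. f k q) \<longlonglongrightarrow> F q" if "q \<in> types L U {y} A" for q
  proof (rule Lim_null[THEN iffD2])
    show "(\<lambda>k. f k q - F q) \<longlonglongrightarrow> 0"
    proof (rule tendsto_rabs_zero_cancel, rule tendsto_sandwich[OF _ _ tendsto_const])
      show "(\<lambda>k. 1 / real (Suc k)) \<longlonglongrightarrow> 0" by (rule LIMSEQ_Suc[OF lim_1_over_n])
      show "eventually (\<lambda>k. \<bar>f k q - F q\<bar> \<le> 1 / real (Suc k)) sequentially"
        using f(2)[OF that] by (simp add: abs_minus_commute)
    qed simp
  qed
  have Fm: "F \<in> borel_measurable ?N"
    using lim f(1) by (intro borel_measurable_LIMSEQ_real[of ?N f F]) (auto simp: sp)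
  have Fi: "integrable ?N F"
  proof (rule integrable_const_bound[OF _ Fm])
    show "AE q in ?N. norm (F q) \<le> 2"
    proof (rule AE_I2)
      fix q assume "q \<in> space ?N"
      then have q: "q \<in> types L U {y} A" by (simp add: sp)
      show "norm (F q) \<le> 2" using f(2)[OF q, of 0] f(3)[OF q, of 0] by (simp add: abs_le_iff)
    qed
  qed
  have Si: "integrable ?N (S n \<eta> t)" "(\<integral>q. S n \<eta> t q \<partial>?N) = (\<Sum>i<n. t i * \<nu> (\<eta> i))"
    using S_int[of n \<eta> t] fit by (auto simp: step_approximation_def)
  have "\<bar>\<integral>q. F q - S n \<eta> t q \<partial>?N\<bar> \<le> (\<integral>q. \<bar>F q - S n \<eta> t q\<bar> \<partial>?N)"
    by (rule integral_abs_bound)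
  also have "\<dots> \<le> (\<integral>q. \<epsilon> \<partial>?N)"
  proof (rule integral_mono)
    show "integrable ?N (\<lambda>q. \<bar>F q - S n \<eta> t q\<bar>)" using Fi Si by auto
    fix q assume "q \<in> space ?N"
    then have q: "q \<in> types L U {y} A" by (simp add: sp)
    show "\<bar>F q - S n \<eta> t q\<bar> \<le> \<epsilon>" using S_eq[OF fit q] by blast
  qed simp
  also have "\<dots> = \<epsilon>" by (simp add: prob_space)
  finally show ?thesis using Fi Si by simp
qed

section \<open>Idempotence\<close>

lemma inst_inst:
  assumes "y \<notin> Z"
  shows "inst {y} (\<lambda>_. c) (inst Z b \<psi>) = inst (insert y Z) (b(y := c)) \<psi>"
  unfolding inst_def by (rule subst_subst) (use assms in auto)

lemma sum_swap_divide:
  fixes t :: "nat \<Rightarrow> real"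
  shows "(\<Sum>r<N. (\<Sum>i<n. t i * f i r) - (\<Sum>k<n'. g k r) / c) / d =
    (\<Sum>i<(n::nat). t i * ((\<Sum>r<(N::nat). f i r) / d)) - (\<Sum>k<(n'::nat). (\<Sum>r<N. g k r) / d) / c"
proof -
  have "(\<Sum>r<N. \<Sum>i<n. t i * f i r) = (\<Sum>i<n. t i * (\<Sum>r<N. f i r))"
    by (subst sum.swap) (simp only: sum_distrib_left)
  moreover have "(\<Sum>r<N. \<Sum>k<n'. g k r) = (\<Sum>k<n'. \<Sum>r<N. g k r)" by (rule sum.swap)
  ultimately have "(\<Sum>r<N. (\<Sum>i<n. t i * f i r) - (\<Sum>k<n'. g k r) / c) =
      (\<Sum>i<n. t i * (\<Sum>r<N. f i r)) - (\<Sum>k<n'. \<Sum>r<N. g k r) / c"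
    by (simp only: sum_subtractf sum_divide_distrib[symmetric])
  then show ?thesis
    by (simp add: diff_divide_distrib sum_divide_distrib[symmetric])
qed

lemma small_Un_finite:
  assumes "Card_order \<kappa>" "|UNIV :: nat set| <o \<kappa>" "|A| <o \<kappa>" "finite B"
  shows "|A \<union> B| <o \<kappa>"
proof -
  have nat: "cinfinite |UNIV :: nat set|" by (simp add: cinfinite_def Field_card_of)
  have \<kappa>: "Cinfinite \<kappa>" using assms(1) cinfinite_mono[OF ordLess_imp_ordLeq[OF assms(2)] nat] by simp
  have "Cfinite |B|" using assms(4) by (simp add: cfinite_def Field_card_of card_of_card_order_on)
  then have "|B| <o \<kappa>" using \<kappa> by (rule Cfinite_ordLess_Cinfinite)
  with assms(3) show ?thesis using \<kappa> by (rule Un_Cinfinite_bound_strict)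
qed

locale approximable_invariant = approximable L U M x K m
  for L :: "('s, 'f, 'r) glang" and U M :: "('s, 'f, 'r, 'u) struct" and x :: "'s var"
    and K :: "'u set" and m :: "('s, 'f, 'r, 'u) form \<Rightarrow> real" +
  assumes group_L: "group_lang L" and x_sort: "fst x = gsort L"
    and m_invariant: "\<And>a \<phi>. a \<in> K \<Longrightarrow> \<phi> \<in> forms L {x} (elts M) \<Longrightarrow> m (subst (ltrans L x a) \<phi>) = m \<phi>"
begin

lemma K_elts: "a \<in> K \<Longrightarrow> (gsort L, a) \<in> elts M"
  using K x_sort by (auto simp: elts_def)

text \<open>
  Over \<open>M\<close> the measures of an instance and its translate agree, so samples that are good for both
  formulas have close averages there. Membership of the finitely many sample points is expressed by
  formulas over \<open>M\<close> in the variables \<open>Z\<close>, so the averages are close over \<open>U\<close> too.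
\<close>

lemma \<rho>_invariant:
  assumes a: "a \<in> K" and \<phi>: "\<phi> \<in> forms L {x} (elts U)"
  shows "\<rho> (subst (ltrans L x a) \<phi>) = \<rho> \<phi>"
proof -
  obtain Z b \<psi> where \<psi>: "partitioned \<psi> Z" and b: "b \<in> assign U Z" and \<phi>eq: "inst Z b \<psi> = \<phi>"
    using \<phi> by (rule as_instance)
  have p: "\<psi> \<in> forms L (insert x Z) {}" "finite Z" "x \<notin> Z" using \<psi> by (auto simp: partitioned_def)
  obtain w where w: "fst w = gsort L" "w \<notin> insert x Z"
    using fresh_variable[of "insert x Z" "gsort L"] p(2) by auto
  define \<psi>' where "\<psi>' = subst (Var(x := Fn (gmul L) [Var w, Var x])) \<psi>"
  have \<psi>': "partitioned \<psi>' (insert w Z)"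
    using product_in_forms[OF group_L x_sort w(1) p(1)] p w by (auto simp: partitioned_def \<psi>'_def)
  have tr: "subst (ltrans L x a) (inst Z c \<psi>) = inst (insert w Z) (c(w := a)) \<psi>'" for c
    using ltrans_inst[OF p(1,3) w(2), of a c] by (simp add: ltrans_def w(1) \<psi>'_def)
  have aU: "(gsort L, a) \<in> elts U" using K_elts[OF a] elts_elementary[OF MU] by blast
  have lim: "((\<lambda>pr. (av U (subst (ltrans L x a) \<phi>)) pr - (av U \<phi>) pr)
      \<longlongrightarrow> \<rho> (subst (ltrans L x a) \<phi>) - \<rho> \<phi>) sample_filter"
    by (intro tendsto_diff \<rho>_limit \<phi> ltrans_in_forms[OF group_L x_sort aU])
  have "\<bar>\<rho> (subst (ltrans L x a) \<phi>) - \<rho> \<phi>\<bar> \<le> \<epsilon>" if e: "0 < \<epsilon>" for \<epsilon>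
  proof (rule tendsto_upperbound[OF tendsto_rabs[OF lim] _ sample_filter_not_bot])
    have e2: "0 < \<epsilon> / 2" using e by simp
    show "eventually (\<lambda>pr. \<bar>(av U (subst (ltrans L x a) \<phi>)) pr -
        (av U \<phi>) pr\<bar> \<le> \<epsilon>) sample_filter"
      using eventually_samples[OF \<psi> e2] eventually_samples[OF \<psi>' e2]
    proof eventually_elim
      case (elim pr)
      obtain n l where nl: "pr = (n, l)" by (cases pr)
      have lK: "l k \<in> K" if "k < n" for k using elim(1) that by (auto simp: nl samples_def)
      \<comment> \<open>membership of the sample points in both solution sets is expressed by formulas over \<open>M\<close> in the variables \<open>Z\<close>\<close>
      let ?\<theta> = "\<lambda>k. inst {x} (\<lambda>_. l k) \<psi>" and ?\<theta>' = "\<lambda>k. inst {x} (\<lambda>_. l k) (subst (ltrans L x a) \<psi>)"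
      have \<theta>: "?\<theta> k \<in> forms L Z (elts M)" if "k < n" for k by (rule inst_x_in_forms[OF \<psi> lK[OF that]])
      have "subst (ltrans L x a) \<psi> \<in> forms L (Z \<union> {x}) (elts M)"
        by (rule subst_in_forms[OF p(1)])
          (use group_L x_sort K_elts[OF a] in \<open>auto simp: ltrans_def group_lang_def\<close>)
      then have \<theta>': "?\<theta>' k \<in> forms L Z (elts M)" if "k < n" for k
        by (rule inst_in_forms) (use K_elts[OF lK[OF that]] x_sort in auto)
      have sat': "sat N c [] (?\<theta>' k) \<longleftrightarrow> l k \<in> solset N (subst (ltrans L x a) (inst Z c \<psi>))" for N c k
      proof -
        have "sat N c [] (?\<theta>' k) \<longleftrightarrow> sat N (\<lambda>v. if v = x then fint N (gmul L) [a, l k] else (if v \<in> {x} then l k else c v)) [] \<psi>"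
          unfolding sat_inst by (rule sat_subst) (simp add: ltrans_def)
        also have "\<dots> \<longleftrightarrow> sat N (\<lambda>v. if v \<in> Z then c v else if v = x then fint N (gmul L) [a, l k] else l k) [] \<psi>"
          by (rule sat_cong_forms[OF p(1)]) (use p(3) in auto)
        also have "\<dots> \<longleftrightarrow> sat N (\<lambda>v. if v = x then fint N (gmul L) [a, l k] else l k) [] (inst Z c \<psi>)"
          by (simp only: sat_inst)
        also have "\<dots> \<longleftrightarrow> sat N (\<lambda>_. l k) [] (subst (ltrans L x a) (inst Z c \<psi>))"
          by (rule sat_subst[symmetric]) (simp add: ltrans_def)
        finally show ?thesis by (simp add: solset_def)
      qed
      have "finite (?\<theta> ` {..<n} \<union> ?\<theta>' ` {..<n})" "?\<theta> ` {..<n} \<union> ?\<theta>' ` {..<n} \<subseteq> forms L Z (elts M)"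
        using \<theta> \<theta>' by auto
      from sat_elementary_finite[OF MU p(2) this b] obtain c where c: "c \<in> assign M Z"
        and "\<forall>\<theta>\<in>?\<theta> ` {..<n} \<union> ?\<theta>' ` {..<n}. sat M c [] \<theta> \<longleftrightarrow> sat U b [] \<theta>" by metis
      then have cs: "sat M c [] (?\<theta> k) \<longleftrightarrow> sat U b [] (?\<theta> k)" "sat M c [] (?\<theta>' k) \<longleftrightarrow> sat U b [] (?\<theta>' k)" if "k < n" for k
        using that by blast+
      have 1: "avg n l (solset U \<phi>) = avg n l (solset M (inst Z c \<psi>))"
        using cs(1) by (intro avg_cong) (simp add: sat_inst_x[OF \<psi>] \<phi>eq)
      have 2: "avg n l (solset U (subst (ltrans L x a) \<phi>)) = avg n l (solset M (subst (ltrans L x a) (inst Z c \<psi>)))"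
        using cs(2) by (intro avg_cong) (simp add: sat' \<phi>eq)
      have "\<bar>avg n l (solset M (inst Z c \<psi>)) - m (inst Z c \<psi>)\<bar> \<le> \<epsilon> / 2"
        using elim(1) c by (auto simp: nl samples_def)
      moreover have "c(w := a) \<in> assign M (insert w Z)"
        using c a K w x_sort by (auto simp: assign_def)
      then have "\<bar>avg n l (solset M (subst (ltrans L x a) (inst Z c \<psi>))) - m (subst (ltrans L x a) (inst Z c \<psi>))\<bar> \<le> \<epsilon> / 2"
        unfolding tr using elim(2) by (auto simp: nl samples_def simp del: fun_upd_apply)
      moreover have "m (subst (ltrans L x a) (inst Z c \<psi>)) = m (inst Z c \<psi>)"
        by (rule m_invariant[OF a inst_in_forms_x[OF \<psi> c]])
      ultimately show ?case unfolding nl case_prod_conv 1 2 by linarith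
    qed
  qed
  then show ?thesis using field_le_epsilon[of "\<bar>\<rho> (subst (ltrans L x a) \<phi>) - \<rho> \<phi>\<bar>" 0] by simp
qed

text \<open>
  Two approximations of the function \<open>\<rho>(\<phi>(x \<cdot> c))\<close> of \<open>c\<close> are compared. Definability over \<open>G\<close> gives a step
  function with clopen pieces over \<open>G\<close> and the parameters of \<open>\<phi>\<close>, whose integral is close to the
  convolution. A sample from \<open>K\<close> gives the average of the indicators of the translates of \<open>\<phi>\<close> by the
  sample points; by invariance each translate has measure \<open>\<rho>(\<phi>)\<close>. The sample points may lie outside \<open>G\<close>, so the
  second function does not live on the same type space. Both are combinations of indicators of
  definable sets that are close at all points of \<open>U\<close>; averages over samples preserve this, and so does
  \<open>\<rho>\<close> as their limit.
\<close>

lemma convolution_\<rho>: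
  assumes mon: "monster_model L \<kappa> U" and y: "fst y = gsort L" "x \<noteq> y"
    and G: "definable_over L \<kappa> U x G \<rho>"
  shows "convolution L U G x y \<rho> \<rho> = \<rho>"
proof
  fix \<phi>
  show "convolution L U G x y \<rho> \<rho> \<phi> = \<rho> \<phi>"
  proof (cases "\<phi> \<in> forms L {x} (elts U)")
    case False
    have "\<rho> \<in> extensional (forms L {x} (elts U))" using keisler_\<rho> by (simp only: keisler_def)
    from extensional_arb[OF this False] False show ?thesis by (simp only: convolution_def restrict_apply if_False)
  next
    case \<phi>: True
    define \<phi>' where "\<phi>' = subst (Var(x := Fn (gmul L) [Var x, Var y])) \<phi>"
    have \<phi>': "\<phi>' \<in> forms L {x, y} (elts U)"
      unfolding \<phi>'_def by (rule subst_in_forms[OF \<phi>]) (use group_L x_sort y in \<open>auto simp: group_lang_def\<close>)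
    define A where "A = elts G \<union> par \<phi>'"
    have GU: "elementary_substruct L G U" and smallG: "|elts G| <o \<kappa>"
      using G by (auto simp: definable_over_def small_model_def)
    have AU: "A \<subseteq> elts U" using elts_elementary[OF GU] \<phi>' by (auto simp: A_def forms_def)
    have Asmall: "|A| <o \<kappa>"
      unfolding A_def using mon smallG by (intro small_Un_finite finite_par) (auto simp: monster_model_def)
    define \<nu> where "\<nu> = restrict (in_variable L U x y \<rho>) (forms L {y} A)"
    have sub: "subst (Var(y := Var x)) \<psi> \<in> forms L {x} (elts U)" if "\<psi> \<in> forms L {y} (elts U)" for \<psi>
      by (rule subst_in_forms[OF that]) (use x_sort y in auto)
    have sol: "solset U (subst (Var(y := Var x)) \<psi>) = solset U \<psi>" for \<psi>
      unfolding solset_def by (rule Collect_cong, rule sat_subst) simp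
    have \<nu>_eq: "\<nu> \<psi> = \<rho> (subst (Var(y := Var x)) \<psi>)" if "\<psi> \<in> forms L {y} A" for \<psi>
      using that forms_mono[OF that subset_refl AU] by (simp add: \<nu>_def in_variable_def)
    have \<nu>_lim: "((av U \<psi>) \<longlongrightarrow> \<nu> \<psi>) sample_filter" if "\<psi> \<in> forms L {y} A" for \<psi>
      using \<rho>_limit[OF sub[OF forms_mono[OF that subset_refl AU]]] unfolding \<nu>_eq[OF that] sol .
    have K\<nu>: "keisler L U y A \<nu>"
      by (rule keisler_limit[OF _ _ \<nu>_lim]) (simp_all add: \<nu>_def x_sort y del: restrict_apply)
    obtain Z b \<theta> where Z: "finite Z" "{x, y} \<inter> Z = {}" "\<theta> \<in> forms L ({x, y} \<union> Z) {}" "inst Z b \<theta> = \<phi>'"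
      "\<And>w. w \<in> Z \<Longrightarrow> (fst w, b w) \<in> par \<phi>'"
      by (rule abstract_parameters[OF \<phi>']) auto
    have \<theta>: "partitioned \<theta> (insert y Z)" using Z y by (auto simp: partitioned_def insert_commute)
    have bU: "b(y := c) \<in> assign U (insert y Z)" if "c \<in> carr U (fst y)" for c
      using Z(5) \<phi>' that by (fastforce simp: assign_def forms_def elts_def)
    have iy: "inst {y} (\<lambda>_. c) \<phi>' = inst (insert y Z) (b(y := c)) \<theta>" for c
      unfolding Z(4)[symmetric] by (rule inst_inst) (use Z(2) in auto)
    define F where "F q = (let c = SOME c. c \<in> carr U (fst y) \<and> tp L U {y} A (\<lambda>_. c) = q in \<rho> (inst {y} (\<lambda>_. c) \<phi>'))" for q
    have conv: "convolution L U G x y \<rho> \<rho> \<phi> = (\<integral>q. F q \<partial>type_measure L U y A \<nu>)"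
      by (simp only: convolution_def morley_product_def restrict_apply \<phi> \<phi>' if_True
          \<phi>'_def[symmetric] A_def[symmetric] \<nu>_def[symmetric] F_def Let_def)
    obtain F\<theta> where F\<theta>: "continuous_map (type_topology L G (insert y Z) (elts G)) (top_of_set {0..1}) F\<theta>"
      "\<And>d. d \<in> assign U (insert y Z) \<Longrightarrow> \<rho> (inst (insert y Z) d \<theta>) = F\<theta> (tp L U (insert y Z) (elts G) d)"
    proof -
      have "\<exists>F. defining_map L G (restrict \<rho> (forms L {x} (elts G))) (insert y Z) \<theta> F \<and>
             (\<forall>b\<in>assign U (insert y Z). \<rho> (inst (insert y Z) b \<theta>) = F (tp L U (insert y Z) (elts G) b))"
        using G \<theta> unfolding definable_over_def partitioned_def by metis
      then show ?thesis using that unfolding defining_map_def by blast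
    qed
    \<comment> \<open>the pieces come from a partition of the type space over \<open>G\<close> in \<open>y\<close> and the variables for the parameters of \<open>\<phi>'\<close>\<close>
    have step: "\<exists>(n::nat) \<eta> t. (\<forall>i<n. \<eta> i \<in> forms L {y} A) \<and> (\<forall>i. 0 \<le> t i \<and> t i \<le> 1) \<and>
      (\<forall>c\<in>carr U (fst y). \<exists>i<n. (\<forall>k<n. c \<in> solset U (\<eta> k) \<longleftrightarrow> k = i) \<and>
        \<bar>\<rho> (inst {y} (\<lambda>_. c) \<phi>') - t i\<bar> \<le> \<epsilon>)" if e: "0 < \<epsilon>" for \<epsilon>
    proof -
      obtain n :: nat and \<xi> t where \<xi>: "\<And>i. i < n \<Longrightarrow> \<xi> i \<in> forms L (insert y Z) (elts G)"
        "\<And>q. q \<in> types L G (insert y Z) (elts G) \<Longrightarrow> \<exists>!i. i < n \<and> \<xi> i \<in> q"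
        "\<And>q i. q \<in> types L G (insert y Z) (elts G) \<Longrightarrow> i < n \<Longrightarrow> \<xi> i \<in> q \<Longrightarrow> \<bar>F\<theta> q - t i\<bar> \<le> \<epsilon>"
        "\<And>i. 0 \<le> t i \<and> t i \<le> 1"
        by (rule continuous_types_partition[OF F\<theta>(1) e]) blast
      have \<eta>: "inst Z b (\<xi> i) \<in> forms L {y} A" if "i < n" for i
        by (rule inst_in_forms[of _ _ _ _ "elts G"]) (use \<xi>(1)[OF that] Z(5) in \<open>auto simp: A_def\<close>)
      have main: "\<exists>i<n. (\<forall>k<n. c \<in> solset U (inst Z b (\<xi> k)) \<longleftrightarrow> k = i) \<and>
        \<bar>\<rho> (inst {y} (\<lambda>_. c) \<phi>') - t i\<bar> \<le> \<epsilon>" if c: "c \<in> carr U (fst y)" for c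
      proof -
        let ?q = "tp L U (insert y Z) (elts G) (b(y := c))"
        have q: "?q \<in> types L G (insert y Z) (elts G)"
          using Z(1) by (intro tp_in_types_elementary[OF GU _ bU[OF c]]) auto
        have mem: "c \<in> solset U (inst Z b (\<xi> i)) \<longleftrightarrow> \<xi> i \<in> ?q" if "i < n" for i
        proof -
          have "sat U (\<lambda>w. if w \<in> Z then b w else c) [] (\<xi> i) \<longleftrightarrow> sat U (b(y := c)) [] (\<xi> i)"
            by (rule sat_cong_forms[OF \<xi>(1)[OF that]]) (use Z(2) in auto)
          then show ?thesis using \<xi>(1)[OF that] by (simp add: mem_solset_inst tp_def del: fun_upd_apply)
        qed
        obtain i where i: "i < n" "\<xi> i \<in> ?q" "\<And>k. k < n \<Longrightarrow> \<xi> k \<in> ?q \<Longrightarrow> k = i"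
          using \<xi>(2)[OF q] by (elim ex1E) blast
        have "\<bar>\<rho> (inst {y} (\<lambda>_. c) \<phi>') - t i\<bar> \<le> \<epsilon>"
          unfolding iy F\<theta>(2)[OF bU[OF c]] by (rule \<xi>(3)[OF q i(1,2)])
        moreover have "\<forall>k<n. c \<in> solset U (inst Z b (\<xi> k)) \<longleftrightarrow> k = i" using mem i by blast
        ultimately show ?thesis using i(1) by blast
      qed
      show ?thesis
        using \<eta> \<xi>(4) main by (intro exI[of _ n] exI[of _ "\<lambda>i. inst Z b (\<xi> i)"] exI[of _ t]) blast
    qed
    \<comment> \<open>saturation realizes the types over the small set \<open>A\<close>, so the choice in \<open>F\<close> succeeds\<close>
    have real: "\<exists>c\<in>carr U (fst y). tp L U {y} A (\<lambda>_. c) = q \<and> F q = \<rho> (inst {y} (\<lambda>_. c) \<phi>')"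
      if q: "q \<in> types L U {y} A" for q
    proof -
      have "\<exists>c. c \<in> carr U (fst y) \<and> tp L U {y} A (\<lambda>_. c) = q"
        using mon q AU Asmall unfolding monster_model_def saturated_def by blast
      from someI_ex[OF this] show ?thesis unfolding F_def Let_def by blast
    qed
    have step_types: "step_approximation L U y A F \<epsilon> n \<eta> t"
      if \<eta>: "\<forall>i<n. \<eta> i \<in> forms L {y} A" and t: "\<forall>i. 0 \<le> t i \<and> t i \<le> 1"
        and c: "\<forall>c\<in>carr U (fst y). \<exists>i<n. (\<forall>k<n. c \<in> solset U (\<eta> k) \<longleftrightarrow> k = i) \<and>
        \<bar>\<rho> (inst {y} (\<lambda>_. c) \<phi>') - t i\<bar> \<le> \<epsilon>" for n \<eta> t \<epsilon>
      unfolding step_approximation_def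
    proof (intro conjI ballI \<eta> t)
      fix q assume q: "q \<in> types L U {y} A"
      obtain d where d: "d \<in> carr U (fst y)" "tp L U {y} A (\<lambda>_. d) = q" "F q = \<rho> (inst {y} (\<lambda>_. d) \<phi>')"
        using real[OF q] by blast
      have mem: "\<eta> i \<in> q \<longleftrightarrow> d \<in> solset U (\<eta> i)" if "i < n" for i
        using \<eta> that unfolding d(2)[symmetric] by (simp add: tp_def solset_def)
      show "\<exists>i<n. (\<forall>k<n. \<eta> k \<in> q \<longleftrightarrow> k = i) \<and> \<bar>F q - t i\<bar> \<le> \<epsilon>"
        using bspec[OF c d(1)] mem unfolding d(3) by blast
    qed
    have "\<bar>convolution L U G x y \<rho> \<rho> \<phi> - \<rho> \<phi>\<bar> \<le> \<epsilon>" if e: "0 < \<epsilon>" for \<epsilon>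
    proof -
      have e3: "0 < \<epsilon> / 3" using e by simp
      obtain n :: nat and \<eta> t where st: "\<forall>i<n. \<eta> i \<in> forms L {y} A" "\<forall>i. 0 \<le> t i \<and> t i \<le> 1"
        "\<forall>c\<in>carr U (fst y). \<exists>i<n. (\<forall>k<n. c \<in> solset U (\<eta> k) \<longleftrightarrow> k = i) \<and>
        \<bar>\<rho> (inst {y} (\<lambda>_. c) \<phi>') - t i\<bar> \<le> \<epsilon> / 3"
        using step[OF e3] by (elim exE conjE)
      let ?\<Sigma> = "\<Sum>i<n. t i * \<nu> (\<eta> i)"
      have 1: "\<bar>convolution L U G x y \<rho> \<rho> \<phi> - ?\<Sigma>\<bar> \<le> \<epsilon> / 3"
        unfolding conv
      proof (rule integral_step_approximation[OF K\<nu> _ step_types[OF st]])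
        show "\<exists>n \<eta> t. step_approximation L U y A F \<delta> n \<eta> t" if "0 < \<delta>" for \<delta>
          using step[OF that] by (elim exE conjE) (intro exI, rule step_types)
      qed
      obtain n0 l0 where l0: "n0 \<noteq> 0" "\<And>k. k < n0 \<Longrightarrow> l0 k \<in> K"
        "\<And>d. d \<in> assign U (insert y Z) \<Longrightarrow> \<bar>avg n0 l0 (solset U (inst (insert y Z) d \<theta>)) - \<rho> (inst (insert y Z) d \<theta>)\<bar> \<le> \<epsilon> / 3"
        using \<rho>_uniform[OF \<theta> e3] by metis
      have tr: "subst (ltrans L x (l0 k)) \<phi> \<in> forms L {x} (elts U)" if "k < n0" for k
        using K_elts[OF l0(2)[OF that]] elts_elementary[OF MU]
        by (intro ltrans_in_forms[OF group_L x_sort _ \<phi>]) auto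
      have mem: "l0 k \<in> solset U (inst (insert y Z) (b(y := c)) \<theta>) \<longleftrightarrow> c \<in> solset U (subst (ltrans L x (l0 k)) \<phi>)" for k c
      proof -
        have "l0 k \<in> solset U (inst {y} (\<lambda>_. c) \<phi>') \<longleftrightarrow> sat U (\<lambda>w. if w \<in> {y} then c else l0 k) [] \<phi>'"
          by (rule mem_solset_inst)
        also have "\<dots> \<longleftrightarrow> sat U (\<lambda>w. if w = x then fint U (gmul L) [l0 k, c] else if w \<in> {y} then c else l0 k) [] \<phi>"
          unfolding \<phi>'_def by (rule sat_subst) (use y(2) in auto)
        also have "\<dots> \<longleftrightarrow> sat U (\<lambda>_. fint U (gmul L) [l0 k, c]) [] \<phi>"
          by (rule sat_cong_forms[OF \<phi>]) simp
        also have "\<dots> \<longleftrightarrow> c \<in> solset U (subst (ltrans L x (l0 k)) \<phi>)"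
          unfolding mem_solset_ltrans[OF \<phi>] by (simp add: solset_def)
        finally show ?thesis by (simp only: iy)
      qed
      \<comment> \<open>both functions are \<open>\<epsilon> / 3\<close>-close to \<open>\<rho>(\<phi>(x \<cdot> c))\<close>\<close>
      have pt: "\<bar>(\<Sum>i<n. t i * of_bool (c \<in> solset U (\<eta> i))) -
          (\<Sum>k<n0. of_bool (c \<in> solset U (subst (ltrans L x (l0 k)) \<phi>))) / real n0\<bar> \<le> 2 * \<epsilon> / 3"
        if c: "c \<in> carr U (fst y)" for c
      proof -
        obtain i where i: "i < n" "\<And>k. k < n \<Longrightarrow> c \<in> solset U (\<eta> k) \<longleftrightarrow> k = i"
          "\<bar>\<rho> (inst {y} (\<lambda>_. c) \<phi>') - t i\<bar> \<le> \<epsilon> / 3"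
          using bspec[OF st(3) c] by blast
        have "(\<Sum>i<n. t i * of_bool (c \<in> solset U (\<eta> i))) = (\<Sum>k<n. if k = i then t i else 0)"
          using i(2) by (intro sum.cong) auto
        then have s1: "(\<Sum>i<n. t i * of_bool (c \<in> solset U (\<eta> i))) = t i" using i(1) by simp
        have s2: "(\<Sum>k<n0. of_bool (c \<in> solset U (subst (ltrans L x (l0 k)) \<phi>))) / real n0 =
            avg n0 l0 (solset U (inst (insert y Z) (b(y := c)) \<theta>))" by (simp only: avg_def mem)
        from i(3) l0(3)[OF bU[OF c]] show ?thesis unfolding s1 s2 iy by linarith
      qed
      have avs: "\<bar>(\<Sum>i<n. t i * avg N l (solset U (\<eta> i))) -
          (\<Sum>k<n0. avg N l (solset U (subst (ltrans L x (l0 k)) \<phi>))) / real n0\<bar> \<le> 2 * \<epsilon> / 3"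
        if N: "N \<noteq> 0" and l: "\<And>r. r < N \<Longrightarrow> l r \<in> K" for N l
      proof -
        let ?d = "\<lambda>c. (\<Sum>i<n. t i * of_bool (c \<in> solset U (\<eta> i))) -
          (\<Sum>k<n0. of_bool (c \<in> solset U (subst (ltrans L x (l0 k)) \<phi>))) / real n0"
        have "(\<Sum>r<N. ?d (l r)) / real N = (\<Sum>i<n. t i * avg N l (solset U (\<eta> i))) -
          (\<Sum>k<n0. avg N l (solset U (subst (ltrans L x (l0 k)) \<phi>))) / real n0"
          unfolding avg_def by (rule sum_swap_divide)
        moreover have "\<bar>(\<Sum>r<N. ?d (l r)) / real N\<bar> \<le> 2 * \<epsilon> / 3"
        proof -
          have "\<bar>\<Sum>r<N. ?d (l r)\<bar> \<le> (\<Sum>r<N. \<bar>?d (l r)\<bar>)" by (rule sum_abs)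
          also have "\<dots> \<le> (\<Sum>r<N. 2 * \<epsilon> / 3)"
            using l K_U x_sort y(1) by (intro sum_mono pt) auto
          finally have "\<bar>\<Sum>r<N. ?d (l r)\<bar> \<le> real N * (2 * \<epsilon> / 3)" by simp
          then show ?thesis using N by (simp add: abs_divide pos_divide_le_eq mult.commute)
        qed
        ultimately show ?thesis by simp
      qed
      have 2: "\<bar>?\<Sigma> - (\<Sum>k<n0. \<rho> (subst (ltrans L x (l0 k)) \<phi>)) / real n0\<bar> \<le> 2 * \<epsilon> / 3"
      proof (rule tendsto_upperbound[OF _ _ sample_filter_not_bot])
        let ?a = "av U"
        show "((\<lambda>p. \<bar>(\<Sum>i<n. t i * ?a (\<eta> i) p) - (\<Sum>k<n0. ?a (subst (ltrans L x (l0 k)) \<phi>) p) / real n0\<bar>)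
          \<longlongrightarrow> \<bar>?\<Sigma> - (\<Sum>k<n0. \<rho> (subst (ltrans L x (l0 k)) \<phi>)) / real n0\<bar>) sample_filter"
          using st(1) tr l0(1) by (intro tendsto_intros \<nu>_lim \<rho>_limit) auto
        show "eventually (\<lambda>p. \<bar>(\<Sum>i<n. t i * ?a (\<eta> i) p) - (\<Sum>k<n0. ?a (subst (ltrans L x (l0 k)) \<phi>) p) / real n0\<bar> \<le> 2 * \<epsilon> / 3) sample_filter"
          using eventually_in_K
        proof eventually_elim
          case (elim p)
          obtain N l where p: "p = (N, l)" by (cases p)
          show ?case unfolding p case_prod_conv using elim by (intro avs) (auto simp: p)
        qed
      qed
      have "(\<Sum>k<n0. \<rho> (subst (ltrans L x (l0 k)) \<phi>)) = (\<Sum>k<n0. \<rho> \<phi>)"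
        using l0(2) by (intro sum.cong \<rho>_invariant \<phi>) auto
      then have "(\<Sum>k<n0. \<rho> (subst (ltrans L x (l0 k)) \<phi>)) / real n0 = \<rho> \<phi>" using l0(1) by simp
      with 1 2 show ?thesis by linarith
    qed
    then show ?thesis using field_le_epsilon[of "\<bar>convolution L U G x y \<rho> \<rho> \<phi> - \<rho> \<phi>\<bar>" 0] by simp
  qed
qed

end

theorem theorem5p5:
  fixes L :: "('s, 'f, 'r) glang"
    and G :: "'i \<Rightarrow> ('s, 'f, 'r, 'a) struct"
    and H :: "'i \<Rightarrow> 'a set"
    and D :: "'i filter"
    and \<kappa> :: "'k rel"
    and U M :: "('s, 'f, 'r, 'u) struct"
    and j :: "'s \<Rightarrow> ('i \<Rightarrow> 'a) set \<Rightarrow> 'u"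
    and x y :: "'s \<times> nat"
  assumes "group_lang L"
    and "infinite (UNIV :: 'i set)"
    and "\<And>i. expands_group L (G i)"
    and "\<And>i. subgroup (H i) (grp L (G i))"
    and "\<And>i. finite (H i)"
    and "ultrafilter D" and "nonprincipal D"
    and "monster_model L \<kappa> U"
    and "isomorphism L (ultraproduct L D G) M j"
    and "small_model L \<kappa> U M"
    and "fst x = gsort L" and "fst y = gsort L" and "x \<noteq> y"
    and "NIP L (ultraproduct L D G)"
  defines "\<mu> \<equiv> ultralimit L D G x (\<lambda>i. uniform_measure_on L (G i) x (H i))"
  defines "\<mu>_hat \<equiv> hat L \<kappa> U x M (transport L (ultraproduct L D G) M j x \<mu>)"
  shows "keisler L U x (elts U) \<mu>_hat \<and>
         generically_stable L \<kappa> U x \<mu>_hat \<and>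
         idempotent_measure L \<kappa> U x y \<mu>_hat"
proof -
  interpret T: transported L D G H x M j
    by (intro transported.intro transported_axioms.intro ultra_finite_subgroups.intro
        ultra_finite_subgroups_axioms.intro ultra_struct.intro)
      (use assms(1,3-6,9,11,14) in \<open>auto simp: expands_group_def\<close>)
  have \<mu>: "\<mu> = T.\<mu>" unfolding \<mu>_def T.\<mu>_def ..
  interpret A: approximable_invariant L U M x T.K T.m
  proof
    show "elementary_substruct L M U" using assms(10) by (simp add: small_model_def)
    show "T.K \<subseteq> carr M (fst x)" by (rule T.K_carr)
    show "T.m \<in> extensional (forms L {x} (elts M))" by (simp only: transport_def restrict_extensional)
    show "group_lang L" "fst x = gsort L" by fact+
    show "T.m (subst (ltrans L x a) \<phi>) = T.m \<phi>" if "a \<in> T.K" "\<phi> \<in> forms L {x} (elts M)" for a \<phi>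
      using that by (rule T.m_ltrans)
  qed (rule T.approximation_transported)
  have "\<mu>_hat = A.\<rho>" unfolding \<mu>_hat_def \<mu> by (rule A.hat_eq_\<rho>[OF assms(10)])
  moreover have "idempotent_measure L \<kappa> U x y A.\<rho>"
    unfolding idempotent_measure_def
    using A.definable_\<rho>[OF assms(10)] A.convolution_\<rho>[OF assms(8,12,13)] by blast
  ultimately show ?thesis using A.keisler_\<rho> A.generically_stable_\<rho>[OF assms(10)] by simp
qed

end
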